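(* Let $m,n$ be positive integers with $\gcd(m,n)=1$ and let $\mathbb{H}_{m/n}=\{(z_1,z_2)\in\mathbb{C}^2: |z_1|^{m/n}<|z_2|<1\}$. For each $p$ with $2\le p<\infty$ there is a bounded linear operator $\widetilde{\mathbf{P}}:L^2(\mathbb{H}_{m/n})\to A^2(\mathbb{H}_{m/n})$ given by an integral formula $\widetilde{\mathbf{P}}f(z)=\int_{\mathbb{H}_{m/n}}\widetilde P(z,w)f(w)\,dV(w)$ such that (i) $|\widetilde{\mathbf{P}}|$ is bounded on $L^p(\mathbb{H}_{m/n})$: there is $C>0$ with $\big\||\widetilde{\mathbf{P}}|f\big\|_p\le C\|f\|_p$ for all $f\in L^p(\mathbb{H}_{m/n})$; (ii) $\widetilde{\mathbf{P}}h=h$ for all $h\in A^p(\mathbb{H}_{m/n})$. Moreover, for every $g\in L^p(\mathbb{H}_{m/n})$, $\widetilde{\mathbf{P}}g$ is the unique $L^2$-nearest element of $A^p(\mathbb{H}_{m/n})$ to $g$; that is, $\widetilde{\mathbf{P}}g\in A^p(\mathbb{H}_{m/n})$ and $\|g-\widetilde{\mathbf{P}}g\|_{2}\le\|g-h\|_{2}$ for all $h\in A^p(\mathbb{H}_{m/n})$, with equality only if $h=\widetilde{\mathbf{P}}g$.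
   Context: $dV$ is Lebesgue measure; $A^p(\Omega)$ is the Bergman space of holomorphic functions on $\Omega$ lying in $L^p(\Omega)$, with the $L^p$ norm $\|\cdot\|_p$. For an operator $\mathbf{P}$ with kernel $P(z,w)$, $|\mathbf{P}|$ is defined by $|\mathbf{P}|f(z)=\int_\Omega|P(z,w)|f(w)\,dV(w)$. *)

theory Defs
  imports "HOL-Analysis.Analysis"
begin

definition rational_hartogs :: "nat \<Rightarrow> nat \<Rightarrow> (complex \<times> complex) set" where
  "rational_hartogs m n =
     {(z1, z2). norm z1 powr (real m / real n) < norm z2 \<and> norm z2 < 1}"

text \<open>
  Elements of the spaces below are functions on the whole type, but all notions depend only on
  their values on \<open>\<Omega>\<close>; two functions are identified when they agree almost everywhere
  on \<open>\<Omega>\<close>, respectively everywhere on \<open>\<Omega>\<close> in the holomorphic case.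
\<close>

definition Lp_space :: "real \<Rightarrow> 'a::euclidean_space set \<Rightarrow> ('a \<Rightarrow> complex) set" where
  "Lp_space p \<Omega> =
     {f. f \<in> borel_measurable (lebesgue_on \<Omega>) \<and>
         integrable (lebesgue_on \<Omega>) (\<lambda>z. norm (f z) powr p)}"

definition Lp_norm :: "real \<Rightarrow> 'a::euclidean_space set \<Rightarrow> ('a \<Rightarrow> complex) \<Rightarrow> real" where
  "Lp_norm p \<Omega> f = (integral\<^sup>L (lebesgue_on \<Omega>) (\<lambda>z. norm (f z) powr p)) powr (1 / p)"

text \<open>
  Holomorphy in two variables on an open set: the Frechet derivative exists at every point and is
  complex linear, i.e. of the form \<open>(h1, h2) \<mapsto> a * h1 + b * h2\<close>.
\<close>

definition holomorphic2_on :: "(complex \<times> complex \<Rightarrow> complex) \<Rightarrow> (complex \<times> complex) set \<Rightarrow> bool" where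
  "holomorphic2_on f \<Omega> \<longleftrightarrow>
     (\<forall>z\<in>\<Omega>. \<exists>a b. (f has_derivative (\<lambda>h. a * fst h + b * snd h)) (at z within \<Omega>))"

definition bergman_space :: "real \<Rightarrow> (complex \<times> complex) set \<Rightarrow> (complex \<times> complex \<Rightarrow> complex) set" where
  "bergman_space p \<Omega> = {f \<in> Lp_space p \<Omega>. holomorphic2_on f \<Omega>}"

definition bounded_linear_L2_A2 ::
  "(complex \<times> complex) set \<Rightarrow>
   ((complex \<times> complex \<Rightarrow> complex) \<Rightarrow> complex \<times> complex \<Rightarrow> complex) \<Rightarrow> bool" where
  "bounded_linear_L2_A2 \<Omega> P \<longleftrightarrow>
     (\<forall>f\<in>Lp_space 2 \<Omega>. P f \<in> bergman_space 2 \<Omega>) \<and>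
     (\<forall>f\<in>Lp_space 2 \<Omega>. \<forall>g\<in>Lp_space 2 \<Omega>. \<forall>z\<in>\<Omega>. P (\<lambda>w. f w + g w) z = P f z + P g z) \<and>
     (\<forall>c. \<forall>f\<in>Lp_space 2 \<Omega>. \<forall>z\<in>\<Omega>. P (\<lambda>w. c * f w) z = c * P f z) \<and>
     (\<exists>C>0. \<forall>f\<in>Lp_space 2 \<Omega>. Lp_norm 2 \<Omega> (P f) \<le> C * Lp_norm 2 \<Omega> f)"

definition integral_operator ::
  "'a::euclidean_space set \<Rightarrow> ('a \<Rightarrow> 'a \<Rightarrow> complex) \<Rightarrow> ('a \<Rightarrow> complex) \<Rightarrow> 'a \<Rightarrow> complex" where
  "integral_operator \<Omega> K f z = integral\<^sup>L (lebesgue_on \<Omega>) (\<lambda>w. K z w * f w)"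

text \<open>
  Bochner integrals of non-integrable functions are 0 by convention, so convergence of the
  integrals is required explicitly: at every point of \<open>\<Omega>\<close> when the integral is to represent a
  holomorphic function, and almost everywhere for boundedness on \<open>L^p\<close>.
\<close>

definition has_integral_kernel_L2 ::
  "'a::euclidean_space set \<Rightarrow> (('a \<Rightarrow> complex) \<Rightarrow> 'a \<Rightarrow> complex) \<Rightarrow> ('a \<Rightarrow> 'a \<Rightarrow> complex) \<Rightarrow> bool" where
  "has_integral_kernel_L2 \<Omega> P K \<longleftrightarrow>
     (\<lambda>(z, w). K z w) \<in> borel_measurable (lebesgue_on (\<Omega> \<times> \<Omega>)) \<and>
     (\<forall>f\<in>Lp_space 2 \<Omega>. \<forall>z\<in>\<Omega>.
        integrable (lebesgue_on \<Omega>) (\<lambda>w. K z w * f w) \<and> P f z = integral_operator \<Omega> K f z)"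

definition abs_kernel :: "('a \<Rightarrow> 'a \<Rightarrow> complex) \<Rightarrow> 'a \<Rightarrow> 'a \<Rightarrow> complex" where
  "abs_kernel K z w = of_real (norm (K z w))"

definition integral_operator_bounded_Lp ::
  "real \<Rightarrow> 'a::euclidean_space set \<Rightarrow> ('a \<Rightarrow> 'a \<Rightarrow> complex) \<Rightarrow> bool" where
  "integral_operator_bounded_Lp p \<Omega> K \<longleftrightarrow>
     (\<exists>C>0. \<forall>f\<in>Lp_space p \<Omega>.
        (AE z in lebesgue_on \<Omega>. integrable (lebesgue_on \<Omega>) (\<lambda>w. K z w * f w)) \<and>
        integral_operator \<Omega> K f \<in> Lp_space p \<Omega> \<and>
        Lp_norm p \<Omega> (integral_operator \<Omega> K f) \<le> C * Lp_norm p \<Omega> f)"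

end

theory Submission
  imports Defs "HOL-Complex_Analysis.Complex_Analysis"
begin

text \<open>
  Let \<open>k\<close> be the largest integer with \<open>k p < 2 (m + n)\<close>. A monomial \<open>z1^a z2^b\<close> with \<open>a \<ge> 0\<close> lies in
  \<open>A^p\<close> exactly if \<open>n a + m b \<ge> - k\<close>, so the operator has to be the orthogonal projection onto the closed
  span of these monomials in \<open>A^2\<close>. Summing its kernel separately over the residue classes of \<open>a\<close> modulo
  \<open>m\<close> gives a closed form in \<open>s = z1 cnj w1\<close>, \<open>t = z2 cnj w2\<close> and \<open>u = s^m / t^n\<close>, which is dominated by
  \<open>|t|^(-k/m) |1 - u|^(-2) |1 - t|^(-2)\<close>. Schur's test with powers of
  \<open>(1 - |z2|^2) (1 - |z1|^2 / |z2|^(2n/m))\<close> and \<open>|z2|\<close> as weights bounds the absolute operator on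
  \<open>L^2\<close> and on \<open>L^p\<close>.

  For \<open>f\<close> in \<open>A^p\<close> each Fourier coefficient of \<open>f\<close> over a torus orbit is a multiple of a monomial by
  Cauchy's theorem, and by convexity it vanishes unless this monomial is in \<open>L^p\<close>. The operator
  commutes with the torus action and fixes the admissible monomials, hence \<open>P f - f\<close> has no
  Fourier coefficients on any orbit and is zero by Stone--Weierstrass. Since the
  kernel is Hermitian, \<open>g - P g\<close> is orthogonal to \<open>A^p\<close>, and Pythagoras gives the
  best approximation.
\<close>

section \<open>Lebesgue measure and the unit circle\<close>

text \<open>The obstacle is that the full Bergman projection, the case \<open>k = m + n - 1\<close>,
  keeps monomials that are square integrable but, for large \<open>p\<close>, not in L^p; it is
  therefore in general not bounded on L^p. Discarding these monomials loses nothing of A^p, since no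
  L^p function can contain them. The two inequalities that determine \<open>k\<close> do opposite
  jobs: \<open>k * p < 2 * (m + n)\<close> opens the window of weight exponents in which Schur's
  test works for \<open>p\<close>, and \<open>2 * (m + n) \<le> (k + 1) * p\<close> makes every
  discarded monomial fail to be in L^p. The hypothesis \<open>p \<ge> 2\<close> yields
  \<open>k < m + n\<close>, which places the kept monomials in L^2, and it makes L^p a subspace of
  L^2 because the domain has finite measure. The analysis is carried out for Borel functions;
  Lebesgue measurable functions enter at the end, through Borel representatives.\<close>

lemma nn_integral_lborel_translate:
  fixes f :: "'a::euclidean_space \<Rightarrow> ennreal"
  assumes [measurable]: "f \<in> borel_measurable borel"
  shows "(\<integral>\<^sup>+x. f (a + x) \<partial>lborel) = (\<integral>\<^sup>+x. f x \<partial>lborel)"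
proof -
  have "(\<integral>\<^sup>+x. f x \<partial>lborel) = (\<integral>\<^sup>+x. f x \<partial>distr lborel borel ((+) a))"
    by (simp add: lborel_distr_plus)
  also have "\<dots> = (\<integral>\<^sup>+x. f (a + x) \<partial>lborel)"
    by (subst nn_integral_distr) auto
  finally show ?thesis ..
qed

text \<open>
  The map preserves the volume of the unit ball; integrating \<open>1_A (T x) 1_B (y - T x)\<close> in both orders, with
  \<open>B\<close> the unit ball, transfers this to every \<open>A\<close>.
\<close>

lemma lborel_distr_isometry:
  fixes T :: "'a::euclidean_space \<Rightarrow> 'a"
  assumes lin: "linear T" and iso: "\<And>x. norm (T x) = norm x"
  shows "distr lborel borel T = lborel"
proof (rule measure_eqI)
  have [measurable]: "T \<in> borel_measurable borel"
    using linear_continuous_on[OF linear_conv_bounded_linear[THEN iffD1, OF lin]]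
    by (intro borel_measurable_continuous_onI)
  have "inj T"
    using iso by (metis lin linear_injective_0 norm_eq_zero)
  hence surj: "surj T"
    using lin linear_injective_imp_surjective by blast
  fix A assume "A \<in> sets (distr lborel borel T)"
  hence A [measurable]: "A \<in> sets borel" by simp
  let ?B = "ball (0::'a) 1"
  let ?F = "\<lambda>x y. indicator A (T x) * indicator ?B (y - T x) :: ennreal"
  have [measurable]: "?B \<in> sets borel" by simp
  have meas: "(\<lambda>(x, y). ?F x y) \<in> borel_measurable (lborel \<Otimes>\<^sub>M lborel)"
    by measurable
  have 1: "(\<integral>\<^sup>+x. \<integral>\<^sup>+y. ?F x y \<partial>lborel \<partial>lborel) = emeasure (distr lborel borel T) A * emeasure lborel ?B"
  proof -
    have "(\<integral>\<^sup>+y. ?F x y \<partial>lborel) = indicator A (T x) * emeasure lborel ?B" for x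
      using nn_integral_lborel_translate[of "\<lambda>y. indicator ?B y" "- T x"]
      by (simp add: nn_integral_cmult)
    moreover have "(\<integral>\<^sup>+x. indicator A (T x) \<partial>lborel) = emeasure (distr lborel borel T) A"
      by (subst nn_integral_indicator[symmetric], simp, subst nn_integral_distr) auto
    ultimately show ?thesis
      by (simp add: nn_integral_multc)
  qed
  have "(\<integral>\<^sup>+x. \<integral>\<^sup>+y. ?F x y \<partial>lborel \<partial>lborel) = (\<integral>\<^sup>+y. \<integral>\<^sup>+x. ?F x y \<partial>lborel \<partial>lborel)"
    by (rule lborel_pair.Fubini'[OF meas, symmetric])
  also have "\<dots> = (\<integral>\<^sup>+y. \<integral>\<^sup>+x. indicator A (y + T x) * indicator ?B (T x) \<partial>lborel \<partial>lborel)"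
  proof (rule nn_integral_cong)
    fix y
    \<comment> \<open>Replacing \<open>x\<close> by \<open>y' + x\<close> turns
      \<open>y - T x\<close> into \<open>- T x\<close>, and the ball is symmetric.\<close>
    obtain y' where y': "y = T y'" using surj by blast
    show "(\<integral>\<^sup>+x. ?F x y \<partial>lborel) = (\<integral>\<^sup>+x. indicator A (y + T x) * indicator ?B (T x) \<partial>lborel)"
      by (subst nn_integral_lborel_translate[of "\<lambda>x. ?F x y" y', symmetric], measurable)
        (simp add: y' linear_add[OF lin] indicator_def)
  qed
  also have "\<dots> = (\<integral>\<^sup>+x. \<integral>\<^sup>+y. indicator A (y + T x) * indicator ?B (T x) \<partial>lborel \<partial>lborel)"
    by (rule lborel_pair.Fubini') measurable
  also have "\<dots> = (\<integral>\<^sup>+x. emeasure lborel A * indicator ?B x \<partial>lborel)"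
  proof (rule nn_integral_cong)
    fix x
    show "(\<integral>\<^sup>+y. indicator A (y + T x) * indicator ?B (T x) \<partial>lborel) = emeasure lborel A * indicator ?B x"
    proof -
      have "(\<integral>\<^sup>+y. indicator A (y + T x) \<partial>lborel) = emeasure lborel A"
        using nn_integral_lborel_translate[of "\<lambda>y. indicator A y" "T x"] by (simp add: add.commute)
      moreover have "indicator ?B (T x) = (indicator ?B x :: ennreal)"
        by (simp add: indicator_def iso)
      ultimately show ?thesis
        by (simp add: nn_integral_multc)
    qed
  qed
  also have "\<dots> = emeasure lborel A * emeasure lborel ?B"
    by (simp add: nn_integral_cmult)
  finally have "emeasure (distr lborel borel T) A * emeasure lborel ?B = emeasure lborel A * emeasure lborel ?B"
    using 1 by simp
  moreover have "emeasure lborel ?B \<noteq> 0" "emeasure lborel ?B \<noteq> \<infinity>"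
    using less_irrefl[of "0::real"] unit_ball_vol_pos[of "real DIM('a)"]
    by (auto simp: emeasure_ball simp del: unit_ball_vol_pos)
  ultimately show "emeasure (distr lborel borel T) A = emeasure lborel A"
    by (metis ennreal_mult_cancel_left infinity_ennreal_def mult.commute)
qed simp

text \<open>The disc \<open>|w|^2 < a\<close> has area \<open>pi * a\<close>, so the two measures
  agree on half-lines, which generate the Borel sets and are stable under intersection. This
  replaces polar coordinates; the squared modulus is chosen because its density is constant.\<close>

lemma distr_norm_sq_complex:
  "distr lborel borel (\<lambda>w::complex. (norm w)\<^sup>2) = density lborel (\<lambda>x. ennreal pi * indicator {0..} x)"
  (is "?M = ?N")
proof -
  have N: "emeasure ?N {..<a} = ennreal (pi * max 0 a)" for a :: real
  proof -
    have "emeasure ?N {..<a} = (\<integral>\<^sup>+x. ennreal pi * indicator {0..<a} x \<partial>lborel)"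
      by (subst emeasure_density) (auto intro!: nn_integral_cong simp: indicator_def)
    also have "\<dots> = ennreal pi * emeasure lborel {0..<a}"
      by (simp add: nn_integral_cmult)
    also have "\<dots> = ennreal (pi * max 0 a)"
      by (cases "a \<ge> 0") (auto simp: ennreal_mult max_def)
    finally show ?thesis .
  qed
  have M: "emeasure ?M {..<a} = ennreal (pi * max 0 a)" for a :: real
  proof -
    have "(\<lambda>w::complex. (norm w)\<^sup>2) -` {..<a} = (if a \<ge> 0 then ball 0 (sqrt a) else {})"
    proof (cases "a \<ge> 0")
      case True
      thus ?thesis
        by (auto simp: real_less_rsqrt intro: real_less_rsqrt)
          (metis norm_ge_zero real_sqrt_less_iff real_sqrt_unique real_sqrt_pow2 power2_eq_square real_sqrt_abs2 abs_of_nonneg real_sqrt_power power_strict_mono zero_less_numeral)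
    next
      case False
      thus ?thesis by auto (meson less_trans not_less zero_le_power2 order.trans less_imp_le)
    qed
    thus ?thesis
      by (subst emeasure_distr) (auto simp: emeasure_ball unit_ball_vol_2 max_def)
  qed
  show ?thesis
  proof (rule measure_eqI_generator_eq[where E="range lessThan" and \<Omega>=UNIV and A="\<lambda>i. {..<real i}"])
    show "Int_stable (range lessThan :: real set set)"
    proof (rule Int_stableI)
      fix a b :: "real set" assume "a \<in> range lessThan" "b \<in> range (lessThan :: real \<Rightarrow> _)"
      then obtain x y :: real where "a = {..<x}" "b = {..<y}" by auto
      hence "a \<inter> b = {..<min x y}" by auto
      thus "a \<inter> b \<in> range lessThan" by blast
    qed
    show "(\<Union>i. {..<real i}) = UNIV"
      by (auto intro: reals_Archimedean2)
    have "sets borel = sigma_sets UNIV (range (lessThan :: real \<Rightarrow> _))"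
      by (subst borel_Iio) simp
    thus "sets ?M = sigma_sets UNIV (range lessThan)" "sets ?N = sigma_sets UNIV (range lessThan)"
      by simp_all
  qed (auto simp: M N)
qed

lemma nn_integral_radial:
  assumes [measurable]: "h \<in> borel_measurable (borel::real measure)"
  shows "(\<integral>\<^sup>+(w::complex). h ((norm w)\<^sup>2) \<partial>lborel) = ennreal pi * (\<integral>\<^sup>+x. h x * indicator {0..} x \<partial>lborel)"
proof -
  have "(\<integral>\<^sup>+(w::complex). h ((norm w)\<^sup>2) \<partial>lborel) = (\<integral>\<^sup>+x. h x \<partial>distr lborel borel (\<lambda>w::complex. (norm w)\<^sup>2))"
    by (subst nn_integral_distr) auto
  also have "\<dots> = (\<integral>\<^sup>+x. ennreal pi * (h x * indicator {0..} x) \<partial>lborel)"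
    by (subst distr_norm_sq_complex, subst nn_integral_density) (auto simp: mult_ac)
  finally show ?thesis
    by (simp add: nn_integral_cmult)
qed

section \<open>Parametrisation of the unit circle\<close>

definition unit_circle :: "real \<Rightarrow> complex" where
  "unit_circle \<theta> = cis (2 * pi * \<theta>)"

text \<open>Using [0,1] instead of angles matches \<open>circlepath\<close> and gives total mass 1,
  so integrals against this measure are means over the circle.\<close>

abbreviation \<U> :: "real measure" where
  "\<U> \<equiv> restrict_space lborel {0..1}"

lemma norm_unit_circle [simp]: "norm (unit_circle \<theta>) = 1"
  by (simp add: unit_circle_def)

lemma unit_circle_nonzero [simp]: "unit_circle \<theta> \<noteq> 0"
  by (simp add: unit_circle_def)

lemma continuous_on_unit_circle [continuous_intros]:
  "continuous_on S f \<Longrightarrow> continuous_on S (\<lambda>x. unit_circle (f x))"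
  unfolding unit_circle_def cis_conv_exp by (intro continuous_intros)

lemma measurable_unit_circle [measurable]: "unit_circle \<in> borel_measurable borel"
  by (intro borel_measurable_continuous_onI continuous_intros)

lemma sigma_finite_U: "sigma_finite_measure \<U>"
  by (intro sigma_finite_measure_restrict_space) (auto intro: lborel.sigma_finite_measure_axioms)

lemma emeasure_U_space [simp]: "emeasure \<U> {0..1} = 1"
  by (simp add: emeasure_restrict_space space_restrict_space)

section \<open>Schur test and kernel integrals\<close>

text \<open>Young's inequality for \<open>f / a powr (1 / p)\<close> and
  \<open>g / b powr (1 / q)\<close>; if a bound is zero, the product vanishes almost everywhere.
  Bounds \<open>a\<close>, \<open>b\<close> instead of the integrals themselves let Schur's test
  insert its weight estimate directly.\<close>

lemma nn_integral_Holder: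
  fixes f g :: "'a \<Rightarrow> real"
  assumes pq: "p > 1" "q > 1" "1 / p + 1 / q = 1"
    and [measurable]: "f \<in> borel_measurable M" "g \<in> borel_measurable M"
    and f0: "\<And>x. x \<in> space M \<Longrightarrow> f x \<ge> 0" and g0: "\<And>x. x \<in> space M \<Longrightarrow> g x \<ge> 0"
    and a: "a \<ge> 0" "(\<integral>\<^sup>+x. ennreal (f x powr p) \<partial>M) \<le> ennreal a"
    and b: "b \<ge> 0" "(\<integral>\<^sup>+x. ennreal (g x powr q) \<partial>M) \<le> ennreal b"
  shows "(\<integral>\<^sup>+x. ennreal (f x * g x) \<partial>M) \<le> ennreal (a powr (1 / p) * b powr (1 / q))"
proof (cases "a = 0 \<or> b = 0")
  case True
  have "AE x in M. f x * g x = 0"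
    using True
  proof
    assume "a = 0"
    hence "AE x in M. ennreal (f x powr p) = 0"
      using a by (subst nn_integral_0_iff_AE[symmetric]) auto
    thus ?thesis
      using AE_space by eventually_elim (use f0 in \<open>auto simp: ennreal_eq_0_iff\<close>)
  next
    assume "b = 0"
    hence "AE x in M. ennreal (g x powr q) = 0"
      using b by (subst nn_integral_0_iff_AE[symmetric]) auto
    thus ?thesis
      using AE_space by eventually_elim (use g0 in \<open>auto simp: ennreal_eq_0_iff\<close>)
  qed
  hence "(\<integral>\<^sup>+x. ennreal (f x * g x) \<partial>M) = (\<integral>\<^sup>+x. 0 \<partial>M)"
    by (intro nn_integral_cong_AE) auto
  thus ?thesis by simp
next
  case False
  hence ab: "a > 0" "b > 0" using a b by auto
  define c where "c = a powr (1 / p) * b powr (1 / q)"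
  have c: "c > 0" using ab by (simp add: c_def)
  have "(\<integral>\<^sup>+x. ennreal (f x * g x) \<partial>M)
      \<le> (\<integral>\<^sup>+x. ennreal (c / (p * a)) * ennreal (f x powr p) + ennreal (c / (q * b)) * ennreal (g x powr q) \<partial>M)"
  proof (rule nn_integral_mono)
    fix x assume x: "x \<in> space M"
    have "(f x / a powr (1 / p)) * (g x / b powr (1 / q))
        \<le> (f x / a powr (1 / p)) powr p / p + (g x / b powr (1 / q)) powr q / q"
      by (rule Youngs_inequality) (use pq f0 g0 x in auto)
    also have "\<dots> = f x powr p / (p * a) + g x powr q / (q * b)"
      using pq f0[OF x] g0[OF x] ab by (simp add: powr_divide powr_powr mult.commute)
    finally have "f x * g x \<le> c * (f x powr p / (p * a) + g x powr q / (q * b))"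
      using ab by (simp add: c_def field_simps)
    also have "\<dots> = c / (p * a) * f x powr p + c / (q * b) * g x powr q"
      by (simp add: algebra_simps)
    finally show "ennreal (f x * g x)
        \<le> ennreal (c / (p * a)) * ennreal (f x powr p) + ennreal (c / (q * b)) * ennreal (g x powr q)"
      using c ab pq by (simp add: ennreal_mult'[symmetric] flip: ennreal_plus)
  qed
  also have "\<dots> = ennreal (c / (p * a)) * (\<integral>\<^sup>+x. ennreal (f x powr p) \<partial>M)
      + ennreal (c / (q * b)) * (\<integral>\<^sup>+x. ennreal (g x powr q) \<partial>M)"
    by (subst nn_integral_add) (auto simp: nn_integral_cmult)
  also have "\<dots> \<le> ennreal (c / (p * a)) * ennreal a + ennreal (c / (q * b)) * ennreal b"
    by (intro add_mono mult_left_mono a b) auto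
  also have "\<dots> = ennreal (c * (1 / p + 1 / q))"
    using c ab pq by (simp add: ennreal_mult'[symmetric] field_simps flip: ennreal_plus)
  finally show ?thesis
    by (simp add: pq(3) c_def)
qed

text \<open>For fixed \<open>z\<close>, Hoelder's inequality is applied to the splitting of
  \<open>k * f\<close> into \<open>k powr (1 / p) * (f / h)\<close> and
  \<open>k powr (1 / q) * h\<close>; \<open>q_test\<close> bounds the second factor. Integrating in
  \<open>z\<close> and exchanging the integrals leaves \<open>p_test\<close>. Asking only that
  \<open>u\<close> be dominated by the integral lets the same lemma serve the operator and its
  absolute version.\<close>

lemma Schur_test:
  fixes k :: "'a \<times> 'a \<Rightarrow> real" and f h u :: "'a \<Rightarrow> real"
  assumes "sigma_finite_measure M"
    and pq: "p > 1" "q > 1" "1 / p + 1 / q = 1"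
    and [measurable]: "k \<in> borel_measurable (M \<Otimes>\<^sub>M M)" "h \<in> borel_measurable M" "f \<in> borel_measurable M"
    and k0: "\<And>z w. z \<in> space M \<Longrightarrow> w \<in> space M \<Longrightarrow> k (z, w) \<ge> 0"
    and h0: "\<And>z. z \<in> space M \<Longrightarrow> h z > 0"
    and f0: "\<And>z. z \<in> space M \<Longrightarrow> f z \<ge> 0"
    and u0: "\<And>z. z \<in> space M \<Longrightarrow> u z \<ge> 0"
    and C: "C > 0"
    and q_test: "\<And>z. z \<in> space M \<Longrightarrow>
       (\<integral>\<^sup>+w. ennreal (k (z, w) * h w powr q) \<partial>M) \<le> ennreal (C * h z powr q)"
    and p_test: "\<And>w. w \<in> space M \<Longrightarrow>
       (\<integral>\<^sup>+z. ennreal (k (z, w) * h z powr p) \<partial>M) \<le> ennreal (C * h w powr p)"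
    and u: "\<And>z. z \<in> space M \<Longrightarrow> ennreal (u z) \<le> (\<integral>\<^sup>+w. ennreal (k (z, w) * f w) \<partial>M)"
  shows "(\<integral>\<^sup>+z. ennreal (u z powr p) \<partial>M) \<le> ennreal (C powr p) * (\<integral>\<^sup>+w. ennreal (f w powr p) \<partial>M)"
proof -
  interpret sigma_finite_measure M by fact
  interpret pair_sigma_finite M M ..
  define A where "A = (\<lambda>z. \<integral>\<^sup>+w. ennreal (k (z, w) * (f w / h w) powr p) \<partial>M)"
  have [measurable]: "A \<in> borel_measurable M"
    unfolding A_def by measurable
  have pw: "ennreal (u z powr p) \<le> ennreal (C powr (p / q) * h z powr p) * A z" if z: "z \<in> space M" for z
  \<comment> \<open>Hoelder's inequality needs finite bounds. If \<open>A z\<close> is infinite, so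
    is the right-hand side, as the factor in front is positive.\<close>
  proof (cases "A z = \<infinity>")
    case True
    thus ?thesis using C h0[OF z] by (simp add: ennreal_mult_top)
  next
    case False
    then obtain a where a: "A z = ennreal a" "a \<ge> 0"
      by (cases "A z") auto
    have [measurable]: "(\<lambda>w. k (z, w)) \<in> borel_measurable M"
      using z by measurable
    let ?F = "\<lambda>w. k (z, w) powr (1 / p) * (f w / h w)" and ?G = "\<lambda>w. k (z, w) powr (1 / q) * h w"
    have "ennreal (u z) \<le> (\<integral>\<^sup>+w. ennreal (k (z, w) * f w) \<partial>M)" by (rule u[OF z])
    also have "\<dots> = (\<integral>\<^sup>+w. ennreal (?F w * ?G w) \<partial>M)"
    proof (intro nn_integral_cong arg_cong[where f=ennreal])
      fix w assume w: "w \<in> space M"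
      have "k (z, w) powr (1 / p) * k (z, w) powr (1 / q) = k (z, w)"
        using pq k0[OF z w] by (simp flip: powr_add)
      thus "k (z, w) * f w = ?F w * ?G w"
        using h0[OF w] by (simp add: field_simps)
    qed
    also have "\<dots> \<le> ennreal (a powr (1 / p) * (C * h z powr q) powr (1 / q))"
    proof (rule nn_integral_Holder[OF pq])
      show "(\<integral>\<^sup>+w. ennreal (?F w powr p) \<partial>M) \<le> ennreal a"
        unfolding a(1)[symmetric] A_def
        by (intro nn_integral_mono ennreal_leI)
          (use pq k0 h0 f0 z in \<open>auto simp: powr_mult powr_powr less_imp_le simp del: times_divide_eq_right\<close>)
      show "(\<integral>\<^sup>+w. ennreal (?G w powr q) \<partial>M) \<le> ennreal (C * h z powr q)"
        by (rule order_trans[OF _ q_test[OF z]], intro nn_integral_mono ennreal_leI)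
          (use pq k0 h0 f0 z in \<open>auto simp: powr_mult powr_powr less_imp_le simp del: times_divide_eq_right\<close>)
    qed (use a C k0 h0 f0 z in \<open>auto intro!: mult_nonneg_nonneg divide_nonneg_nonneg simp: less_imp_le\<close>)
    finally have "u z \<le> a powr (1 / p) * (C * h z powr q) powr (1 / q)"
      using a C by (simp add: ennreal_le_iff)
    hence "u z powr p \<le> (a powr (1 / p) * (C * h z powr q) powr (1 / q)) powr p"
      using u0[OF z] pq by (intro powr_mono2) auto
    also have "\<dots> = C powr (p / q) * h z powr p * a"
      using a C pq h0[OF z] by (simp add: powr_mult powr_powr)
    finally show ?thesis
      using a by (simp add: ennreal_leI ennreal_mult'[symmetric])
  qed
  have "(\<integral>\<^sup>+z. ennreal (u z powr p) \<partial>M)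
      \<le> (\<integral>\<^sup>+z. \<integral>\<^sup>+w. ennreal (C powr (p / q) * h z powr p) * ennreal (k (z, w) * (f w / h w) powr p) \<partial>M \<partial>M)"
    using pw by (intro nn_integral_mono) (auto simp: A_def nn_integral_cmult)
  also have "\<dots> = (\<integral>\<^sup>+w. \<integral>\<^sup>+z. ennreal (C powr (p / q) * h z powr p) * ennreal (k (z, w) * (f w / h w) powr p) \<partial>M \<partial>M)"
    by (rule Fubini') measurable
  also have "\<dots> \<le> (\<integral>\<^sup>+w. ennreal (C powr p) * ennreal (f w powr p) \<partial>M)"
  proof (rule nn_integral_mono)
    fix w assume w: "w \<in> space M"
    have [measurable]: "(\<lambda>z. k (z, w)) \<in> borel_measurable M"
      using w by measurable
    have "(\<integral>\<^sup>+z. ennreal (C powr (p / q) * h z powr p) * ennreal (k (z, w) * (f w / h w) powr p) \<partial>M)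
        = (\<integral>\<^sup>+z. ennreal (C powr (p / q) * (f w / h w) powr p) * ennreal (k (z, w) * h z powr p) \<partial>M)"
      by (intro nn_integral_cong) (use k0 w in \<open>auto simp: ennreal_mult'[symmetric] mult_ac\<close>)
    also have "\<dots> = ennreal (C powr (p / q) * (f w / h w) powr p) * (\<integral>\<^sup>+z. ennreal (k (z, w) * h z powr p) \<partial>M)"
      by (rule nn_integral_cmult) measurable
    also have "\<dots> \<le> ennreal (C powr (p / q) * (f w / h w) powr p) * ennreal (C * h w powr p)"
      by (intro mult_left_mono p_test w) auto
    also have "\<dots> = ennreal (C powr (p / q + 1) * f w powr p)"
      using C h0[OF w] f0[OF w] by (simp add: ennreal_mult'[symmetric] powr_add powr_divide field_simps)
    also have "p / q + 1 = p"
      using pq by (simp add: field_simps)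
    finally show "(\<integral>\<^sup>+z. ennreal (C powr (p / q) * h z powr p) * ennreal (k (z, w) * (f w / h w) powr p) \<partial>M)
        \<le> ennreal (C powr p) * ennreal (f w powr p)"
      by (simp add: ennreal_mult')
  qed
  also have "\<dots> = ennreal (C powr p) * (\<integral>\<^sup>+w. ennreal (f w powr p) \<partial>M)"
    by (simp add: nn_integral_cmult)
  finally show ?thesis .
qed

section \<open>One-variable integrals of powers\<close>

lemma nn_integral_powr_interval:
  assumes "a > -1" "c \<ge> 0"
  shows "(\<integral>\<^sup>+x. ennreal (x powr a) * indicator {0..c} x \<partial>lborel) = ennreal (c powr (a + 1) / (a + 1))"
  using nn_integral_has_integral_lebesgue[OF _ has_integral_powr_from_0[OF assms]]
  by (simp add: ennreal_mult' ennreal_indicator mult.commute)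

lemma nn_integral_powr_tail:
  assumes "a < -1" "c > 0"
  shows "(\<integral>\<^sup>+x. ennreal (x powr a) * indicator {c..} x \<partial>lborel) = ennreal (c powr (a + 1) / - (a + 1))"
proof -
  have "- (c powr (a + 1)) / (a + 1) = c powr (a + 1) / - (a + 1)"
    by (metis minus_divide_left minus_divide_right)
  thus ?thesis
  using nn_integral_has_integral_lebesgue[OF _ has_integral_powr_to_inf[OF assms]]
  by (simp add: ennreal_mult' ennreal_indicator mult.commute)
qed

lemma nn_integral_powr_infinite:
  assumes "a \<le> -1"
  shows "(\<integral>\<^sup>+x. ennreal (x powr a) * indicator {0..1} x \<partial>lborel) = \<infinity>"
proof (rule ccontr)
  assume "\<not> ?thesis"
  then obtain I where I: "(\<integral>\<^sup>+x. ennreal (x powr a) * indicator {0..1} x \<partial>lborel) = ennreal I" "I \<ge> 0"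
    by (cases "\<integral>\<^sup>+x. ennreal (x powr a) * indicator {0..1} x \<partial>lborel") auto
  \<comment> \<open>Since \<open>b - 1 > -1 \<ge> a\<close>, the function
    \<open>x powr (b - 1)\<close> lies below \<open>x powr a\<close> on the unit interval, yet its
    integral \<open>1 / b = I + 1\<close> exceeds the supposed value.\<close>
  define b where "b = 1 / (I + 1)"
  have b: "b > 0" using I by (simp add: b_def)
  have "ennreal (1 / b) = (\<integral>\<^sup>+x. ennreal (x powr (b - 1)) * indicator {0..1} x \<partial>lborel)"
    using b by (subst nn_integral_powr_interval) auto
  also have "\<dots> \<le> (\<integral>\<^sup>+x. ennreal (x powr a) * indicator {0..1} x \<partial>lborel)"
    using assms b
    by (intro nn_integral_mono) (auto split: split_indicator intro!: ennreal_leI powr_mono')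
  finally show False
    using I b by (simp add: b_def)
qed

text \<open>Near 0 only \<open>x powr \<delta>\<close> is singular. Near 1 the denominator satisfies
  \<open>1 - X * x \<ge> max (1 - X) (1 - x)\<close>, so the integral is split where
  \<open>1 - x = 1 - X\<close>: the inner piece converges because \<open>\<epsilon> < 1\<close>, the
  outer one because \<open>\<epsilon> > 0\<close>, and both scale like
  \<open>(1 - X) powr (-\<epsilon>)\<close>.\<close>

lemma Forelli_Rudin_interval:
  fixes \<epsilon> \<delta> :: real
  assumes \<epsilon>: "0 < \<epsilon>" "\<epsilon> < 1" and \<delta>: "\<delta> > -1"
  shows "\<exists>C>0. \<forall>X. 0 \<le> X \<longrightarrow> X < 1 \<longrightarrow>
     (\<integral>\<^sup>+x. ennreal (x powr \<delta> * (1 - x) powr (-\<epsilon>) / (1 - X * x)) * indicator {0<..<1} x \<partial>lborel)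
       \<le> ennreal (C * (1 - X) powr (-\<epsilon>))"
proof -
  define c where "c = 2 powr \<bar>\<delta>\<bar>"
  have c: "c > 0" by (simp add: c_def)
  \<comment> \<open>The 4 is the product of two factors bounded by 2 on \<open>x \<le> 1/2\<close>;
    \<open>c\<close> bounds \<open>x powr \<delta>\<close> on the other half, and the last two
    fractions come from the two pieces of the split.\<close>
  define C where "C = 4 / (\<delta> + 1) + c * (1 / (1 - \<epsilon>) + 1 / \<epsilon>)"
  have "C > 0" using assms c by (auto simp: C_def intro!: add_pos_pos mult_pos_pos)
  moreover have "(\<integral>\<^sup>+x. ennreal (x powr \<delta> * (1 - x) powr (-\<epsilon>) / (1 - X * x)) * indicator {0<..<1} x \<partial>lborel)
       \<le> ennreal (C * (1 - X) powr (-\<epsilon>))" if X: "0 \<le> X" "X < 1" for X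
  proof -
    define d where "d = 1 - X"
    have d: "0 < d" "d \<le> 1" using X by (auto simp: d_def)
    let ?J = "\<lambda>s. ennreal (s powr (-\<epsilon>) / d) * indicator {0..d} s + ennreal (s powr (-\<epsilon> - 1)) * indicator {d..} s"
    have pw: "ennreal (x powr \<delta> * (1 - x) powr (-\<epsilon>) / (1 - X * x)) * indicator {0<..<1} x
       \<le> ennreal 4 * (ennreal (x powr \<delta>) * indicator {0..1} x) + ennreal c * ?J (1 - x)" for x
    proof (cases "0 < x \<and> x < 1")
      case True
      hence x: "0 < x" "x < 1" by auto
      have Xx: "X * x \<le> x" "X * x \<le> X" "X * x < 1"
        using x X mult_left_le_one_le[of x X] mult_left_le[of x X] by auto
      show ?thesis
      proof (cases "x \<le> 1/2")
        case le: True
        have "(1 - x) powr (-\<epsilon>) \<le> 2"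
        proof -
          have "(1 - x) powr (-\<epsilon>) = (1 / (1 - x)) powr \<epsilon>"
            using x by (simp add: powr_minus_divide powr_divide)
          also have "\<dots> \<le> (1 / (1 - x)) powr 1"
            using x \<epsilon> le by (intro powr_mono) auto
          also have "\<dots> \<le> 2" using x le by (simp add: field_simps)
          finally show ?thesis .
        qed
        moreover have "1 / (1 - X * x) \<le> 2"
          using Xx le by (simp add: field_simps)
        ultimately have "x powr \<delta> * ((1 - x) powr (-\<epsilon>) * (1 / (1 - X * x))) \<le> x powr \<delta> * (2 * 2)"
          using Xx x by (intro mult_left_mono mult_mono) auto
        hence "ennreal (x powr \<delta> * (1 - x) powr (-\<epsilon>) / (1 - X * x)) \<le> ennreal 4 * ennreal (x powr \<delta>)"
          by (subst ennreal_mult'[symmetric]) (auto intro!: ennreal_leI simp: mult_ac)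
        thus ?thesis
          using x by (simp add: add_increasing2)
      next
        case False
        have xd: "x powr \<delta> \<le> c"
        proof (cases "\<delta> \<ge> 0")
          case True
          have "x powr \<delta> \<le> 1" using x True by (simp add: powr_le1)
          also have "1 \<le> c" using True by (simp add: c_def ge_one_powr_ge_zero)
          finally show ?thesis .
        next
          case neg: False
          have "x powr \<delta> \<le> (1/2) powr \<delta>" using x neg False by (intro powr_mono2') auto
          also have "\<dots> = c" using neg by (simp add: c_def powr_divide powr_minus_divide)
          finally show ?thesis .
        qed
        have J: "ennreal ((1 - x) powr (-\<epsilon>) / (1 - X * x)) \<le> ?J (1 - x)"
        proof (cases "1 - x \<le> d")
          case True
          have "(1 - x) powr (-\<epsilon>) / (1 - X * x) \<le> (1 - x) powr (-\<epsilon>) / d"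
            using Xx d by (intro divide_left_mono) (auto simp: d_def intro!: mult_pos_pos)
          thus ?thesis using True x by (simp add: add_increasing2 ennreal_leI)
        next
          case False
          have "(1 - x) powr (-\<epsilon>) / (1 - X * x) \<le> (1 - x) powr (-\<epsilon>) / (1 - x)"
            using Xx x by (intro divide_left_mono) (auto intro!: mult_pos_pos)
          also have "\<dots> = (1 - x) powr (-\<epsilon> - 1)"
            using x by (simp add: powr_diff)
          finally show ?thesis using False x by (simp add: add_increasing ennreal_leI)
        qed
        have "ennreal (x powr \<delta> * (1 - x) powr (-\<epsilon>) / (1 - X * x)) \<le> ennreal (c * ((1 - x) powr (-\<epsilon>) / (1 - X * x)))"
          using xd Xx x by (auto intro!: ennreal_leI mult_right_mono divide_right_mono)
        also have "\<dots> \<le> ennreal c * ?J (1 - x)"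
          using J c by (simp only: ennreal_mult' less_imp_le mult_left_mono zero_le)
        finally show ?thesis using x by (simp add: add_increasing)
      qed
    qed simp
    have "(\<integral>\<^sup>+x. ennreal (x powr \<delta> * (1 - x) powr (-\<epsilon>) / (1 - X * x)) * indicator {0<..<1} x \<partial>lborel)
        \<le> (\<integral>\<^sup>+x. ennreal 4 * (ennreal (x powr \<delta>) * indicator {0..1} x) + ennreal c * ?J (1 - x) \<partial>lborel)"
      by (intro nn_integral_mono pw)
    also have "\<dots> = ennreal 4 * (\<integral>\<^sup>+x. ennreal (x powr \<delta>) * indicator {0..1} x \<partial>lborel)
        + ennreal c * (\<integral>\<^sup>+x. ?J (1 - x) \<partial>lborel)"
      by (subst nn_integral_add, measurable, subst nn_integral_cmult, measurable, subst nn_integral_cmult) auto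
    also have "(\<integral>\<^sup>+x. ?J (1 - x) \<partial>lborel) = (\<integral>\<^sup>+s. ?J s \<partial>lborel)"
      by (subst nn_integral_real_affine[of ?J "-1" 1]) auto
    also have "(\<integral>\<^sup>+s. ?J s \<partial>lborel)
       = (\<integral>\<^sup>+s. ennreal (1 / d) * (ennreal (s powr (-\<epsilon>)) * indicator {0..d} s) \<partial>lborel)
       + (\<integral>\<^sup>+s. ennreal (s powr (-\<epsilon> - 1)) * indicator {d..} s \<partial>lborel)"
      using d by (subst nn_integral_add) (auto simp: ennreal_mult'[symmetric] mult.assoc[symmetric])
    also have "\<dots> = ennreal (1 / d) * ennreal (d powr (1 - \<epsilon>) / (1 - \<epsilon>)) + ennreal (d powr (-\<epsilon>) / \<epsilon>)"
      using d \<epsilon> by (subst nn_integral_cmult) (auto simp: nn_integral_powr_interval nn_integral_powr_tail)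
    also have "\<dots> = ennreal (d powr (-\<epsilon>) * (1 / (1 - \<epsilon>) + 1 / \<epsilon>))"
    proof -
      have "d powr (1 - \<epsilon>) = d powr (-\<epsilon>) * d"
        using d powr_add[of d "-\<epsilon>" 1] by simp
      thus ?thesis
        using d \<epsilon> by (simp add: ennreal_mult'[symmetric] algebra_simps flip: ennreal_plus)
    qed
    also have "(\<integral>\<^sup>+x. ennreal (x powr \<delta>) * indicator {0..1} x \<partial>lborel) = ennreal (1 / (\<delta> + 1))"
      using \<delta> by (subst nn_integral_powr_interval) auto
    also have "ennreal 4 * ennreal (1 / (\<delta> + 1)) + ennreal c * ennreal (d powr (-\<epsilon>) * (1 / (1 - \<epsilon>) + 1 / \<epsilon>))
       = ennreal (4 / (\<delta> + 1) + c * (d powr (-\<epsilon>) * (1 / (1 - \<epsilon>) + 1 / \<epsilon>)))"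
      using \<delta> \<epsilon> c d by (subst (1 2) ennreal_mult'[symmetric]) (auto simp flip: ennreal_plus)
    also have "\<dots> \<le> ennreal (C * d powr (-\<epsilon>))"
    proof (rule ennreal_leI)
      \<comment> \<open>This absorbs the contribution of \<open>x \<le> 1/2\<close>, which does not
        depend on \<open>d\<close>.\<close>
      have "1 \<le> d powr (-\<epsilon>)"
        using d \<epsilon> powr_mono2'[of "-\<epsilon>" d 1] by simp
      hence "4 / (\<delta> + 1) * 1 \<le> 4 / (\<delta> + 1) * d powr (-\<epsilon>)"
        using \<delta> by (intro mult_left_mono) auto
      thus "4 / (\<delta> + 1) + c * (d powr (-\<epsilon>) * (1 / (1 - \<epsilon>) + 1 / \<epsilon>)) \<le> C * d powr (-\<epsilon>)"
        by (simp add: C_def algebra_simps)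
    qed
    finally show ?thesis by (simp add: d_def)
  qed
  ultimately show ?thesis by blast
qed

section \<open>Means of holomorphic functions over circles\<close>

lemma has_bochner_integral_U:
  fixes g :: "real \<Rightarrow> 'b::euclidean_space"
  assumes "continuous_on {0..1} g" "(g has_integral I) {0..1}"
  shows "has_bochner_integral \<U> g I"
proof -
  have S: "set_integrable lborel {0..1} g"
    by (rule borel_integrable_atLeastAtMost'[OF assms(1)])
  hence "integrable \<U> g"
    by (subst integrable_restrict_space) (auto simp: set_integrable_def)
  moreover have "integral\<^sup>L \<U> g = I"
    using set_borel_integral_eq_integral(2)[OF S] integral_unique[OF assms(2)]
    by (subst integral_restrict_space) (auto simp: set_lebesgue_integral_def)
  ultimately show ?thesis
    by (simp add: has_bochner_integral_iff)
qed

lemma integrable_U: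
  fixes g :: "real \<Rightarrow> 'b::euclidean_space"
  assumes "continuous_on {0..1} g"
  shows "integrable \<U> g"
  using has_bochner_integral_U[OF assms integrable_integral] assms
  by (auto simp: has_bochner_integral_iff intro: integrable_continuous_real)

lemma circlepath_unit_circle: "circlepath 0 r x = of_real r * unit_circle x"
  by (simp add: circlepath unit_circle_def cis_conv_exp mult_ac)

lemma has_contour_integral_circle_iff:
  "(f has_contour_integral I) (circlepath 0 r) \<longleftrightarrow>
    ((\<lambda>x. 2 * of_real pi * \<i> * (f (of_real r * unit_circle x) * (of_real r * unit_circle x))) has_integral I) {0..1}"
  unfolding has_contour_integral vector_derivative_circlepath circlepath_unit_circle
  by (simp add: unit_circle_def cis_conv_exp mult_ac)

lemma circle_mean_value:
  assumes f: "f holomorphic_on cball 0 r" and r: "r > 0"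
  shows "has_bochner_integral \<U> (\<lambda>x. f (of_real r * unit_circle x)) (f 0)"
proof (rule has_bochner_integral_U)
  have "((\<lambda>u. f u / (u - 0)) has_contour_integral (2 * of_real pi * \<i> * f 0)) (circlepath 0 r)"
    using r f by (intro Cauchy_integral_circlepath_simple) auto
  hence "((\<lambda>x. 2 * of_real pi * \<i> * f (of_real r * unit_circle x)) has_integral (2 * of_real pi * \<i> * f 0)) {0..1}"
    unfolding has_contour_integral_circle_iff using r by simp
  from has_integral_mult_right[OF this, of "1 / (2 * of_real pi * \<i>)"]
  show "((\<lambda>x. f (of_real r * unit_circle x)) has_integral f 0) {0..1}"
    by simp
  show "continuous_on {0..1} (\<lambda>x. f (complex_of_real r * unit_circle x))"
    using r by (intro continuous_on_compose2[OF holomorphic_on_imp_continuous_on[OF f]] continuous_intros)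
      (auto simp: norm_mult)
qed

text \<open>With \<open>w = c * z ^ l\<close> and \<open>|z| = 1\<close>, the integrand is the real
  part of \<open>(1 + w) / (1 - w)\<close> divided by \<open>1 - |c|^2\<close>. That function of
  \<open>z\<close> is holomorphic on the closed disc and equals 1 at 0 (here \<open>l > 0\<close>
  enters), so the mean value property evaluates the integral.\<close>

lemma Poisson_mean:
  fixes c :: complex
  assumes c: "norm c < 1" and l: "l > 0"
  shows "(\<integral>\<^sup>+x. ennreal (1 / (norm (1 - c * unit_circle x ^ l))\<^sup>2) \<partial>\<U>) \<le> ennreal (1 / (1 - (norm c)\<^sup>2))"
proof -
  define F where "F = (\<lambda>z. (1 + c * z ^ l) / (1 - c * z ^ l))"
  have n: "norm (c * z ^ l) < 1" if "norm z \<le> 1" for z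
  proof -
    have "norm c * norm z ^ l \<le> norm c * 1"
      using that by (intro mult_left_mono power_le_one) auto
    thus ?thesis using c by (simp add: norm_mult norm_power)
  qed
  have ne: "1 - c * z ^ l \<noteq> 0" if "norm z \<le> 1" for z
    using n[OF that] by auto
  have "F holomorphic_on cball 0 1"
    unfolding F_def using ne by (intro holomorphic_intros) auto
  from circle_mean_value[OF this]
  have hb: "has_bochner_integral \<U> (\<lambda>x. F (unit_circle x)) 1"
    using l by (simp add: F_def zero_power)
  have Re: "1 / (norm (1 - c * unit_circle x ^ l))\<^sup>2 = Re (F (unit_circle x)) / (1 - (norm c)\<^sup>2)" for x
  proof -
    define w where "w = c * unit_circle x ^ l"
    have w: "norm w = norm c" by (simp add: w_def norm_mult norm_power)
    have "(norm c)\<^sup>2 < 1" using c by (simp add: power_less_one_iff abs_square_less_1)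
    moreover have "Re ((1 + w) / (1 - w)) = (1 - (norm c)\<^sup>2) / (norm (1 - w))\<^sup>2"
      unfolding w[symmetric] cmod_power2 by (simp add: Re_divide power2_eq_square algebra_simps)
    ultimately show ?thesis by (simp add: F_def w_def)
  qed
  have "has_bochner_integral \<U> (\<lambda>x. Re (F (unit_circle x))) 1"
    using has_bochner_integral_Re[OF hb] by simp
  hence "has_bochner_integral \<U> (\<lambda>x. Re (F (unit_circle x)) / (1 - (norm c)\<^sup>2)) (1 / (1 - (norm c)\<^sup>2))"
    by (rule has_bochner_integral_divide_zero)
  hence "has_bochner_integral \<U> (\<lambda>x. 1 / (norm (1 - c * unit_circle x ^ l))\<^sup>2) (1 / (1 - (norm c)\<^sup>2))"
    by (simp only: Re)
  thus ?thesis
    by (subst nn_integral_eq_integral) (auto simp: has_bochner_integral_iff)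
qed

section \<open>The Hartogs triangle and the kernel\<close>

lemma powr_divide_power:
  fixes x :: real
  assumes "x \<ge> 0" "j > 0" "l > 0"
  shows "(x powr (real l / real j)) ^ j = x ^ l"
proof (cases "x = 0")
  case True
  thus ?thesis using assms by (simp add: zero_power)
next
  case False
  hence "(x powr (real l / real j)) ^ j = (x powr (real l / real j)) powr real j"
    using assms by (intro powr_realpow[symmetric]) auto
  also have "\<dots> = x ^ l"
    using assms False by (simp add: powr_powr powr_realpow)
  finally show ?thesis .
qed

text \<open>The bound on \<open>k\<close> puts all monomials with \<open>a \<ge> 0\<close> and
  \<open>n a + m b \<ge> - k\<close> into L^2. The exponent \<open>p\<close> is not fixed here:
  boundedness on L^2 and on L^p are two instances of the same lemmas.\<close>

locale hartogs =
  fixes m n k :: nat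
  assumes m: "m > 0" and n: "n > 0" and k: "k < m + n"
begin

abbreviation \<Omega> :: "(complex \<times> complex) set" where
  "\<Omega> \<equiv> rational_hartogs m n"

abbreviation \<mu> :: "(complex \<times> complex) measure" where
  "\<mu> \<equiv> restrict_space lborel \<Omega>"

lemma mem_\<Omega>_iff: "z \<in> \<Omega> \<longleftrightarrow> norm (fst z) ^ m < norm (snd z) ^ n \<and> norm (snd z) < 1"
proof -
  let ?a = "norm (fst z)" and ?b = "norm (snd z)"
  have "?a powr (real m / real n) < ?b \<longleftrightarrow> ?a ^ m < ?b ^ n"
  proof -
    have "(?a powr (real m / real n)) ^ n = ?a ^ m"
      using m n by (intro powr_divide_power) auto
    thus ?thesis
      using n by (metis norm_ge_zero powr_ge_zero power_less_imp_less_base power_strict_mono)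
  qed
  thus ?thesis
    by (auto simp: rational_hartogs_def case_prod_unfold)
qed

lemma snd_nonzero: "z \<in> \<Omega> \<Longrightarrow> snd z \<noteq> 0"
  using n by (auto simp: mem_\<Omega>_iff zero_power)

lemma open_\<Omega>: "open \<Omega>"
proof -
  have "\<Omega> = {z. norm (fst z) ^ m < norm (snd z) ^ n} \<inter> {z. norm (snd z) < 1}"
    by (auto simp: mem_\<Omega>_iff)
  thus ?thesis
    by (simp add: open_Int open_Collect_less continuous_on_norm continuous_on_power continuous_on_fst continuous_on_snd)
qed

lemma \<Omega>_borel [measurable, simp]: "\<Omega> \<in> sets borel"
  using open_\<Omega> by simp

section \<open>Radial coordinates, the kernel and its pointwise bound\<close>

text \<open>
  \<open>X\<close> and \<open>Y\<close> are the squared moduli of the coordinates \<open>z1 / |z2|^(n/m)\<close> and \<open>z2\<close>, in which the domain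
  becomes a product of a disc and a punctured disc.
\<close>

definition X :: "complex \<times> complex \<Rightarrow> real" where
  "X z = (norm (fst z))\<^sup>2 / (norm (snd z))\<^sup>2 powr (real n / real m)"

definition Y :: "complex \<times> complex \<Rightarrow> real" where
  "Y z = (norm (snd z))\<^sup>2"

lemma X_power: "snd z \<noteq> 0 \<Longrightarrow> X z ^ m = norm (fst z) ^ (2 * m) / norm (snd z) ^ (2 * n)"
proof -
  assume "snd z \<noteq> 0"
  hence "((norm (snd z))\<^sup>2 powr (real n / real m)) ^ m = norm (snd z) ^ (2 * n)"
    using m n powr_divide_power[of "(norm (snd z))\<^sup>2" m n] by (simp add: power_mult)
  thus ?thesis
    by (simp add: X_def power_divide power_mult)
qed

lemma mem_\<Omega>_iff_XY: "z \<in> \<Omega> \<longleftrightarrow> X z < 1 \<and> 0 < Y z \<and> Y z < 1"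
proof (cases "snd z = 0")
  case True
  thus ?thesis using snd_nonzero[of z] by (auto simp: Y_def)
next
  case False
  have "X z < 1 \<longleftrightarrow> X z ^ m < 1"
    using m by (simp add: power_less_one_iff X_def)
  also have "\<dots> \<longleftrightarrow> norm (fst z) ^ m < norm (snd z) ^ n"
  proof -
    have "X z ^ m < 1 \<longleftrightarrow> (norm (fst z) ^ m)\<^sup>2 < (norm (snd z) ^ n)\<^sup>2"
      using False by (simp add: X_power power_mult[symmetric] mult.commute)
    also have "\<dots> \<longleftrightarrow> norm (fst z) ^ m < norm (snd z) ^ n"
      by (metis norm_ge_zero pos2 power_less_imp_less_base power_strict_mono zero_le_power)
    finally show ?thesis .
  qed
  finally show ?thesis
    using False by (auto simp: mem_\<Omega>_iff Y_def abs_square_less_1)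
qed

lemma X_nonneg [simp]: "X z \<ge> 0" and Y_nonneg [simp]: "Y z \<ge> 0"
  by (auto simp: X_def Y_def)

text \<open>
  \<open>cf c x\<close> is the sum of \<open>(m j + c) x^j\<close>. Writing \<open>a = m q + r\<close>, the admissible monomials with \<open>a mod m = r\<close> are
  \<open>s^r u^q t^(j - dg r)\<close> with \<open>q, j \<ge> 0\<close>, and \<open>1 / \<parallel>z^(a,b)\<parallel>^2 = (a + 1) (m (b + 1) + n (a + 1)) / (pi^2 m)\<close>
  splits into the factors \<open>m q + (r + 1)\<close> and \<open>m j + ec r\<close>.
\<close>

definition cf :: "complex \<Rightarrow> complex \<Rightarrow> complex" where
  "cf c x = c / (1 - x) + of_nat m * x / (1 - x)\<^sup>2"

definition dg :: "nat \<Rightarrow> nat" where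
  "dg r = (k + n * r) div m"

text \<open>Inserting \<open>a = m q + r\<close> and \<open>b = j - dg r - n q\<close> into
  \<open>m (b + 1) + n (a + 1)\<close> cancels the terms with \<open>q\<close>; this is what remains
  besides \<open>m j\<close>.\<close>

definition ec :: "nat \<Rightarrow> real" where
  "ec r = real m * (1 - real (dg r)) + real n * (real r + 1)"

definition kern :: "complex \<Rightarrow> complex \<Rightarrow> complex" where
  "kern s t = 1 / (of_real (pi\<^sup>2) * of_nat m) *
     (\<Sum>r<m. s ^ r / t ^ dg r * cf (of_nat (r + 1)) (s ^ m / t ^ n) * cf (of_real (ec r)) t)"

definition K :: "complex \<times> complex \<Rightarrow> complex \<times> complex \<Rightarrow> complex" where
  "K z w = kern (fst z * cnj (fst w)) (snd z * cnj (snd w))"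

text \<open>All coefficients of \<open>kern\<close> are real. The symmetry makes the operator
  self-adjoint and lets one weight estimate serve both hypotheses of Schur's test.\<close>

lemma cnj_K: "cnj (K z w) = K w z"
proof -
  have "cnj (kern s t) = kern (cnj s) (cnj t)" for s t
    by (simp add: kern_def cf_def)
  thus ?thesis
    by (simp add: K_def mult.commute)
qed

lemma norm_cf_le:
  assumes "norm x < 1"
  shows "norm (cf c x) \<le> (2 * norm c + real m) / (norm (1 - x))\<^sup>2"
proof -
  have ne: "norm (1 - x) > 0" using assms by auto
  have "norm (1 - x) \<le> 2"
    using norm_triangle_ineq4[of 1 x] assms by simp
  hence "norm c * norm (1 - x) \<le> norm c * 2"
    by (intro mult_left_mono) auto
  hence "norm c / norm (1 - x) \<le> 2 * norm c / (norm (1 - x))\<^sup>2"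
    using ne by (simp add: field_simps power2_eq_square)
  moreover have "real m * norm x / (norm (1 - x))\<^sup>2 \<le> real m / (norm (1 - x))\<^sup>2"
    using assms by (intro divide_right_mono mult_left_le) auto
  moreover have "norm (cf c x) \<le> norm c / norm (1 - x) + real m * norm x / (norm (1 - x))\<^sup>2"
    unfolding cf_def by (rule order_trans[OF norm_triangle_ineq]) (simp add: norm_divide norm_mult norm_power)
  ultimately show ?thesis by (simp add: add_divide_distrib)
qed

definition kernel_const :: real where
  "kernel_const = (\<Sum>r<m. (2 * real (r + 1) + real m) * (2 * \<bar>ec r\<bar> + real m)) / (pi\<^sup>2 * real m)"

lemma kernel_const_nonneg: "kernel_const \<ge> 0"
  by (auto simp: kernel_const_def intro!: divide_nonneg_nonneg sum_nonneg mult_nonneg_nonneg)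

text \<open>Because \<open>|s| \<le> |t|^(n/m)\<close> and \<open>dg r \<le> (k + n r) / m\<close>
  with \<open>|t| < 1\<close>, each factor \<open>s^r / t^(dg r)\<close> is at most
  \<open>|t|^(-k/m)\<close>: all residue classes share one bound for the singularity.\<close>

lemma norm_kern_le:
  assumes t: "t \<noteq> 0" "norm t < 1" and st: "norm s ^ m < norm t ^ n"
  shows "norm (kern s t) \<le> kernel_const * norm t powr (- (real k / real m)) /
           ((norm (1 - s ^ m / t ^ n))\<^sup>2 * (norm (1 - t))\<^sup>2)"
proof -
  let ?u = "s ^ m / t ^ n"
  let ?N = "(norm (1 - ?u))\<^sup>2 * (norm (1 - t))\<^sup>2"
  have u: "norm ?u < 1"
    using t st by (simp add: norm_divide norm_power)
  have s: "norm s \<le> norm t powr (real n / real m)"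
  proof -
    have "(norm t powr (real n / real m)) ^ m = norm t ^ n"
      using m n by (intro powr_divide_power) auto
    thus ?thesis
      using st m by (metis less_imp_le power_less_imp_less_base powr_ge_zero)
  qed
  have d: "norm (s ^ r / t ^ dg r) \<le> norm t powr (- (real k / real m))" for r
  proof -
    have "real (dg r) \<le> (real k + real n * real r) / real m"
      unfolding dg_def using of_nat_div_le_of_nat[of "k + n * r" m, where 'a=real] by simp
    hence 1: "norm t powr (- real (dg r)) \<le> norm t powr (- ((real k + real n * real r) / real m))"
      using t by (intro powr_mono') auto
    have 2: "norm s ^ r \<le> norm t powr (real n * real r / real m)"
    proof -
      have "norm s ^ r \<le> (norm t powr (real n / real m)) ^ r"
        by (intro power_mono s) auto
      also have "\<dots> = (norm t powr (real n / real m)) powr real r"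
        using t by (intro powr_realpow[symmetric]) auto
      finally show ?thesis by (simp add: powr_powr)
    qed
    have "norm (s ^ r / t ^ dg r) = norm s ^ r * norm t powr (- real (dg r))"
      using t by (simp add: norm_divide norm_power powr_minus_divide powr_realpow)
    also have "\<dots> \<le> norm t powr (real n * real r / real m) * norm t powr (- ((real k + real n * real r) / real m))"
      by (intro mult_mono 1 2) auto
    also have "\<dots> = norm t powr (- (real k / real m))"
      using m by (simp add: powr_add[symmetric] field_simps)
    finally show ?thesis .
  qed
  have "norm (\<Sum>r<m. s ^ r / t ^ dg r * cf (of_nat (r + 1)) ?u * cf (of_real (ec r)) t)
     \<le> (\<Sum>r<m. norm t powr (- (real k / real m)) * ((2 * real (r + 1) + real m) / (norm (1 - ?u))\<^sup>2)
           * ((2 * \<bar>ec r\<bar> + real m) / (norm (1 - t))\<^sup>2))"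
  proof (intro sum_norm_le)
    fix r
    have "norm (cf (of_nat (r + 1)) ?u) \<le> (2 * real (r + 1) + real m) / (norm (1 - ?u))\<^sup>2"
      using norm_cf_le[OF u, of "of_nat (r + 1)"] by (simp only: norm_of_nat)
    moreover have "norm (cf (of_real (ec r)) t) \<le> (2 * \<bar>ec r\<bar> + real m) / (norm (1 - t))\<^sup>2"
      using norm_cf_le[OF t(2), of "of_real (ec r)"] by simp
    ultimately show "norm (s ^ r / t ^ dg r * cf (of_nat (r + 1)) ?u * cf (of_real (ec r)) t)
      \<le> norm t powr (- (real k / real m)) * ((2 * real (r + 1) + real m) / (norm (1 - ?u))\<^sup>2)
           * ((2 * \<bar>ec r\<bar> + real m) / (norm (1 - t))\<^sup>2)"
      unfolding norm_mult by (intro mult_mono d) (auto intro!: mult_nonneg_nonneg)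
  qed
  also have "\<dots> = (norm t powr (- (real k / real m)) / ?N) * (\<Sum>r<m. (2 * real (r + 1) + real m) * (2 * \<bar>ec r\<bar> + real m))"
    by (subst sum_distrib_left) (intro sum.cong refl, simp)
  finally have B: "norm (\<Sum>r<m. s ^ r / t ^ dg r * cf (of_nat (r + 1)) ?u * cf (of_real (ec r)) t)
    \<le> (norm t powr (- (real k / real m)) / ?N) * (\<Sum>r<m. (2 * real (r + 1) + real m) * (2 * \<bar>ec r\<bar> + real m))" .
  have "norm (kern s t) = 1 / (pi\<^sup>2 * real m) * norm (\<Sum>r<m. s ^ r / t ^ dg r * cf (of_nat (r + 1)) ?u * cf (of_real (ec r)) t)"
    unfolding kern_def norm_mult norm_divide by (simp add: norm_power)
  also have "\<dots> \<le> 1 / (pi\<^sup>2 * real m) * ((norm t powr (- (real k / real m)) / ?N) * (\<Sum>r<m. (2 * real (r + 1) + real m) * (2 * \<bar>ec r\<bar> + real m)))"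
    by (intro mult_left_mono B) auto
  also have "\<dots> = kernel_const * norm t powr (- (real k / real m)) / ?N"
    by (simp add: kernel_const_def)
  finally show ?thesis .
qed

lemma \<Omega>_kernel_args:
  assumes z: "z \<in> \<Omega>" and w: "w \<in> \<Omega>"
  defines "s \<equiv> fst z * cnj (fst w)" and "t \<equiv> snd z * cnj (snd w)"
  shows "t \<noteq> 0" "norm t < 1" "norm s ^ m < norm t ^ n"
    "norm (s ^ m / t ^ n) ^ 2 = X z ^ m * X w ^ m" "(norm t)\<^sup>2 = Y z * Y w"
proof -
  note nz = snd_nonzero[OF z] snd_nonzero[OF w]
  show "t \<noteq> 0" using nz by (simp add: t_def)
  show "norm t < 1"
  proof -
    have "norm (snd z) * norm (snd w) < 1 * 1"
      using z w nz by (intro mult_strict_mono) (auto simp: mem_\<Omega>_iff)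
    thus ?thesis by (simp add: t_def norm_mult)
  qed
  show "norm s ^ m < norm t ^ n"
    using z w nz by (auto simp: s_def t_def norm_mult power_mult_distrib mem_\<Omega>_iff intro!: mult_strict_mono)
  have e: "(a ^ j)\<^sup>2 = a ^ (2 * j)" for a :: real and j
    by (simp add: power_mult[symmetric] mult.commute)
  have "norm (s ^ m / t ^ n) = norm (fst z) ^ m * norm (fst w) ^ m / (norm (snd z) ^ n * norm (snd w) ^ n)"
    by (simp add: s_def t_def norm_mult norm_divide norm_power power_mult_distrib)
  thus "norm (s ^ m / t ^ n) ^ 2 = X z ^ m * X w ^ m"
    unfolding X_power[OF nz(1)] X_power[OF nz(2)] by (simp only: power_divide power_mult_distrib e times_divide_times_eq)
  show "(norm t)\<^sup>2 = Y z * Y w"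
    by (simp add: Y_def t_def norm_mult power_mult_distrib)
qed

lemma norm_K_le:
  assumes z: "z \<in> \<Omega>" and w: "w \<in> \<Omega>"
  shows "norm (K z w) \<le> kernel_const * (Y z * Y w) powr (- (real k / (2 * real m))) /
    ((norm (1 - (fst z * cnj (fst w)) ^ m / (snd z * cnj (snd w)) ^ n))\<^sup>2 * (norm (1 - snd z * cnj (snd w)))\<^sup>2)"
proof -
  note a = \<Omega>_kernel_args[OF z w]
  have "norm (snd z * cnj (snd w)) powr (- (real k / real m)) = (Y z * Y w) powr (- (real k / (2 * real m)))"
  proof -
    have "(x\<^sup>2) powr (- (real k / (2 * real m))) = x powr (- (real k / real m))" if "x > 0" for x :: real
    proof -
      have "(x\<^sup>2) powr (- (real k / (2 * real m))) = (x powr 2) powr (- (real k / (2 * real m)))"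
        using that by simp
      also have "\<dots> = x powr (- (real k / real m))"
        unfolding powr_powr by simp
      finally show ?thesis .
    qed
    from this[of "norm (snd z * cnj (snd w))"] a(1) show ?thesis
      unfolding a(5) by simp
  qed
  thus ?thesis
    using norm_kern_le[OF a(1-3)] by (simp add: K_def)
qed

end

section \<open>Measurability, rotations and radial integration on the domain\<close>

lemma borel_measurable_fst_comp [measurable (raw)]:
  fixes f :: "'a \<Rightarrow> 'b::second_countable_topology \<times> 'c::second_countable_topology"
  shows "f \<in> borel_measurable M \<Longrightarrow> (\<lambda>x. fst (f x)) \<in> borel_measurable M"
  by (erule measurable_compose) (auto intro!: borel_measurable_continuous_onI continuous_intros)

lemma borel_measurable_snd_comp [measurable (raw)]:
  fixes f :: "'a \<Rightarrow> 'b::second_countable_topology \<times> 'c::second_countable_topology"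
  shows "f \<in> borel_measurable M \<Longrightarrow> (\<lambda>x. snd (f x)) \<in> borel_measurable M"
  by (erule measurable_compose) (auto intro!: borel_measurable_continuous_onI continuous_intros)

lemma borel_measurable_cnj [measurable (raw)]:
  "f \<in> borel_measurable M \<Longrightarrow> (\<lambda>x. cnj (f x)) \<in> borel_measurable M"
  by (erule measurable_compose) (auto intro!: borel_measurable_continuous_onI continuous_intros)

lemma measurable_restrict_lborel_id [measurable]: "(\<lambda>x. x) \<in> borel_measurable (restrict_space lborel S)"
  by (intro measurable_restrict_space1) auto

lemma measurable_fst_restrict_lborel [measurable]:
  "fst \<in> borel_measurable (restrict_space lborel S \<Otimes>\<^sub>M N)"
  "snd \<in> borel_measurable (N \<Otimes>\<^sub>M restrict_space lborel S)"
  by (rule measurable_compose[OF measurable_fst measurable_restrict_lborel_id]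
      measurable_compose[OF measurable_snd measurable_restrict_lborel_id])+

context hartogs
begin

lemma space_\<mu> [simp]: "space \<mu> = \<Omega>"
  by (simp add: space_restrict_space)

lemma sigma_finite_\<mu>: "sigma_finite_measure \<mu>"
  by (intro sigma_finite_measure_restrict_space) (auto intro: lborel.sigma_finite_measure_axioms)

lemma measurable_\<mu> [measurable (raw)]: "f \<in> borel_measurable borel \<Longrightarrow> f \<in> borel_measurable \<mu>"
  by (intro measurable_restrict_space1) auto

lemma measurable_X [measurable]: "X \<in> borel_measurable borel"
  and measurable_Y [measurable]: "Y \<in> borel_measurable borel"
  unfolding X_def[abs_def] Y_def[abs_def] by measurable

lemma nn_integral_\<mu>:
  assumes [measurable]: "g \<in> borel_measurable borel"
  shows "(\<integral>\<^sup>+w. g w \<partial>\<mu>) = (\<integral>\<^sup>+w. g w * indicator \<Omega> w \<partial>lborel)"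
  by (subst nn_integral_restrict_space) auto

lemma nn_integral_\<mu>_iterated:
  assumes [measurable]: "g \<in> borel_measurable borel"
  shows "(\<integral>\<^sup>+w. g w \<partial>\<mu>) = (\<integral>\<^sup>+w2. \<integral>\<^sup>+w1. g (w1, w2) * indicator \<Omega> (w1, w2) \<partial>lborel \<partial>lborel)"
proof -
  have "(\<integral>\<^sup>+w. g w \<partial>\<mu>) = (\<integral>\<^sup>+w. g w * indicator \<Omega> w \<partial>(lborel \<Otimes>\<^sub>M lborel))"
    by (simp add: nn_integral_\<mu> lborel_prod)
  also have "\<dots> = (\<integral>\<^sup>+w2. \<integral>\<^sup>+w1. g (w1, w2) * indicator \<Omega> (w1, w2) \<partial>lborel \<partial>lborel)"
    by (subst lborel_pair.nn_integral_snd[symmetric]) (auto simp: lborel_prod)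
  finally show ?thesis .
qed

definition rot :: "complex \<Rightarrow> complex \<Rightarrow> complex \<times> complex \<Rightarrow> complex \<times> complex" where
  "rot c d w = (c * fst w, d * snd w)"

lemma fst_rot [simp]: "fst (rot c d w) = c * fst w" and snd_rot [simp]: "snd (rot c d w) = d * snd w"
  by (simp_all add: rot_def)

lemma continuous_on_rot: "continuous_on S (rot c d)"
  unfolding rot_def[abs_def] by (intro continuous_intros)

lemma measurable_rot [measurable]: "rot c d \<in> borel_measurable borel"
  by (intro borel_measurable_continuous_onI continuous_on_rot)

lemma rot_mem_\<Omega>_iff [simp]: "norm c = 1 \<Longrightarrow> norm d = 1 \<Longrightarrow> rot c d w \<in> \<Omega> \<longleftrightarrow> w \<in> \<Omega>"
  by (simp add: mem_\<Omega>_iff norm_mult)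

lemma X_rot [simp]: "norm c = 1 \<Longrightarrow> norm d = 1 \<Longrightarrow> X (rot c d w) = X w"
  and Y_rot [simp]: "norm d = 1 \<Longrightarrow> Y (rot c d w) = Y w"
  by (simp_all add: X_def Y_def norm_mult)

lemma distr_rot:
  assumes "norm c = 1" "norm d = 1"
  shows "distr lborel borel (rot c d) = lborel"
proof (rule lborel_distr_isometry)
  show "linear (rot c d)"
    by (intro linearI) (auto simp: rot_def algebra_simps)
  show "norm (rot c d x) = norm x" for x
    by (cases x) (simp add: rot_def norm_Pair norm_mult assms)
qed

lemma nn_integral_\<mu>_rot:
  assumes [measurable]: "g \<in> borel_measurable borel" and c: "norm c = 1" "norm d = 1"
  shows "(\<integral>\<^sup>+w. g (rot c d w) \<partial>\<mu>) = (\<integral>\<^sup>+w. g w \<partial>\<mu>)"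
proof -
  have "(\<integral>\<^sup>+w. g w \<partial>\<mu>) = (\<integral>\<^sup>+w. g w * indicator \<Omega> w \<partial>distr lborel borel (rot c d))"
    by (simp add: nn_integral_\<mu> distr_rot c)
  also have "\<dots> = (\<integral>\<^sup>+w. g (rot c d w) * indicator \<Omega> w \<partial>lborel)"
    by (subst nn_integral_distr) (auto simp: indicator_def c)
  finally show ?thesis
    by (simp add: nn_integral_\<mu>)
qed

text \<open>Each rotation preserves the measure; averaging over the angle and Tonelli give the
  claim. Two separate functions \<open>f1\<close>, \<open>f2\<close> allow one coordinate to turn
  while the other stays fixed.\<close>

lemma nn_integral_\<mu>_mean:
  assumes [measurable]: "g \<in> borel_measurable borel" "f1 \<in> borel_measurable borel" "f2 \<in> borel_measurable borel"
    and f: "\<And>\<theta>. norm (f1 \<theta>) = 1" "\<And>\<theta>. norm (f2 \<theta>) = 1"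
  shows "(\<integral>\<^sup>+w. g w \<partial>\<mu>) = (\<integral>\<^sup>+w. \<integral>\<^sup>+\<theta>. g (rot (f1 \<theta>) (f2 \<theta>) w) \<partial>\<U> \<partial>\<mu>)"
proof -
  interpret U: sigma_finite_measure \<U> by (rule sigma_finite_U)
  interpret mu: sigma_finite_measure \<mu> by (rule sigma_finite_\<mu>)
  interpret pair_sigma_finite \<U> \<mu> ..
  have [measurable]: "f1 \<in> borel_measurable \<U>" "f2 \<in> borel_measurable \<U>"
    by (auto intro: measurable_restrict_space1)
  have "(\<integral>\<^sup>+w. \<integral>\<^sup>+\<theta>. g (rot (f1 \<theta>) (f2 \<theta>) w) \<partial>\<U> \<partial>\<mu>) = (\<integral>\<^sup>+\<theta>. \<integral>\<^sup>+w. g (rot (f1 \<theta>) (f2 \<theta>) w) \<partial>\<mu> \<partial>\<U>)"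
    unfolding rot_def by (rule Fubini') measurable
  also have "\<dots> = (\<integral>\<^sup>+\<theta>. (\<integral>\<^sup>+w. g w \<partial>\<mu>) \<partial>\<U>)"
    by (intro nn_integral_cong nn_integral_\<mu>_rot) (auto simp: f)
  also have "\<dots> = (\<integral>\<^sup>+w. g w \<partial>\<mu>)"
    by simp
  finally show ?thesis ..
qed

text \<open>For fixed \<open>y = |w2|^2\<close> the first coordinate runs over the disc
  \<open>|w1|^2 < y^(n/m)\<close>. Rescaling it to \<open>x\<close> in [0,1) produces the Jacobian
  \<open>y^(n/m)\<close>, and the two radial substitutions contribute one factor \<open>pi\<close>
  each.\<close>

lemma nn_integral_\<mu>_radial:
  fixes G :: "real \<times> real \<Rightarrow> ennreal"
  assumes [measurable]: "G \<in> borel_measurable borel"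
  shows "(\<integral>\<^sup>+w. G (X w, Y w) \<partial>\<mu>) =
    ennreal (pi\<^sup>2) * (\<integral>\<^sup>+y. \<integral>\<^sup>+x. ennreal (y powr (real n / real m)) * G (x, y) * indicator {0..<1} x * indicator {0<..<1} y \<partial>lborel \<partial>lborel)"
proof -
  define R where "R = (\<lambda>y. \<integral>\<^sup>+x. ennreal (y powr (real n / real m)) * G (x, y) * indicator {0..<1} x * indicator {0<..<1} y \<partial>lborel)"
  have [measurable]: "R \<in> borel_measurable borel"
    unfolding R_def by measurable
  have inner: "(\<integral>\<^sup>+w1. G (X (w1, w2), Y (w1, w2)) * indicator \<Omega> (w1, w2) \<partial>lborel) = ennreal pi * R ((norm w2)\<^sup>2)" for w2
  proof (cases "0 < norm w2 \<and> norm w2 < 1")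
    case False
    hence "indicator \<Omega> (w1, w2) = (0::ennreal)" for w1
      using snd_nonzero[of "(w1, w2)"] by (auto simp: mem_\<Omega>_iff indicator_def)
    moreover have "(norm w2)\<^sup>2 \<notin> {0<..<1}"
      using False by (auto simp: abs_square_less_1)
    ultimately show ?thesis by (simp add: R_def)
  next
    case True
    define y where "y = (norm w2)\<^sup>2"
    have y: "0 < y" "y < 1" using True by (auto simp: y_def abs_square_less_1)
    define c where "c = y powr (real n / real m)"
    have c: "c > 0" using y by (simp add: c_def)
    have "(\<integral>\<^sup>+w1. G (X (w1, w2), Y (w1, w2)) * indicator \<Omega> (w1, w2) \<partial>lborel)
        = (\<integral>\<^sup>+(w1::complex). G ((norm w1)\<^sup>2 / c, y) * indicator {..<c} ((norm w1)\<^sup>2) \<partial>lborel)"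
    proof (rule nn_integral_cong)
      fix w1
      have "(w1, w2) \<in> \<Omega> \<longleftrightarrow> (norm w1)\<^sup>2 < c"
        using y c unfolding mem_\<Omega>_iff_XY by (simp add: X_def Y_def flip: y_def c_def)
      thus "G (X (w1, w2), Y (w1, w2)) * indicator \<Omega> (w1, w2) = G ((norm w1)\<^sup>2 / c, y) * indicator {..<c} ((norm w1)\<^sup>2)"
        by (simp add: X_def Y_def indicator_def flip: y_def c_def)
    qed
    also have "\<dots> = ennreal pi * (\<integral>\<^sup>+v. G (v / c, y) * indicator {..<c} v * indicator {0..} v \<partial>lborel)"
      by (rule nn_integral_radial[of "\<lambda>v. G (v / c, y) * indicator {..<c} v"]) measurable
    also have "(\<integral>\<^sup>+v. G (v / c, y) * indicator {..<c} v * indicator {0..} v \<partial>lborel)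
        = ennreal c * (\<integral>\<^sup>+x. G (x, y) * indicator {0..<1} x \<partial>lborel)"
    proof -
      have "G (c * x / c, y) * indicator {..<c} (c * x) * indicator {0..} (c * x) = G (x, y) * indicator {0..<1} x" for x
        using c mult_less_cancel_left_pos[OF c, of x 1] by (auto simp: indicator_def zero_le_mult_iff)
      thus ?thesis
        using c by (subst nn_integral_real_affine[of _ c 0]) simp_all
    qed
    also have "\<dots> = R y"
      using y by (simp add: R_def c_def nn_integral_cmult mult.assoc)
    finally show ?thesis by (simp add: y_def)
  qed
  have "(\<integral>\<^sup>+w. G (X w, Y w) \<partial>\<mu>) = (\<integral>\<^sup>+(w2::complex). ennreal pi * R ((norm w2)\<^sup>2) \<partial>lborel)"
    by (subst nn_integral_\<mu>_iterated) (auto simp: inner)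
  also have "\<dots> = ennreal pi * (\<integral>\<^sup>+(w2::complex). R ((norm w2)\<^sup>2) \<partial>lborel)"
    by (rule nn_integral_cmult) (simp add: measurable_compose[where g=R and N=borel])
  also have "(\<integral>\<^sup>+(w2::complex). R ((norm w2)\<^sup>2) \<partial>lborel) = ennreal pi * (\<integral>\<^sup>+y. R y * indicator {0..} y \<partial>lborel)"
    by (rule nn_integral_radial) measurable
  also have "(\<integral>\<^sup>+y. R y * indicator {0..} y \<partial>lborel) = (\<integral>\<^sup>+y. R y \<partial>lborel)"
    by (intro nn_integral_cong) (auto simp: R_def indicator_def)
  finally show ?thesis
    by (simp add: R_def power2_eq_square ennreal_mult' mult.assoc)
qed

section \<open>Torus averages and weighted integrals of the kernel\<close>

lemma Poisson_mean_cnj: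
  assumes "norm c < 1" "l > 0"
  shows "(\<integral>\<^sup>+x. ennreal (1 / (norm (1 - c * cnj (unit_circle x) ^ l))\<^sup>2) \<partial>\<U>) \<le> ennreal (1 / (1 - (norm c)\<^sup>2))"
proof -
  have "norm (1 - c * cnj (unit_circle x) ^ l) = norm (1 - cnj c * unit_circle x ^ l)" for x
  proof -
    have "1 - c * cnj (unit_circle x) ^ l = cnj (1 - cnj c * unit_circle x ^ l)" by simp
    thus ?thesis by (simp only: complex_mod_cnj)
  qed
  thus ?thesis
    using Poisson_mean[of "cnj c" l] assms by simp
qed

abbreviation P1 :: "complex \<times> complex \<Rightarrow> complex \<times> complex \<Rightarrow> real" where
  "P1 z w \<equiv> 1 / (norm (1 - (fst z * cnj (fst w)) ^ m / (snd z * cnj (snd w)) ^ n))\<^sup>2"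

abbreviation P2 :: "complex \<times> complex \<Rightarrow> complex \<times> complex \<Rightarrow> real" where
  "P2 z w \<equiv> 1 / (norm (1 - snd z * cnj (snd w)))\<^sup>2"

text \<open>Averaging over the torus turns \<open>|1 - u|^(-2)\<close> into \<open>1 / (1 - |u|^2)\<close>, a radial function.\<close>

lemma nn_integral_Poisson_factors:
  fixes G :: "real \<times> real \<Rightarrow> ennreal"
  assumes [measurable]: "G \<in> borel_measurable borel" and z: "z \<in> \<Omega>"
  shows "(\<integral>\<^sup>+w. ennreal (P1 z w * P2 z w) * G (X w, Y w) \<partial>\<mu>)
     \<le> (\<integral>\<^sup>+w. ennreal (1 / ((1 - X z * X w) * (1 - Y z * Y w))) * G (X w, Y w) \<partial>\<mu>)"
proof -
  have [measurable]: "P1 z \<in> borel_measurable borel" "P2 z \<in> borel_measurable borel"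
    by measurable
  have XY: "0 \<le> X z * X w" "X z * X w < 1" "0 \<le> Y z * Y w" "Y z * Y w < 1" if "w \<in> \<Omega>" for w
  proof -
    have "X z < 1" "X w < 1" "Y z < 1" "Y w < 1"
      using z that by (auto simp: mem_\<Omega>_iff_XY)
    thus "0 \<le> X z * X w" "X z * X w < 1" "0 \<le> Y z * Y w" "Y z * Y w < 1"
      using mult_strict_mono[of "X z" 1 "X w" 1] mult_strict_mono[of "Y z" 1 "Y w" 1] by auto
  qed
  have "(\<integral>\<^sup>+w. ennreal (P1 z w * P2 z w) * G (X w, Y w) \<partial>\<mu>)
    = (\<integral>\<^sup>+w. \<integral>\<^sup>+\<theta>. ennreal (P1 z (rot (unit_circle \<theta>) 1 w) * P2 z (rot (unit_circle \<theta>) 1 w))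
         * G (X (rot (unit_circle \<theta>) 1 w), Y (rot (unit_circle \<theta>) 1 w)) \<partial>\<U> \<partial>\<mu>)"
    by (rule nn_integral_\<mu>_mean) auto
  \<comment> \<open>The order matters: turning \<open>w1\<close> multiplies \<open>u\<close> by a
    unimodular factor and leaves \<open>t\<close> alone, so \<open>P2\<close> is constant in this
    mean. Turning \<open>w2\<close> would move both \<open>u\<close> and \<open>t\<close>, so it
    comes second, when the first factor is already radial.\<close>
  also have "\<dots> \<le> (\<integral>\<^sup>+w. ennreal (P2 z w) * ennreal (1 / (1 - X z * X w)) * G (X w, Y w) \<partial>\<mu>)"
  proof (rule nn_integral_mono)
    fix w assume "w \<in> space \<mu>" hence w: "w \<in> \<Omega>" by simp
    define u where "u = (fst z * cnj (fst w)) ^ m / (snd z * cnj (snd w)) ^ n"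
    note a = \<Omega>_kernel_args[OF z w, folded u_def]
    have u: "norm u < 1"
      using a(1,3) unfolding u_def by (simp add: norm_divide norm_power)
    \<comment> \<open>Dropping the exponent loses sharpness but leaves the factor
      \<open>1 / (1 - X z * X w)\<close> that the one-variable estimate handles.\<close>
    have "(X z * X w) ^ m \<le> (X z * X w) ^ 1"
      using XY[OF w] m by (intro power_decreasing) auto
    hence u2: "(norm u)\<^sup>2 \<le> X z * X w"
      using a(4) by (simp add: power_mult_distrib)
    have P1: "P1 z (rot (unit_circle \<theta>) 1 w) = 1 / (norm (1 - u * cnj (unit_circle \<theta>) ^ m))\<^sup>2" for \<theta>
      by (simp add: u_def power_mult_distrib mult_ac)
    have P2': "P2 z (rot (unit_circle \<theta>) 1 w) = P2 z w" for \<theta>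
      by simp
    have "(\<integral>\<^sup>+\<theta>. ennreal (P1 z (rot (unit_circle \<theta>) 1 w) * P2 z (rot (unit_circle \<theta>) 1 w))
         * G (X (rot (unit_circle \<theta>) 1 w), Y (rot (unit_circle \<theta>) 1 w)) \<partial>\<U>)
      = (\<integral>\<^sup>+\<theta>. ennreal (1 / (norm (1 - u * cnj (unit_circle \<theta>) ^ m))\<^sup>2) * (ennreal (P2 z w) * G (X w, Y w)) \<partial>\<U>)"
      unfolding P1 P2' by (intro nn_integral_cong, subst ennreal_mult) (simp_all add: mult.assoc)
    also have "\<dots> = (\<integral>\<^sup>+\<theta>. ennreal (1 / (norm (1 - u * cnj (unit_circle \<theta>) ^ m))\<^sup>2) \<partial>\<U>) * (ennreal (P2 z w) * G (X w, Y w))"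
      by (rule nn_integral_multc) measurable
    also have "\<dots> \<le> ennreal (1 / (1 - X z * X w)) * (ennreal (P2 z w) * G (X w, Y w))"
      by (intro mult_right_mono order_trans[OF Poisson_mean_cnj] ennreal_leI divide_left_mono)
        (use u m u2 XY[OF w] in \<open>auto intro!: mult_pos_pos\<close>)
    finally show "(\<integral>\<^sup>+\<theta>. ennreal (P1 z (rot (unit_circle \<theta>) 1 w) * P2 z (rot (unit_circle \<theta>) 1 w))
         * G (X (rot (unit_circle \<theta>) 1 w), Y (rot (unit_circle \<theta>) 1 w)) \<partial>\<U>)
       \<le> ennreal (P2 z w) * ennreal (1 / (1 - X z * X w)) * G (X w, Y w)"
      by (simp add: mult_ac)
  qed
  also have "\<dots> = (\<integral>\<^sup>+w. \<integral>\<^sup>+\<theta>. ennreal (P2 z (rot 1 (unit_circle \<theta>) w)) * ennreal (1 / (1 - X z * X (rot 1 (unit_circle \<theta>) w)))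
         * G (X (rot 1 (unit_circle \<theta>) w), Y (rot 1 (unit_circle \<theta>) w)) \<partial>\<U> \<partial>\<mu>)"
    by (rule nn_integral_\<mu>_mean) auto
  also have "\<dots> \<le> (\<integral>\<^sup>+w. ennreal (1 / ((1 - X z * X w) * (1 - Y z * Y w))) * G (X w, Y w) \<partial>\<mu>)"
  proof (rule nn_integral_mono)
    fix w assume "w \<in> space \<mu>" hence w: "w \<in> \<Omega>" by simp
    define t where "t = snd z * cnj (snd w)"
    note a = \<Omega>_kernel_args[OF z w, folded t_def]
    have P2: "P2 z (rot 1 (unit_circle \<theta>) w) = 1 / (norm (1 - t * cnj (unit_circle \<theta>) ^ 1))\<^sup>2" for \<theta>
      by (simp add: t_def mult_ac)
    have "(\<integral>\<^sup>+\<theta>. ennreal (P2 z (rot 1 (unit_circle \<theta>) w)) * ennreal (1 / (1 - X z * X (rot 1 (unit_circle \<theta>) w)))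
         * G (X (rot 1 (unit_circle \<theta>) w), Y (rot 1 (unit_circle \<theta>) w)) \<partial>\<U>)
      = (\<integral>\<^sup>+\<theta>. ennreal (1 / (norm (1 - t * cnj (unit_circle \<theta>) ^ 1))\<^sup>2) * (ennreal (1 / (1 - X z * X w)) * G (X w, Y w)) \<partial>\<U>)"
      unfolding P2 by (simp add: mult.assoc)
    also have "\<dots> = (\<integral>\<^sup>+\<theta>. ennreal (1 / (norm (1 - t * cnj (unit_circle \<theta>) ^ 1))\<^sup>2) \<partial>\<U>) * (ennreal (1 / (1 - X z * X w)) * G (X w, Y w))"
      by (rule nn_integral_multc) measurable
    also have "\<dots> \<le> ennreal (1 / (1 - Y z * Y w)) * (ennreal (1 / (1 - X z * X w)) * G (X w, Y w))"
      using Poisson_mean_cnj[of t 1] a(2,5) by (intro mult_right_mono) auto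
    also have "\<dots> = ennreal (1 / ((1 - X z * X w) * (1 - Y z * Y w))) * G (X w, Y w)"
    proof -
      have "ennreal (1 / ((1 - X z * X w) * (1 - Y z * Y w))) = ennreal (1 / (1 - Y z * Y w)) * ennreal (1 / (1 - X z * X w))"
        using XY[OF w] by (subst ennreal_mult'[symmetric]) auto
      thus ?thesis by (simp add: mult.assoc)
    qed
    finally show "(\<integral>\<^sup>+\<theta>. ennreal (P2 z (rot 1 (unit_circle \<theta>) w)) * ennreal (1 / (1 - X z * X (rot 1 (unit_circle \<theta>) w)))
         * G (X (rot 1 (unit_circle \<theta>) w), Y (rot 1 (unit_circle \<theta>) w)) \<partial>\<U>)
       \<le> ennreal (1 / ((1 - X z * X w) * (1 - Y z * Y w))) * G (X w, Y w)" .
  qed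
  finally show ?thesis .
qed

text \<open>As \<open>Y\<close> is a squared modulus, the first factor is
  \<open>|z2|^(-\<sigma>)\<close>. A power of such a weight is again one, with both parameters
  scaled, so one integral estimate yields both hypotheses of Schur's test.\<close>

definition schur_weight :: "real \<Rightarrow> real \<Rightarrow> complex \<times> complex \<Rightarrow> real" where
  "schur_weight \<sigma> \<epsilon> z = Y z powr (- \<sigma> / 2) * ((1 - X z) * (1 - Y z)) powr (- \<epsilon>)"

text \<open>The upper bound on \<open>\<sigma>\<close> makes the integral in \<open>y\<close>
  converge at 0; the lower bound ensures that the weight is at least as singular in \<open>z\<close>
  as the kernel. After averaging, the integral factors into two Forelli-Rudin integrals.\<close>

lemma kernel_weight_integral:
  assumes \<epsilon>: "0 < \<epsilon>" "\<epsilon> < 1" and \<sigma>: "real k / real m \<le> \<sigma>" "\<sigma> < (2 * real (m + n) - real k) / real m"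
  shows "\<exists>C>0. \<forall>z\<in>\<Omega>. (\<integral>\<^sup>+w. ennreal (norm (K z w) * schur_weight \<sigma> \<epsilon> w) \<partial>\<mu>) \<le> ennreal (C * schur_weight \<sigma> \<epsilon> z)"
proof -
  \<comment> \<open>The exponent of \<open>y\<close> at 0: the Jacobian \<open>n / m\<close>, the
    singularity of the kernel in \<open>w\<close>, and the weight. The upper bound on
    \<open>\<sigma>\<close> is equivalent to \<open>\<delta> > -1\<close>.\<close>
  define \<delta> where "\<delta> = real n / real m - real k / (2 * real m) - \<sigma> / 2"
  have \<delta>: "\<delta> > -1"
    using \<sigma>(2) m by (simp add: \<delta>_def field_simps)
  obtain C1 where C1: "C1 > 0" "\<And>X. 0 \<le> X \<Longrightarrow> X < 1 \<Longrightarrow>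
     (\<integral>\<^sup>+x. ennreal (x powr 0 * (1 - x) powr (-\<epsilon>) / (1 - X * x)) * indicator {0<..<1} x \<partial>lborel)
       \<le> ennreal (C1 * (1 - X) powr (-\<epsilon>))"
    using Forelli_Rudin_interval[OF \<epsilon>, of 0] by auto
  obtain C2 where C2: "C2 > 0" "\<And>X. 0 \<le> X \<Longrightarrow> X < 1 \<Longrightarrow>
     (\<integral>\<^sup>+x. ennreal (x powr \<delta> * (1 - x) powr (-\<epsilon>) / (1 - X * x)) * indicator {0<..<1} x \<partial>lborel)
       \<le> ennreal (C2 * (1 - X) powr (-\<epsilon>))"
    using Forelli_Rudin_interval[OF \<epsilon> \<delta>] by auto
  define \<kappa> where "\<kappa> = real k / (2 * real m)"
  \<comment> \<open>The summand 1 only secures positivity, as \<open>kernel_const\<close> is just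
    known to be nonnegative.\<close>
  define C where "C = (kernel_const + 1) * pi\<^sup>2 * C1 * C2"
  have "C > 0" using C1 C2 kernel_const_nonneg by (simp add: C_def)
  moreover have "(\<integral>\<^sup>+w. ennreal (norm (K z w) * schur_weight \<sigma> \<epsilon> w) \<partial>\<mu>) \<le> ennreal (C * schur_weight \<sigma> \<epsilon> z)" if z: "z \<in> \<Omega>" for z
  proof -
    have Xz: "0 \<le> X z" "X z < 1" and Yz: "0 < Y z" "Y z < 1"
      using z by (auto simp: mem_\<Omega>_iff_XY)
    define a where "a = (kernel_const + 1) * Y z powr (-\<kappa>)"
    have a: "a \<ge> 0" using kernel_const_nonneg by (simp add: a_def)
    define G :: "real \<times> real \<Rightarrow> real" where
      "G = (\<lambda>(x, y). y powr (-\<kappa> - \<sigma> / 2) * ((1 - x) * (1 - y)) powr (-\<epsilon>))"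
    have [measurable]: "G \<in> borel_measurable borel"
      unfolding G_def borel_prod[symmetric] by measurable
    have "(\<integral>\<^sup>+w. ennreal (norm (K z w) * schur_weight \<sigma> \<epsilon> w) \<partial>\<mu>)
       \<le> (\<integral>\<^sup>+w. ennreal a * (ennreal (P1 z w * P2 z w) * ennreal (G (X w, Y w))) \<partial>\<mu>)"
    proof (rule nn_integral_mono)
      fix w assume "w \<in> space \<mu>" hence w: "w \<in> \<Omega>" by simp
      have Yw: "0 < Y w" using w by (auto simp: mem_\<Omega>_iff_XY)
      have "norm (K z w) \<le> kernel_const * (Y z * Y w) powr (-\<kappa>) * (P1 z w * P2 z w)"
        using norm_K_le[OF z w] by (simp add: \<kappa>_def)
      also have "\<dots> \<le> (kernel_const + 1) * (Y z * Y w) powr (-\<kappa>) * (P1 z w * P2 z w)"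
        by (intro mult_right_mono) auto
      finally have "norm (K z w) * schur_weight \<sigma> \<epsilon> w \<le> (kernel_const + 1) * (Y z * Y w) powr (-\<kappa>) * (P1 z w * P2 z w) * schur_weight \<sigma> \<epsilon> w"
        by (intro mult_right_mono) (auto simp: schur_weight_def)
      also have "\<dots> = a * ((P1 z w * P2 z w) * G (X w, Y w))"
        using Yz Yw powr_add[of "Y w" "-\<kappa>" "-\<sigma>/2"]
        by (simp add: a_def G_def schur_weight_def powr_mult)
      finally show "ennreal (norm (K z w) * schur_weight \<sigma> \<epsilon> w) \<le> ennreal a * (ennreal (P1 z w * P2 z w) * ennreal (G (X w, Y w)))"
        using a by (subst ennreal_mult''[symmetric], simp add: G_def, subst ennreal_mult'[symmetric]) (auto intro!: ennreal_leI)
    qed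
    also have "\<dots> = ennreal a * (\<integral>\<^sup>+w. ennreal (P1 z w * P2 z w) * ennreal (G (X w, Y w)) \<partial>\<mu>)"
      by (rule nn_integral_cmult) measurable
    also have "\<dots> \<le> ennreal a * (\<integral>\<^sup>+w. ennreal (1 / ((1 - X z * X w) * (1 - Y z * Y w))) * ennreal (G (X w, Y w)) \<partial>\<mu>)"
      using nn_integral_Poisson_factors[of "\<lambda>v. ennreal (G v)", OF _ z] by (intro mult_left_mono) auto
    also have "(\<integral>\<^sup>+w. ennreal (1 / ((1 - X z * X w) * (1 - Y z * Y w))) * ennreal (G (X w, Y w)) \<partial>\<mu>)
       = ennreal (pi\<^sup>2) * (\<integral>\<^sup>+y. \<integral>\<^sup>+x. ennreal (y powr (real n / real m)) *
           (ennreal (1 / ((1 - X z * x) * (1 - Y z * y))) * ennreal (G (x, y))) * indicator {0..<1} x * indicator {0<..<1} y \<partial>lborel \<partial>lborel)"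
      using nn_integral_\<mu>_radial[of "\<lambda>(x, y). ennreal (1 / ((1 - X z * x) * (1 - Y z * y))) * ennreal (G (x, y))"]
      by (simp add: borel_prod[symmetric])
    also have "(\<integral>\<^sup>+y. \<integral>\<^sup>+x. ennreal (y powr (real n / real m)) *
           (ennreal (1 / ((1 - X z * x) * (1 - Y z * y))) * ennreal (G (x, y))) * indicator {0..<1} x * indicator {0<..<1} y \<partial>lborel \<partial>lborel)
      = (\<integral>\<^sup>+y. \<integral>\<^sup>+x. (ennreal (y powr \<delta> * (1 - y) powr (-\<epsilon>) / (1 - Y z * y)) * indicator {0<..<1} y) *
            (ennreal (x powr 0 * (1 - x) powr (-\<epsilon>) / (1 - X z * x)) * indicator {0<..<1} x) \<partial>lborel \<partial>lborel)"
    proof (rule nn_integral_cong, rule nn_integral_cong_AE)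
      fix y :: real
      show "AE x in lborel. ennreal (y powr (real n / real m)) *
           (ennreal (1 / ((1 - X z * x) * (1 - Y z * y))) * ennreal (G (x, y))) * indicator {0..<1} x * indicator {0<..<1} y
          = (ennreal (y powr \<delta> * (1 - y) powr (-\<epsilon>) / (1 - Y z * y)) * indicator {0<..<1} y) *
            (ennreal (x powr 0 * (1 - x) powr (-\<epsilon>) / (1 - X z * x)) * indicator {0<..<1} x)"
        \<comment> \<open>The two sides integrate over \<open>{0..<1}\<close> and
          \<open>{0<..<1}\<close>; removing the point 0 also avoids
          \<open>0 powr 0 = 0\<close>.\<close>
        using AE_lborel_singleton[of 0]
      proof eventually_elim
        case (elim x)
        show ?case
        proof (cases "0 < x \<and> x < 1 \<and> 0 < y \<and> y < 1")
          case True
          have "X z * x < 1" "Y z * y < 1"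
            using True Xz Yz mult_strict_mono[of "X z" 1 x 1] mult_strict_mono[of "Y z" 1 y 1] by auto
          moreover have "y powr \<delta> = y powr (real n / real m) * y powr (-\<kappa> - \<sigma> / 2)"
            by (simp add: powr_add[symmetric] \<delta>_def \<kappa>_def algebra_simps)
          moreover have "((1 - x) * (1 - y)) powr (-\<epsilon>) = (1 - x) powr (-\<epsilon>) * (1 - y) powr (-\<epsilon>)"
            by (simp add: powr_mult)
          moreover have alg: "a * (1 / (d * e) * (b * (p * q))) = a * b * q / e * (1 * p / d)" for a b d e p q :: real
            by (simp add: mult_ac)
          ultimately have eq: "y powr (real n / real m) * (1 / ((1 - X z * x) * (1 - Y z * y)) * G (x, y))
            = y powr \<delta> * (1 - y) powr (-\<epsilon>) / (1 - Y z * y) * (x powr 0 * (1 - x) powr (-\<epsilon>) / (1 - X z * x))"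
            using True by (simp only: G_def prod.case alg powr_zero_eq_one) simp
          have nn: "0 \<le> 1 / ((1 - X z * x) * (1 - Y z * y))" "0 \<le> G (x, y)"
            "0 \<le> y powr \<delta> * (1 - y) powr (-\<epsilon>) / (1 - Y z * y)"
            using \<open>X z * x < 1\<close> \<open>Y z * y < 1\<close> by (auto simp: G_def)
          have "ennreal (y powr (real n / real m)) * (ennreal (1 / ((1 - X z * x) * (1 - Y z * y))) * ennreal (G (x, y)))
            = ennreal (y powr (real n / real m) * (1 / ((1 - X z * x) * (1 - Y z * y)) * G (x, y)))"
            using nn by (simp only: ennreal_mult' powr_ge_zero)
          also have "\<dots> = ennreal (y powr \<delta> * (1 - y) powr (-\<epsilon>) / (1 - Y z * y))
             * ennreal (x powr 0 * (1 - x) powr (-\<epsilon>) / (1 - X z * x))"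
            unfolding eq using nn by (intro ennreal_mult')
          finally show ?thesis
            using True by simp
        qed (use elim in \<open>auto simp: indicator_def\<close>)
      qed
    qed
    also have "\<dots> = (\<integral>\<^sup>+y. ennreal (y powr \<delta> * (1 - y) powr (-\<epsilon>) / (1 - Y z * y)) * indicator {0<..<1} y \<partial>lborel)
       * (\<integral>\<^sup>+x. ennreal (x powr 0 * (1 - x) powr (-\<epsilon>) / (1 - X z * x)) * indicator {0<..<1} x \<partial>lborel)"
      by (simp add: nn_integral_cmult nn_integral_multc)
    also have "ennreal a * (ennreal (pi\<^sup>2) * \<dots>)
       \<le> ennreal a * (ennreal (pi\<^sup>2) * (ennreal (C2 * (1 - Y z) powr (-\<epsilon>)) * ennreal (C1 * (1 - X z) powr (-\<epsilon>))))"
      by (intro mult_left_mono mult_mono C1 C2 Xz) (use Yz in auto)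
    also have "\<dots> = ennreal (a * (pi\<^sup>2 * ((C2 * (1 - Y z) powr (-\<epsilon>)) * (C1 * (1 - X z) powr (-\<epsilon>)))))"
      using a C1 C2 by (simp add: ennreal_mult'[symmetric])
    also have "\<dots> \<le> ennreal (C * schur_weight \<sigma> \<epsilon> z)"
    proof (rule ennreal_leI)
      \<comment> \<open>Here the lower bound on \<open>\<sigma>\<close> is used: the singularity of
        the kernel in \<open>z\<close> is absorbed by the weight.\<close>
      have "Y z powr (-\<kappa>) \<le> Y z powr (-\<sigma>/2)"
        using Yz \<sigma>(1) by (intro powr_mono') (auto simp: \<kappa>_def)
      hence "Y z powr (-\<kappa>) * (((1 - X z) * (1 - Y z)) powr (-\<epsilon>)) \<le> schur_weight \<sigma> \<epsilon> z"
        unfolding schur_weight_def by (intro mult_right_mono) auto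
      hence "C * (Y z powr (-\<kappa>) * (((1 - X z) * (1 - Y z)) powr (-\<epsilon>))) \<le> C * schur_weight \<sigma> \<epsilon> z"
        using \<open>C > 0\<close> by (intro mult_left_mono) auto
      thus "a * (pi\<^sup>2 * ((C2 * (1 - Y z) powr (-\<epsilon>)) * (C1 * (1 - X z) powr (-\<epsilon>)))) \<le> C * schur_weight \<sigma> \<epsilon> z"
        using Xz Yz by (simp add: a_def C_def powr_mult mult_ac)
    qed
    finally show ?thesis .
  qed
  ultimately show ?thesis by blast
qed

end

section \<open>Holomorphy and mapping properties\<close>

definition holo2_at :: "(complex \<times> complex \<Rightarrow> complex) \<Rightarrow> complex \<times> complex \<Rightarrow> bool" where
  "holo2_at f z \<longleftrightarrow> (\<exists>a b. (f has_derivative (\<lambda>h. a * fst h + b * snd h)) (at z))"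

lemma holo2_atI:
  assumes "(f has_derivative f') (at z)" "\<And>h. f' h = a * fst h + b * snd h"
  shows "holo2_at f z"
proof -
  have "f' = (\<lambda>h. a * fst h + b * snd h)" using assms(2) by auto
  thus ?thesis using assms(1) by (auto simp: holo2_at_def)
qed

lemma holomorphic2_on_iff_holo2_at:
  assumes "open S"
  shows "holomorphic2_on f S \<longleftrightarrow> (\<forall>z\<in>S. holo2_at f z)"
  unfolding holomorphic2_on_def holo2_at_def
  by (intro ball_cong refl) (simp only: at_within_open[OF _ assms])

lemma holo2_const: "holo2_at (\<lambda>_. c) z"
  by (rule holo2_atI[where a=0 and b=0, OF has_derivative_const]) simp

lemma holo2_fst: "holo2_at fst z"
  by (rule holo2_atI[where a=1 and b=0, OF has_derivative_fst[OF has_derivative_ident]]) auto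

lemma holo2_snd: "holo2_at snd z"
  by (rule holo2_atI[where a=0 and b=1, OF has_derivative_snd[OF has_derivative_ident]]) auto

lemma holo2_add:
  assumes "holo2_at f z" "holo2_at g z"
  shows "holo2_at (\<lambda>z. f z + g z) z"
proof -
  obtain a b c d where f: "(f has_derivative (\<lambda>h. a * fst h + b * snd h)) (at z)"
    and g: "(g has_derivative (\<lambda>h. c * fst h + d * snd h)) (at z)"
    using assms by (auto simp: holo2_at_def)
  show ?thesis
    by (rule holo2_atI[where a="a + c" and b="b + d", OF has_derivative_add[OF f g]]) (simp add: algebra_simps)
qed

lemma holo2_mult:
  assumes "holo2_at f z" "holo2_at g z"
  shows "holo2_at (\<lambda>z. f z * g z) z"
proof -
  obtain a b c d where f: "(f has_derivative (\<lambda>h. a * fst h + b * snd h)) (at z)"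
    and g: "(g has_derivative (\<lambda>h. c * fst h + d * snd h)) (at z)"
    using assms by (auto simp: holo2_at_def)
  show ?thesis
    by (rule holo2_atI[where a="f z * c + a * g z" and b="f z * d + b * g z", OF has_derivative_mult[OF f g]])
      (simp add: algebra_simps)
qed

lemma holo2_diff:
  assumes "holo2_at f z" "holo2_at g z"
  shows "holo2_at (\<lambda>z. f z - g z) z"
  using holo2_add[OF assms(1) holo2_mult[OF holo2_const[of "-1"] assms(2)]] by simp

lemma holo2_power: "holo2_at f z \<Longrightarrow> holo2_at (\<lambda>z. f z ^ j) z"
  by (induction j) (auto intro: holo2_const holo2_mult)

lemma holo2_sum: "(\<And>i. i \<in> I \<Longrightarrow> holo2_at (f i) z) \<Longrightarrow> holo2_at (\<lambda>z. \<Sum>i\<in>I. f i z) z"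
  by (induction I rule: infinite_finite_induct) (auto intro: holo2_const holo2_add)

lemma holo2_compose:
  assumes "holo2_at f z" "g field_differentiable (at (f z))"
  shows "holo2_at (\<lambda>z. g (f z)) z"
proof -
  obtain a b where f: "(f has_derivative (\<lambda>h. a * fst h + b * snd h)) (at z)"
    using assms(1) by (auto simp: holo2_at_def)
  obtain g' where g: "(g has_derivative (*) g') (at (f z))"
    using assms(2) by (auto simp: field_differentiable_def has_field_derivative_def)
  show ?thesis
    by (rule holo2_atI[where a="g' * a" and b="g' * b", OF has_derivative_compose[OF f g]])
      (auto simp: algebra_simps)
qed

lemma holo2_divide:
  assumes "holo2_at f z" "holo2_at g z" "g z \<noteq> 0"
  shows "holo2_at (\<lambda>z. f z / g z) z"
  unfolding divide_inverse
  by (intro holo2_mult assms holo2_compose[where g=inverse] field_differentiable_inverse field_differentiable_ident)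

lemma holo2_at_imp_isCont: "holo2_at f z \<Longrightarrow> isCont f z"
  unfolding holo2_at_def using has_derivative_continuous by blast

lemma holo2_line:
  assumes "(f has_derivative (\<lambda>h. a * fst h + b * snd h)) (at (z + (l * v1, l * v2)))"
  shows "((\<lambda>l. f (z + (l * v1, l * v2))) has_field_derivative (a * v1 + b * v2)) (at l)"
proof -
  have "((\<lambda>l. z + (l * v1, l * v2)) has_derivative (\<lambda>h. (h * v1, h * v2))) (at l)"
    by (rule has_derivative_eq_rhs[OF has_derivative_add[OF has_derivative_const
          has_derivative_Pair[OF has_derivative_mult_left[OF has_derivative_ident] has_derivative_mult_left[OF has_derivative_ident]]]]) simp
  from has_derivative_compose[OF this assms] show ?thesis
    unfolding has_field_derivative_def by (rule has_derivative_eq_rhs) (auto simp: algebra_simps)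
qed

lemma pair_add_zero: "z + (0, 0) = (z :: complex \<times> complex)"
  by (cases z) simp

lemma norm_pair_scale: "norm ((l * v1, l * v2) :: complex \<times> complex) = norm l * norm (v1, v2)"
  by (simp add: norm_Pair norm_mult power_mult_distrib real_sqrt_mult flip: distrib_left)

text \<open>A remainder estimate whose constant depends on \<open>f\<close> only through its
  supremum \<open>B\<close>. Applied to the kernel for each \<open>w\<close>, with \<open>B\<close>
  depending on \<open>w\<close>, it permits differentiation under the integral. The proof restricts
  \<open>f\<close> to the complex line spanned by \<open>h\<close> and uses one-variable Taylor and
  Cauchy estimates.\<close>

lemma holo2_Taylor:
  assumes \<rho>: "\<rho> > 0" and f: "\<And>z. z \<in> ball z0 \<rho> \<Longrightarrow> holo2_at f z"
    and B: "\<And>z. z \<in> ball z0 \<rho> \<Longrightarrow> norm (f z) \<le> B"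
    and d: "(f has_derivative (\<lambda>h. a * fst h + b * snd h)) (at z0)"
    and h: "norm h \<le> \<rho> / 2"
  shows "norm (f (z0 + h) - f z0 - (a * fst h + b * snd h)) \<le> 32 * B / \<rho>\<^sup>2 * (norm h)\<^sup>2"
proof (cases "h = 0")
  case False
  \<comment> \<open>The direction is normalised so that \<open>g\<close> lives on the disc of radius
    \<open>\<rho>\<close> and \<open>h\<close> corresponds to the parameter
    \<open>norm h\<close>.\<close>
  define v1 v2 where "v1 = fst h / norm h" and "v2 = snd h / norm h"
  define g where "g = (\<lambda>l. f (z0 + (l * v1, l * v2)))"
  have nv: "norm (v1, v2) = 1"
    using norm_pair_scale[of "of_real (1 / norm h)" "fst h" "snd h"] False by (simp add: v1_def v2_def norm_divide)
  have hv: "(of_real (norm h) * v1, of_real (norm h) * v2) = h"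
    using False by (simp add: v1_def v2_def)
  have in_ball: "z0 + (l * v1, l * v2) \<in> ball z0 \<rho>" if "norm l < \<rho>" for l
  proof -
    have "dist z0 (z0 + (l * v1, l * v2)) = norm (l * v1, l * v2)"
      unfolding dist_norm by (simp only: diff_add_cancel norm_minus_cancel add_diff_cancel_left' flip: norm_minus_commute[of "z0 + _"])
    thus ?thesis
      using that norm_pair_scale[of l v1 v2] nv by simp
  qed
  have hol: "g holomorphic_on ball 0 \<rho>"
  proof (rule holomorphic_onI)
    fix l assume l: "l \<in> ball (0::complex) \<rho>"
    have "holo2_at f (z0 + (l * v1, l * v2))" by (intro f in_ball) (use l in auto)
    then obtain f' where "(g has_field_derivative f') (at l)"
      unfolding holo2_at_def g_def using holo2_line by blast
    thus "g field_differentiable (at l within ball 0 \<rho>)"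
      using field_differentiable_at_within field_differentiable_def by blast
  qed
  have g0: "deriv g 0 = a * v1 + b * v2"
    unfolding g_def by (rule DERIV_imp_deriv, rule holo2_line) (use d in \<open>simp add: pair_add_zero\<close>)
  have D2: "norm ((deriv ^^ 2) g l) \<le> 32 * B / \<rho>\<^sup>2" if l: "l \<in> cball 0 (\<rho> / 2)" for l
  proof -
    have sub: "cball l (\<rho> / 4) \<subseteq> ball 0 \<rho>"
    proof
      fix x assume "x \<in> cball l (\<rho> / 4)"
      thus "x \<in> ball 0 \<rho>"
        using l \<rho> norm_triangle_ineq4[of l "l - x"] by (simp add: dist_norm)
    qed
    \<comment> \<open>Discs of radius \<open>\<rho> / 4\<close> about points with
      \<open>|l| \<le> \<rho> / 2\<close> stay inside the domain of \<open>g\<close>; this radius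
      produces the constant 32.\<close>
    have "norm ((deriv ^^ 2) g l) \<le> fact 2 * B / (\<rho> / 4) ^ 2"
    proof (rule Cauchy_inequality)
      show "g holomorphic_on ball l (\<rho> / 4)"
        using sub ball_subset_cball by (intro holomorphic_on_subset[OF hol]) blast
      show "continuous_on (cball l (\<rho> / 4)) g"
        by (intro holomorphic_on_imp_continuous_on holomorphic_on_subset[OF hol] sub)
      show "norm (g x) \<le> B" if "norm (l - x) = \<rho> / 4" for x
      proof -
        have "x \<in> cball l (\<rho> / 4)" using that by (simp add: dist_norm)
        hence "x \<in> ball 0 \<rho>" using sub by blast
        thus ?thesis unfolding g_def by (intro B in_ball) auto
      qed
    qed (use \<rho> in auto)
    also have "\<dots> = 32 * B / \<rho>\<^sup>2" by (simp add: power2_eq_square)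
    finally show ?thesis .
  qed
  have "norm ((deriv ^^ 0) g (of_real (norm h)) - (\<Sum>i\<le>1. (deriv ^^ i) g 0 * (of_real (norm h) - 0) ^ i / fact i))
      \<le> 32 * B / \<rho>\<^sup>2 * norm (complex_of_real (norm h) - 0) ^ Suc 1 / fact 1"
  proof (rule complex_Taylor[where S="cball 0 (\<rho> / 2)"])
    show "((deriv ^^ i) g has_field_derivative (deriv ^^ Suc i) g x) (at x within cball 0 (\<rho> / 2))"
      if "x \<in> cball 0 (\<rho> / 2)" for i x
    proof -
      have "x \<in> ball 0 \<rho>" using that \<rho> by auto
      thus ?thesis
        using holomorphic_derivI[OF holomorphic_higher_deriv[OF hol open_ball], of x i]
        by (auto intro: has_field_derivative_at_within)
    qed
    show "norm ((deriv ^^ Suc 1) g x) \<le> 32 * B / \<rho>\<^sup>2" if "x \<in> cball 0 (\<rho> / 2)" for x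
      using D2[OF that] by (simp add: numeral_2_eq_2)
  qed (use \<rho> h in auto)
  also have "(deriv ^^ 0) g (of_real (norm h)) = f (z0 + h)"
    by (simp add: g_def hv)
  also have "(\<Sum>i\<le>1. (deriv ^^ i) g 0 * (of_real (norm h) - 0) ^ i / fact i) = f z0 + (a * fst h + b * snd h)"
  proof -
    have "(\<Sum>i\<le>1. (deriv ^^ i) g 0 * (of_real (norm h) - 0) ^ i / fact i) = g 0 + deriv g 0 * of_real (norm h)"
      by simp
    also have "g 0 = f z0"
      by (simp add: g_def pair_add_zero)
    also have "deriv g 0 * of_real (norm h) = a * fst h + b * snd h"
      unfolding g0 using False by (simp add: v1_def v2_def distrib_right)
    finally show ?thesis .
  qed
  finally show ?thesis
    by (simp add: power2_eq_square algebra_simps)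
qed simp

lemma has_derivative_quadratic:
  fixes f :: "'a::real_normed_vector \<Rightarrow> 'b::real_normed_vector"
  assumes L: "bounded_linear L" and r: "r > 0"
    and b: "\<And>h. norm h \<le> r \<Longrightarrow> norm (f (x + h) - f x - L h) \<le> C * (norm h)\<^sup>2"
  shows "(f has_derivative L) (at x)"
  unfolding has_derivative_at_alt
proof (intro conjI L allI impI)
  fix e :: real assume e: "e > 0"
  define d where "d = min r (e / (\<bar>C\<bar> + 1))"
  have "norm (f y - f x - L (y - x)) \<le> e * norm (y - x)" if y: "norm (y - x) < d" for y
  proof -
    have "norm (f y - f x - L (y - x)) \<le> C * (norm (y - x))\<^sup>2"
      using b[of "y - x"] y by (simp add: d_def)
    also have "\<dots> \<le> (\<bar>C\<bar> + 1) * (norm (y - x))\<^sup>2"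
      by (intro mult_right_mono) auto
    also have "\<dots> = ((\<bar>C\<bar> + 1) * norm (y - x)) * norm (y - x)"
      by (simp add: power2_eq_square)
    also have "\<dots> \<le> e * norm (y - x)"
    proof (rule mult_right_mono)
      have "norm (y - x) \<le> e / (\<bar>C\<bar> + 1)" using y by (simp add: d_def)
      thus "(\<bar>C\<bar> + 1) * norm (y - x) \<le> e" by (simp add: field_simps)
    qed auto
    finally show ?thesis .
  qed
  moreover have "d > 0" using e r by (simp add: d_def)
  ultimately show "\<exists>d>0. \<forall>y. norm (y - x) < d \<longrightarrow> norm (f y - f x - L (y - x)) \<le> e * norm (y - x)"
    by blast
qed

lemma bounded_linear_pair_form: "bounded_linear (\<lambda>h::complex \<times> complex. a * fst h + b * snd h)"
  by (intro bounded_linear_add bounded_linear_const_mult bounded_linear_fst bounded_linear_snd)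

context hartogs
begin

section \<open>Boundedness of the absolute operator\<close>

lemma measurable_K [measurable (raw)]:
  assumes [measurable]: "f \<in> borel_measurable N" "g \<in> borel_measurable N"
  shows "(\<lambda>x. K (f x) (g x)) \<in> borel_measurable N"
  unfolding K_def kern_def cf_def by measurable

lemma schur_weight_powr: "schur_weight \<sigma> \<epsilon> z powr a = schur_weight (\<sigma> * a) (\<epsilon> * a) z"
  by (simp add: schur_weight_def powr_mult powr_powr)

lemma schur_weight_pos: "z \<in> \<Omega> \<Longrightarrow> schur_weight \<sigma> \<epsilon> z > 0"
  by (auto simp: schur_weight_def mem_\<Omega>_iff_XY)

lemma norm_K_commute: "norm (K z w) = norm (K w z)"
  by (metis cnj_K complex_mod_cnj)

lemma measurable_schur_weight [measurable]: "schur_weight \<sigma> \<epsilon> \<in> borel_measurable borel"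
  unfolding schur_weight_def[abs_def] by measurable

text \<open>Schur's test with \<open>schur_weight \<tau> \<epsilon>\<close>; its powers
  \<open>q\<close> and \<open>p\<close> must both fall into the window of
  \<open>kernel_weight_integral\<close>, and \<open>k * p < 2 * (m + n)\<close> is what leaves room
  for the power \<open>p\<close>.\<close>

lemma kernel_Lp_bound:
  assumes p: "p \<ge> 2" and kp: "real k * p < 2 * real (m + n)"
  shows "\<exists>C>0. \<forall>f\<in>borel_measurable \<mu>. \<forall>u. (\<forall>z\<in>\<Omega>. 0 \<le> u z \<and> ennreal (u z) \<le> (\<integral>\<^sup>+w. ennreal (norm (K z w) * norm (f w :: complex)) \<partial>\<mu>))
     \<longrightarrow> (\<integral>\<^sup>+z. ennreal (u z powr p) \<partial>\<mu>) \<le> ennreal C * (\<integral>\<^sup>+w. ennreal (norm (f w) powr p) \<partial>\<mu>)"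
proof -
  define q where "q = p / (p - 1)"
  \<comment> \<open>Chosen so that \<open>\<tau> * q\<close> is the lower end \<open>k / m\<close>
    of the window. Then \<open>\<tau> * p = k * (p - 1) / m\<close>, which lies above the lower end
    by \<open>p \<ge> 2\<close> and below the upper end by \<open>kp\<close>. Likewise
    \<open>\<epsilon>\<close> gives \<open>\<epsilon> * p = 1/2\<close> and
    \<open>\<epsilon> * q \<le> 1/2\<close>.\<close>
  define \<tau> where "\<tau> = real k / (real m * q)"
  define \<epsilon> where "\<epsilon> = 1 / (2 * p)"
  have pq: "p > 1" "q > 1" "1 / p + 1 / q = 1"
    using p by (auto simp: q_def field_simps)
  have \<tau>q: "\<tau> * q = real k / real m" and \<tau>p: "\<tau> * p = real k * (p - 1) / real m"
    using p pq(2) by (auto simp: \<tau>_def q_def)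
  have \<epsilon>q: "0 < \<epsilon> * q" "\<epsilon> * q < 1" and \<epsilon>p: "0 < \<epsilon> * p" "\<epsilon> * p < 1"
    using p by (auto simp: \<epsilon>_def q_def field_simps)
  have kk: "real k < real (m + n)" using k by linarith
  have "real k / real m \<le> \<tau> * q" "\<tau> * q < (2 * real (m + n) - real k) / real m"
    unfolding \<tau>q using m kk by (auto intro!: divide_strict_right_mono)
  from kernel_weight_integral[OF \<epsilon>q this] obtain Cq where Cq: "Cq > 0"
    "\<And>z. z \<in> \<Omega> \<Longrightarrow> (\<integral>\<^sup>+w. ennreal (norm (K z w) * schur_weight (\<tau> * q) (\<epsilon> * q) w) \<partial>\<mu>) \<le> ennreal (Cq * schur_weight (\<tau> * q) (\<epsilon> * q) z)"
    by blast
  have "real k / real m \<le> \<tau> * p" "\<tau> * p < (2 * real (m + n) - real k) / real m"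
    unfolding \<tau>p using m kp p mult_left_mono[of 1 "p - 1" "real k"]
    by (auto intro!: divide_strict_right_mono divide_right_mono simp: algebra_simps)
  from kernel_weight_integral[OF \<epsilon>p this] obtain Cp where Cp: "Cp > 0"
    "\<And>z. z \<in> \<Omega> \<Longrightarrow> (\<integral>\<^sup>+w. ennreal (norm (K z w) * schur_weight (\<tau> * p) (\<epsilon> * p) w) \<partial>\<mu>) \<le> ennreal (Cp * schur_weight (\<tau> * p) (\<epsilon> * p) z)"
    by blast
  define C where "C = max Cq Cp"
  have C: "C > 0" using Cq by (simp add: C_def)
  have "(\<integral>\<^sup>+z. ennreal (u z powr p) \<partial>\<mu>) \<le> ennreal (C powr p) * (\<integral>\<^sup>+w. ennreal (norm (f w) powr p) \<partial>\<mu>)"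
    if f [measurable]: "f \<in> borel_measurable \<mu>"
      and u: "\<forall>z\<in>\<Omega>. 0 \<le> u z \<and> ennreal (u z) \<le> (\<integral>\<^sup>+w. ennreal (norm (K z w) * norm (f w :: complex)) \<partial>\<mu>)" for f u
  proof (rule Schur_test[OF sigma_finite_\<mu> pq, where k="\<lambda>x. norm (K (fst x) (snd x))" and h="schur_weight \<tau> \<epsilon>"])
    show "(\<integral>\<^sup>+w. ennreal (norm (K (fst (z, w)) (snd (z, w))) * schur_weight \<tau> \<epsilon> w powr q) \<partial>\<mu>) \<le> ennreal (C * schur_weight \<tau> \<epsilon> z powr q)"
      if "z \<in> space \<mu>" for z
      using that schur_weight_pos[of z] unfolding schur_weight_powr
      by (simp, intro order_trans[OF Cq(2)] ennreal_leI mult_right_mono) (auto simp: C_def less_imp_le)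
    show "(\<integral>\<^sup>+z. ennreal (norm (K (fst (z, w)) (snd (z, w))) * schur_weight \<tau> \<epsilon> z powr p) \<partial>\<mu>) \<le> ennreal (C * schur_weight \<tau> \<epsilon> w powr p)"
      if "w \<in> space \<mu>" for w
      using that schur_weight_pos[of w] unfolding schur_weight_powr
      by (simp add: norm_K_commute[of _ w], intro order_trans[OF Cp(2)] ennreal_leI mult_right_mono) (auto simp: C_def less_imp_le)
  qed (use C u in \<open>auto simp: schur_weight_pos\<close>)
  thus ?thesis using C by (intro exI[of _ "C powr p"]) auto
qed

text \<open>The integral in \<open>y\<close> is left unevaluated because its convergent case gives
  the norms of the kept monomials and its divergent case excludes the others.\<close>

lemma nn_integral_moment:
  assumes "A > -1"
  shows "(\<integral>\<^sup>+w. ennreal (X w powr A * Y w powr \<beta>) \<partial>\<mu>) =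
    ennreal (pi\<^sup>2 / (A + 1)) * (\<integral>\<^sup>+y. ennreal (y powr (real n / real m + \<beta>)) * indicator {0..1} y \<partial>lborel)"
proof -
  have "(\<integral>\<^sup>+w. ennreal (X w powr A * Y w powr \<beta>) \<partial>\<mu>) =
    ennreal (pi\<^sup>2) * (\<integral>\<^sup>+y. \<integral>\<^sup>+x. ennreal (y powr (real n / real m)) * ennreal (x powr A * y powr \<beta>) * indicator {0..<1} x * indicator {0<..<1} y \<partial>lborel \<partial>lborel)"
    using nn_integral_\<mu>_radial[of "\<lambda>(x, y). ennreal (x powr A * y powr \<beta>)"] by (simp add: borel_prod[symmetric])
  also have "(\<integral>\<^sup>+y. \<integral>\<^sup>+x. ennreal (y powr (real n / real m)) * ennreal (x powr A * y powr \<beta>) * indicator {0..<1} x * indicator {0<..<1} y \<partial>lborel \<partial>lborel)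
    = (\<integral>\<^sup>+y. \<integral>\<^sup>+x. (ennreal (y powr (real n / real m + \<beta>)) * indicator {0..1} y) * (ennreal (x powr A) * indicator {0..1} x) \<partial>lborel \<partial>lborel)"
  proof (rule nn_integral_cong_AE)
    show "AE y in lborel. (\<integral>\<^sup>+x. ennreal (y powr (real n / real m)) * ennreal (x powr A * y powr \<beta>) * indicator {0..<1} x * indicator {0<..<1} y \<partial>lborel)
       = (\<integral>\<^sup>+x. (ennreal (y powr (real n / real m + \<beta>)) * indicator {0..1} y) * (ennreal (x powr A) * indicator {0..1} x) \<partial>lborel)"
      using AE_lborel_singleton[of 0] AE_lborel_singleton[of 1]
    proof eventually_elim
      case y: (elim y)
      show ?case
      proof (rule nn_integral_cong_AE)
        show "AE x in lborel. ennreal (y powr (real n / real m)) * ennreal (x powr A * y powr \<beta>) * indicator {0..<1} x * indicator {0<..<1} y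
          = (ennreal (y powr (real n / real m + \<beta>)) * indicator {0..1} y) * (ennreal (x powr A) * indicator {0..1} x)"
          using AE_lborel_singleton[of 1]
        proof eventually_elim
          case (elim x)
          have "ennreal (y powr (real n / real m)) * ennreal (x powr A * y powr \<beta>) = ennreal (y powr (real n / real m + \<beta>)) * ennreal (x powr A)"
            by (simp add: ennreal_mult'[symmetric] powr_add mult_ac)
          thus ?case using elim y by (auto simp: indicator_def)
        qed
      qed
    qed
  qed
  also have "\<dots> = (\<integral>\<^sup>+y. ennreal (y powr (real n / real m + \<beta>)) * indicator {0..1} y \<partial>lborel) * ennreal (1 / (A + 1))"
    using assms nn_integral_powr_interval[OF assms, of 1] by (simp add: nn_integral_cmult nn_integral_multc)
  also have "ennreal (pi\<^sup>2) * (I * ennreal (1 / (A + 1))) = ennreal (pi\<^sup>2 / (A + 1)) * I" for I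
  proof -
    have "ennreal (pi\<^sup>2 / (A + 1)) = ennreal (pi\<^sup>2) * ennreal (1 / (A + 1))"
      using assms by (subst ennreal_mult'[symmetric]) auto
    thus ?thesis by (simp add: mult_ac)
  qed
  finally show ?thesis .
qed

lemma nn_integral_moment_finite:
  assumes "A > -1" "real n / real m + \<beta> > -1"
  shows "(\<integral>\<^sup>+w. ennreal (X w powr A * Y w powr \<beta>) \<partial>\<mu>) = ennreal (pi\<^sup>2 / ((A + 1) * (real n / real m + \<beta> + 1)))"
  unfolding nn_integral_moment[OF assms(1)] nn_integral_powr_interval[OF assms(2) zero_le_one]
  using assms by (subst ennreal_mult'[symmetric]) auto

lemma nn_integral_moment_infinite:
  assumes "A > -1" "real n / real m + \<beta> \<le> -1"
  shows "(\<integral>\<^sup>+w. ennreal (X w powr A * Y w powr \<beta>) \<partial>\<mu>) = \<infinity>"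
  unfolding nn_integral_moment[OF assms(1)] nn_integral_powr_infinite[OF assms(2)] using assms(1)
  by (simp add: ennreal_mult_top)

section \<open>Local bounds for the kernel and holomorphy of the image\<close>

definition \<kappa> :: real where
  "\<kappa> = real k / (2 * real m)"

text \<open>This is \<open>k < m + n\<close> rewritten: it makes
  \<open>Y powr (-(2 * \<kappa>))\<close> integrable, so the growth of the kernel in
  \<open>w\<close> is square integrable.\<close>

lemma kappa_moment: "real n / real m - 2 * \<kappa> > -1"
proof -
  have "real k < real m + real n" using k by linarith
  thus ?thesis using m by (simp add: \<kappa>_def field_simps)
qed

lemma continuous_on_X: "continuous_on \<Omega> X" and continuous_on_Y: "continuous_on \<Omega> Y"
  unfolding X_def[abs_def] Y_def[abs_def] using snd_nonzero
  by (auto intro!: continuous_on_divide continuous_on_power continuous_on_norm continuous_on_fst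
      continuous_on_snd continuous_on_id continuous_on_powr continuous_on_const)

text \<open>On a compact set \<open>X z\<close> and \<open>Y z\<close> stay away from 1, hence so do
  \<open>|u|\<close> and \<open>|t|\<close>, uniformly in \<open>w\<close>; moreover
  \<open>Y z\<close> stays away from 0. Only the singularity at \<open>Y w = 0\<close> is
  left.\<close>

lemma K_locally_bounded:
  assumes S: "compact S" "S \<subseteq> \<Omega>"
  shows "\<exists>B>0. \<forall>z\<in>S. \<forall>w\<in>\<Omega>. norm (K z w) \<le> B * Y w powr (-\<kappa>)"
proof (cases "S = {}")
  case False
  obtain x where x: "x \<in> S" "\<And>z. z \<in> S \<Longrightarrow> X z \<le> X x"
    using continuous_attains_sup[OF S(1) False continuous_on_subset[OF continuous_on_X S(2)]] by blast
  obtain y where y: "y \<in> S" "\<And>z. z \<in> S \<Longrightarrow> Y z \<le> Y y"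
    using continuous_attains_sup[OF S(1) False continuous_on_subset[OF continuous_on_Y S(2)]] by blast
  obtain y' where y': "y' \<in> S" "\<And>z. z \<in> S \<Longrightarrow> Y y' \<le> Y z"
    using continuous_attains_inf[OF S(1) False continuous_on_subset[OF continuous_on_Y S(2)]] by blast
  have xy: "X x < 1" "Y y < 1" "0 < Y y'"
    using x(1) y(1) y'(1) S(2) by (auto simp: mem_\<Omega>_iff_XY)
  define a b where "a = 1 - sqrt (X x)" and "b = 1 - sqrt (Y y)"
  have ab: "a > 0" "b > 0" using xy by (auto simp: a_def b_def)
  define B where "B = kernel_const * Y y' powr (-\<kappa>) / (a\<^sup>2 * b\<^sup>2)"
  have \<kappa>0: "\<kappa> \<ge> 0" by (simp add: \<kappa>_def)
  have "norm (K z w) \<le> (B + 1) * Y w powr (-\<kappa>)" if z: "z \<in> S" and w: "w \<in> \<Omega>" for z w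
  proof -
    have z': "z \<in> \<Omega>" using z S by auto
    define u where "u = (fst z * cnj (fst w)) ^ m / (snd z * cnj (snd w)) ^ n"
    define t where "t = snd z * cnj (snd w)"
    note ka = \<Omega>_kernel_args[OF z' w, folded u_def, folded t_def]
    have Xw: "0 \<le> X w" "X w < 1" "0 < Y w" "Y w < 1" using w by (auto simp: mem_\<Omega>_iff_XY)
    have Xz: "0 \<le> X z" "X z < 1" "0 < Y z" "Y z < 1" using z' by (auto simp: mem_\<Omega>_iff_XY)
    have "X z ^ m * X w ^ m \<le> X z ^ 1 * 1"
      using Xz Xw m by (intro mult_mono power_decreasing power_le_one) auto
    hence "(norm u)\<^sup>2 \<le> X x" using ka(4) x(2)[OF z] by simp
    hence "norm u \<le> sqrt (X x)" by (simp add: real_le_rsqrt)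
    hence u: "a \<le> norm (1 - u)"
      using norm_triangle_ineq2[of 1 u] by (simp add: a_def)
    have "Y z * Y w \<le> Y z * 1" using Xz Xw by (intro mult_left_mono) auto
    hence "(norm t)\<^sup>2 \<le> Y y" using ka(5) y(2)[OF z] by simp
    hence "norm t \<le> sqrt (Y y)" by (simp add: real_le_rsqrt)
    hence t: "b \<le> norm (1 - t)"
      using norm_triangle_ineq2[of 1 t] by (simp add: b_def)
    have "norm (K z w) \<le> kernel_const * (Y z * Y w) powr (-\<kappa>) / ((norm (1 - u))\<^sup>2 * (norm (1 - t))\<^sup>2)"
      using norm_K_le[OF z' w] by (simp add: \<kappa>_def u_def t_def)
    also have "\<dots> \<le> kernel_const * (Y y' powr (-\<kappa>) * Y w powr (-\<kappa>)) / (a\<^sup>2 * b\<^sup>2)"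
    proof (rule frac_le)
      have "Y z powr (-\<kappa>) \<le> Y y' powr (-\<kappa>)"
        using y'(2)[OF z] xy \<kappa>0 by (intro powr_mono2') auto
      thus "kernel_const * (Y z * Y w) powr (-\<kappa>) \<le> kernel_const * (Y y' powr (-\<kappa>) * Y w powr (-\<kappa>))"
        using kernel_const_nonneg by (simp add: powr_mult mult_left_mono mult_right_mono)
      show "a\<^sup>2 * b\<^sup>2 \<le> (norm (1 - u))\<^sup>2 * (norm (1 - t))\<^sup>2"
        using ab u t by (intro mult_mono power_mono) auto
    qed (use ab kernel_const_nonneg in auto)
    also have "\<dots> = B * Y w powr (-\<kappa>)" by (simp add: B_def)
    also have "\<dots> \<le> (B + 1) * Y w powr (-\<kappa>)" by (intro mult_right_mono) auto
    finally show ?thesis .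
  qed
  moreover have "B + 1 > 0" using kernel_const_nonneg by (auto simp: B_def intro!: add_nonneg_pos)
  ultimately show ?thesis by blast
qed (auto intro: exI[of _ 1])

lemma cf_field_differentiable: "x \<noteq> 1 \<Longrightarrow> cf c field_differentiable (at x)"
  unfolding cf_def[abs_def]
  by (intro field_differentiable_add field_differentiable_divide field_differentiable_power
      field_differentiable_mult field_differentiable_diff field_differentiable_const field_differentiable_ident) auto

lemma K_holo2:
  assumes z: "z \<in> \<Omega>" and w: "w \<in> \<Omega>"
  shows "holo2_at (\<lambda>z. K z w) z"
proof -
  note ka = \<Omega>_kernel_args[OF z w]
  let ?s = "\<lambda>z::complex\<times>complex. fst z * cnj (fst w)" and ?t = "\<lambda>z::complex\<times>complex. snd z * cnj (snd w)"
  have s: "holo2_at ?s z" and t: "holo2_at ?t z"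
    by (intro holo2_mult holo2_fst holo2_snd holo2_const)+
  have u: "holo2_at (\<lambda>z. ?s z ^ m / ?t z ^ n) z"
    using ka(1) by (intro holo2_divide holo2_power s t) auto
  have "norm (?s z ^ m / ?t z ^ n) < 1"
    using ka(1,3) by (simp add: norm_divide norm_power)
  hence u1: "?s z ^ m / ?t z ^ n \<noteq> 1" by (metis norm_one less_irrefl)
  have t1: "?t z \<noteq> 1" using ka(2) by (metis norm_one less_irrefl)
  show ?thesis
    unfolding K_def kern_def
    by (rule holo2_mult[OF holo2_const], intro holo2_sum holo2_mult holo2_divide holo2_power s t
        holo2_compose[OF u] holo2_compose[OF t] cf_field_differentiable u1 t1)
      (use ka(1) in auto)
qed

text \<open>Borel functions only: \<open>\<mu>\<close> is not completed, so that Fubini is available for \<open>\<mu> \<Otimes>\<^sub>M \<mu>\<close>.\<close>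

definition L2 :: "(complex \<times> complex \<Rightarrow> complex) \<Rightarrow> bool" where
  "L2 f \<longleftrightarrow> f \<in> borel_measurable \<mu> \<and> integrable \<mu> (\<lambda>w. (norm (f w))\<^sup>2)"

definition T :: "(complex \<times> complex \<Rightarrow> complex) \<Rightarrow> complex \<times> complex \<Rightarrow> complex" where
  "T f z = (\<integral>w. K z w * f w \<partial>\<mu>)"

text \<open>Off this null set monomials with negative powers of the first coordinate are
  holomorphic, and formulas with \<open>powr\<close> in \<open>X\<close> hold without the exception
  \<open>0 powr 0 = 0\<close>.\<close>

lemma AE_fst_nonzero: "AE w in \<mu>. fst w \<noteq> 0"
proof -
  have "emeasure (lborel \<Otimes>\<^sub>M lborel) ({0::complex} \<times> (UNIV::complex set)) = 0"
    by (subst lborel.emeasure_pair_measure_Times) auto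
  moreover have "{0::complex} \<times> (UNIV::complex set) \<in> sets borel"
    by (intro borel_closed closed_Times) auto
  ultimately have "{0} \<times> UNIV \<in> null_sets (lborel :: (complex \<times> complex) measure)"
    by (simp add: lborel_prod null_sets_def)
  from AE_not_in[OF this] have "AE w in lborel. fst (w :: complex \<times> complex) \<noteq> 0"
    by eventually_elim auto
  thus ?thesis
    by (subst AE_restrict_space_iff) auto
qed

lemma AE_X_pos: "AE w in \<mu>. X w > 0"
  using AE_fst_nonzero AE_space by eventually_elim (auto simp: X_def dest: snd_nonzero)

lemma integrable_weight: "integrable \<mu> (\<lambda>w. Y w powr (-(2 * \<kappa>)))"
proof -
  have "(\<integral>\<^sup>+w. ennreal (Y w powr (-(2 * \<kappa>))) \<partial>\<mu>) = (\<integral>\<^sup>+w. ennreal (X w powr 0 * Y w powr (-(2 * \<kappa>))) \<partial>\<mu>)"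
    by (rule nn_integral_cong_AE) (use AE_X_pos in eventually_elim, simp)
  also have "\<dots> < \<infinity>" using kappa_moment by (subst nn_integral_moment_finite) auto
  finally show ?thesis by (intro integrableI_nonneg) auto
qed

text \<open>A product of two square integrable functions. Together with
  \<open>K_locally_bounded\<close> it makes the integral defining \<open>T\<close> converge at every
  point of the domain, not merely almost everywhere.\<close>

lemma L2_weight:
  assumes "L2 f"
  shows "integrable \<mu> (\<lambda>w. Y w powr (-\<kappa>) * norm (f w))"
proof (rule Bochner_Integration.integrable_bound)
  have [measurable]: "f \<in> borel_measurable \<mu>" using assms by (simp add: L2_def)
  show "integrable \<mu> (\<lambda>w. Y w powr (-(2 * \<kappa>)) + (norm (f w))\<^sup>2)"
    using assms integrable_weight by (auto simp: L2_def)
  show "(\<lambda>w. Y w powr (-\<kappa>) * norm (f w)) \<in> borel_measurable \<mu>" by measurable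
  have "Y w powr (-\<kappa>) * norm (f w) \<le> Y w powr (-(2 * \<kappa>)) + (norm (f w))\<^sup>2" for w
  proof -
    have "Y w powr (-(2 * \<kappa>)) = (Y w powr (-\<kappa>))\<^sup>2"
      by (simp add: power2_eq_square flip: powr_add)
    moreover have "2 * (Y w powr (-\<kappa>)) * norm (f w) \<le> (Y w powr (-\<kappa>))\<^sup>2 + (norm (f w))\<^sup>2"
      by (rule sum_squares_bound)
    moreover have "0 \<le> Y w powr (-\<kappa>) * norm (f w)" by simp
    ultimately show ?thesis by linarith
  qed
  thus "AE w in \<mu>. norm (Y w powr (-\<kappa>) * norm (f w)) \<le> norm (Y w powr (-(2 * \<kappa>)) + (norm (f w))\<^sup>2)"
    by (intro AE_I2) (simp add: abs_mult)
qed

lemma K_integrable: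
  assumes z: "z \<in> \<Omega>" and f: "L2 f"
  shows "integrable \<mu> (\<lambda>w. K z w * f w)"
proof -
  have [measurable]: "f \<in> borel_measurable \<mu>" using f by (simp add: L2_def)
  obtain B where B: "B > 0" "\<And>w. w \<in> \<Omega> \<Longrightarrow> norm (K z w) \<le> B * Y w powr (-\<kappa>)"
    using K_locally_bounded[of "{z}"] z by auto
  show ?thesis
  proof (rule Bochner_Integration.integrable_bound)
    show "integrable \<mu> (\<lambda>w. B * (Y w powr (-\<kappa>) * norm (f w)))"
      by (intro integrable_mult_right L2_weight f)
    show "AE w in \<mu>. norm (K z w * f w) \<le> norm (B * (Y w powr (-\<kappa>) * norm (f w)))"
      using B by (intro AE_I2) (auto simp: norm_mult abs_mult mult.assoc[symmetric] intro!: mult_right_mono)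
  qed measurable
qed

text \<open>Differentiation under the integral sign. On a small ball the kernel is dominated by
  \<open>B w\<close>, and \<open>holo2_Taylor\<close> turns this into a quadratic remainder that is
  integrable against \<open>f\<close>.\<close>

lemma T_holo2:
  assumes z: "z \<in> \<Omega>" and f: "L2 f"
  shows "holo2_at (T f) z"
proof -
  have [measurable]: "f \<in> borel_measurable \<mu>" using f by (simp add: L2_def)
  obtain \<rho> where \<rho>: "\<rho> > 0" "cball z \<rho> \<subseteq> \<Omega>"
    using open_\<Omega> z open_contains_cball by blast
  obtain B0 where B0: "B0 > 0" "\<And>z' w. z' \<in> cball z \<rho> \<Longrightarrow> w \<in> \<Omega> \<Longrightarrow> norm (K z' w) \<le> B0 * Y w powr (-\<kappa>)"
    using K_locally_bounded[OF compact_cball \<rho>(2)] by blast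
  define B where "B = (\<lambda>w. B0 * Y w powr (-\<kappa>))"
  have [measurable]: "B \<in> borel_measurable borel" unfolding B_def by measurable
  have Bf: "integrable \<mu> (\<lambda>w. B w * norm (f w))"
    unfolding B_def mult.assoc by (intro integrable_mult_right L2_weight f)
  have "\<forall>w. \<exists>a b. w \<in> \<Omega> \<longrightarrow> ((\<lambda>z. K z w) has_derivative (\<lambda>h. a * fst h + b * snd h)) (at z)"
    using K_holo2[OF z] by (auto simp: holo2_at_def)
  \<comment> \<open>The derivative coefficients are merely chosen pointwise in \<open>w\<close>;
    bounds and measurability are established next so that they can be integrated.\<close>
  then obtain a b where ab: "\<And>w. w \<in> \<Omega> \<Longrightarrow> ((\<lambda>z. K z w) has_derivative (\<lambda>h. a w * fst h + b w * snd h)) (at z)"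
    by metis
  have in\<Omega>: "z' \<in> \<Omega>" if "z' \<in> ball z \<rho>" for z' using that \<rho> by auto
  have Tay: "norm (K (z + h) w - K z w - (a w * fst h + b w * snd h)) \<le> 32 * B w / \<rho>\<^sup>2 * (norm h)\<^sup>2"
    if w: "w \<in> \<Omega>" and h: "norm h \<le> \<rho> / 2" for w h
    using \<rho>(1) K_holo2[OF in\<Omega> w] B0(2)[OF _ w] h
    by (intro holo2_Taylor[OF _ _ _ ab[OF w]]) (auto simp: B_def)
  \<comment> \<open>The Taylor estimate read backwards at \<open>|h| = \<rho> / 2\<close>: the
    remainder is at most \<open>8 * B w\<close>, and the two kernel values add
    \<open>2 * B w\<close>.\<close>
  have coeff_bound: "norm (a w * fst h + b w * snd h) \<le> 10 * B w" if w: "w \<in> \<Omega>" and h: "norm h = \<rho> / 2" for w h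
  proof -
    have "norm (K (z + h) w) \<le> B w" "norm (K z w) \<le> B w"
      using B0(2)[of "z + h" w] B0(2)[of z w] w h \<rho> by (auto simp: B_def dist_norm)
    moreover have "32 * B w / \<rho>\<^sup>2 * (norm h)\<^sup>2 = 8 * B w"
      unfolding h using \<rho> by (simp add: power_divide)
    ultimately show ?thesis
      using Tay[OF w, of h] h \<rho>
        norm_triangle_ineq4[of "K (z + h) w - K z w" "K (z + h) w - K z w - (a w * fst h + b w * snd h)"]
        norm_triangle_ineq4[of "K (z + h) w" "K z w"] by simp
  qed
  have a_bound: "norm (a w) \<le> 20 / \<rho> * B w" if w: "w \<in> \<Omega>" for w
  proof -
    have "norm (a w * of_real (\<rho> / 2)) \<le> 10 * B w"
      using coeff_bound[OF w, of "(of_real (\<rho> / 2), 0)"] \<rho> by (simp add: norm_Pair)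
    thus ?thesis using \<rho> by (simp add: norm_mult field_simps)
  qed
  have b_bound: "norm (b w) \<le> 20 / \<rho> * B w" if w: "w \<in> \<Omega>" for w
  proof -
    have "norm (b w * of_real (\<rho> / 2)) \<le> 10 * B w"
      using coeff_bound[OF w, of "(0, of_real (\<rho> / 2))"] \<rho> by (simp add: norm_Pair)
    thus ?thesis using \<rho> by (simp add: norm_mult field_simps)
  qed
  \<comment> \<open>Difference quotients along \<open>1 / (j + 1)\<close> exhibit the coefficients
    as limits of measurable functions.\<close>
  have lim: "(\<lambda>j. of_nat (Suc j) * (K (z + (v1 / of_nat (Suc j), v2 / of_nat (Suc j))) w - K z w)) \<longlonglongrightarrow> a w * v1 + b w * v2"
    if w: "w \<in> \<Omega>" for w and v1 v2
  proof -
    have "((\<lambda>l. K (z + (l * v1, l * v2)) w) has_field_derivative (a w * v1 + b w * v2)) (at 0)"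
      by (rule holo2_line[where f="\<lambda>z. K z w"]) (use ab[OF w] in \<open>simp add: pair_add_zero\<close>)
    hence "((\<lambda>l. (K (z + (l * v1, l * v2)) w - K z w) / l) \<longlongrightarrow> a w * v1 + b w * v2) (at 0)"
      by (simp add: has_field_derivative_iff pair_add_zero)
    moreover have "filterlim (\<lambda>j. 1 / of_nat (Suc j) :: complex) (at 0) sequentially"
      unfolding filterlim_at using lim_1_over_n[where 'a=complex, THEN LIMSEQ_Suc] by (auto simp del: of_nat_Suc)
    ultimately have "(\<lambda>j. (K (z + (1 / of_nat (Suc j) * v1, 1 / of_nat (Suc j) * v2)) w - K z w) / (1 / of_nat (Suc j))) \<longlonglongrightarrow> a w * v1 + b w * v2"
      by (rule filterlim_compose)
    thus ?thesis by (simp add: mult.commute del: of_nat_Suc)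
  qed
  have [measurable]: "a \<in> borel_measurable \<mu>"
    by (rule borel_measurable_LIMSEQ_metric[of "\<lambda>j w. of_nat (Suc j) * (K (z + (1 / of_nat (Suc j), 0 / of_nat (Suc j))) w - K z w)"])
      (use lim[of _ 1 0] in auto)
  have [measurable]: "b \<in> borel_measurable \<mu>"
    by (rule borel_measurable_LIMSEQ_metric[of "\<lambda>j w. of_nat (Suc j) * (K (z + (0 / of_nat (Suc j), 1 / of_nat (Suc j))) w - K z w)"])
      (use lim[of _ 0 1] in auto)
  have int: "integrable \<mu> (\<lambda>w. c w * f w)" if [measurable]: "c \<in> borel_measurable \<mu>" and c: "\<And>w. w \<in> \<Omega> \<Longrightarrow> norm (c w) \<le> 20 / \<rho> * B w" for c
  proof (rule Bochner_Integration.integrable_bound)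
    show "integrable \<mu> (\<lambda>w. 20 / \<rho> * (B w * norm (f w)))"
      by (intro integrable_mult_right Bf)
    show "AE w in \<mu>. norm (c w * f w) \<le> norm (20 / \<rho> * (B w * norm (f w)))"
    proof (rule AE_I2)
      fix w assume "w \<in> space \<mu>"
      hence "norm (c w) * norm (f w) \<le> 20 / \<rho> * B w * norm (f w)"
        by (intro mult_right_mono c) auto
      also have "\<dots> \<le> norm (20 / \<rho> * (B w * norm (f w)))" by (metis abs_ge_self mult.assoc real_norm_def)
      finally show "norm (c w * f w) \<le> norm (20 / \<rho> * (B w * norm (f w)))" by (simp add: norm_mult)
    qed
  qed measurable
  note ia = int[OF _ a_bound, simplified] and ib = int[OF _ b_bound, simplified]
  define A where "A = (\<integral>w. a w * f w \<partial>\<mu>)"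
  define A' where "A' = (\<integral>w. b w * f w \<partial>\<mu>)"
  have "(T f has_derivative (\<lambda>h. A * fst h + A' * snd h)) (at z)"
  proof (rule has_derivative_quadratic[OF bounded_linear_pair_form])
    show "\<rho> / 2 > 0" using \<rho> by simp
    fix h :: "complex \<times> complex" assume h: "norm h \<le> \<rho> / 2"
    have zh: "z + h \<in> \<Omega>" using h \<rho> by (intro in\<Omega>) (auto simp: dist_norm)
    have iA: "integrable \<mu> (\<lambda>w. a w * f w * fst h)" "integrable \<mu> (\<lambda>w. b w * f w * snd h)"
      by (intro integrable_mult_left ia ib; measurable)+
    have eq: "T f (z + h) - T f z - (A * fst h + A' * snd h)
       = (\<integral>w. K (z + h) w * f w - K z w * f w - (a w * f w * fst h + b w * f w * snd h) \<partial>\<mu>)"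
      unfolding T_def A_def A'_def using K_integrable[OF zh f] K_integrable[OF z f] iA by simp
    have int': "integrable \<mu> (\<lambda>w. K (z + h) w * f w - K z w * f w - (a w * f w * fst h + b w * f w * snd h))"
      using K_integrable[OF zh f] K_integrable[OF z f] iA by auto
    have "norm (T f (z + h) - T f z - (A * fst h + A' * snd h))
      \<le> (\<integral>w. norm (K (z + h) w * f w - K z w * f w - (a w * f w * fst h + b w * f w * snd h)) \<partial>\<mu>)"
      unfolding eq by (rule integral_norm_bound)
    also have "\<dots> \<le> (\<integral>w. 32 / \<rho>\<^sup>2 * (norm h)\<^sup>2 * (B w * norm (f w)) \<partial>\<mu>)"
    proof (rule integral_mono[OF integrable_norm[OF int']])
      show "integrable \<mu> (\<lambda>w. 32 / \<rho>\<^sup>2 * (norm h)\<^sup>2 * (B w * norm (f w)))"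
        by (intro integrable_mult_right Bf)
      fix w assume "w \<in> space \<mu>" hence w: "w \<in> \<Omega>" by simp
      have "K (z + h) w * f w - K z w * f w - (a w * f w * fst h + b w * f w * snd h)
         = (K (z + h) w - K z w - (a w * fst h + b w * snd h)) * f w"
        by (simp add: algebra_simps)
      hence "norm (K (z + h) w * f w - K z w * f w - (a w * f w * fst h + b w * f w * snd h))
         = norm (K (z + h) w - K z w - (a w * fst h + b w * snd h)) * norm (f w)"
        by (simp only: norm_mult)
      also have "\<dots> \<le> (32 * B w / \<rho>\<^sup>2 * (norm h)\<^sup>2) * norm (f w)"
        by (intro mult_right_mono Tay w h) auto
      finally show "norm (K (z + h) w * f w - K z w * f w - (a w * f w * fst h + b w * f w * snd h))
         \<le> 32 / \<rho>\<^sup>2 * (norm h)\<^sup>2 * (B w * norm (f w))"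
        by (simp add: mult_ac)
    qed
    also have "\<dots> = (32 / \<rho>\<^sup>2 * (\<integral>w. B w * norm (f w) \<partial>\<mu>)) * (norm h)\<^sup>2"
      by simp
    finally show "norm (T f (z + h) - T f z - (A * fst h + A' * snd h))
      \<le> (32 / \<rho>\<^sup>2 * (\<integral>w. B w * norm (f w) \<partial>\<mu>)) * (norm h)\<^sup>2" .
  qed
  thus ?thesis by (auto simp: holo2_at_def)
qed

end

section \<open>Fourier coefficients on the torus\<close>

abbreviation torus :: "(complex \<times> complex) set" where
  "torus \<equiv> sphere 0 1 \<times> sphere 0 1"

abbreviation unit_square :: "(real \<times> real) set" where
  "unit_square \<equiv> cbox (0, 0) (1, 1)"

abbreviation \<Q> :: "(real \<times> real) measure" where
  "\<Q> \<equiv> restrict_space lborel unit_square"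

definition tor :: "real \<times> real \<Rightarrow> complex \<times> complex" where
  "tor t = (unit_circle (fst t), unit_circle (snd t))"

lemma fst_tor [simp]: "fst (tor t) = unit_circle (fst t)" and snd_tor [simp]: "snd (tor t) = unit_circle (snd t)"
  by (simp_all add: tor_def)

lemma tor_in_torus [simp]: "tor t \<in> torus"
  by (simp add: tor_def)

lemma continuous_on_tor: "continuous_on S tor"
  unfolding tor_def[abs_def] by (intro continuous_intros continuous_on_fst continuous_on_snd)

lemma measurable_tor [measurable]: "tor \<in> borel_measurable borel"
  by (intro borel_measurable_continuous_onI continuous_on_tor)

lemma emeasure_Q [simp]: "emeasure \<Q> unit_square = 1"
  by (simp add: emeasure_restrict_space emeasure_lborel_cbox_eq Basis_prod_def)

lemma sigma_finite_Q: "sigma_finite_measure \<Q>"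
  by (intro sigma_finite_measure_restrict_space) (auto intro: lborel.sigma_finite_measure_axioms)

lemma unit_circle_exhausts:
  assumes "norm c = 1"
  obtains x where "x \<in> {0..1}" "c = unit_circle x"
proof -
  have "c \<in> path_image (circlepath 0 1)"
    using assms by simp
  then obtain x where "x \<in> {0..1}" "c = circlepath 0 1 x"
    by (auto simp: path_image_def)
  thus ?thesis using that[of x] by (simp add: circlepath_unit_circle)
qed

lemma continuous_on_torus_comp:
  assumes "continuous_on torus P"
  shows "continuous_on S (\<lambda>t. P (tor t))"
  by (rule continuous_on_compose2[OF assms continuous_on_tor]) (use tor_in_torus in blast)

lemma integrable_Q:
  fixes h :: "real \<times> real \<Rightarrow> 'b::euclidean_space"
  assumes "continuous_on unit_square h"
  shows "integrable \<Q> h"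
  using borel_integrable_compact[OF compact_cbox assms]
  by (subst integrable_restrict_space) auto

lemma integral_Q:
  fixes h :: "real \<times> real \<Rightarrow> 'b::euclidean_space"
  shows "integral\<^sup>L \<Q> h = (\<integral>t. indicator unit_square t *\<^sub>R h t \<partial>lborel)"
  by (subst integral_restrict_space) auto

text \<open>Both orders are recorded since the Cauchy argument moves either coordinate with the
  other one fixed.\<close>

lemma integral_Q_iterated:
  fixes h :: "real \<times> real \<Rightarrow> 'b::euclidean_space"
  assumes h: "continuous_on unit_square h"
  shows "integral\<^sup>L \<Q> h = (\<integral>x. \<integral>y. h (x, y) \<partial>\<U> \<partial>\<U>)"
    and "integral\<^sup>L \<Q> h = (\<integral>y. \<integral>x. h (x, y) \<partial>\<U> \<partial>\<U>)"
proof -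
  have ind: "indicator unit_square (x, y) *\<^sub>R h (x, y) = indicator {0..1} x *\<^sub>R (indicator {0..1} y *\<^sub>R h (x, y))" for x y
    by (auto simp: indicator_def)
  have int: "integrable (lborel \<Otimes>\<^sub>M lborel) (\<lambda>t. indicator unit_square t *\<^sub>R h t)"
    using borel_integrable_compact[OF compact_cbox h] by (simp add: lborel_prod)
  have U: "integral\<^sup>L \<U> g = (\<integral>x. indicator {0..1} x *\<^sub>R g x \<partial>lborel)" for g :: "real \<Rightarrow> 'b"
    by (subst integral_restrict_space) auto
  have "integral\<^sup>L \<Q> h = (\<integral>t. indicator unit_square t *\<^sub>R h t \<partial>(lborel \<Otimes>\<^sub>M lborel))"
    by (simp add: integral_Q lborel_prod)
  also have "\<dots> = (\<integral>x. \<integral>y. indicator unit_square (x, y) *\<^sub>R h (x, y) \<partial>lborel \<partial>lborel)"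
    by (rule lborel_pair.integral_fst'[OF int, symmetric])
  also have "\<dots> = (\<integral>x. \<integral>y. h (x, y) \<partial>\<U> \<partial>\<U>)"
    by (simp only: ind U integral_scaleR_right)
  finally show "integral\<^sup>L \<Q> h = (\<integral>x. \<integral>y. h (x, y) \<partial>\<U> \<partial>\<U>)" .
  have "integral\<^sup>L \<Q> h = (\<integral>t. indicator unit_square t *\<^sub>R h t \<partial>(lborel \<Otimes>\<^sub>M lborel))"
    by (simp add: integral_Q lborel_prod)
  also have "\<dots> = (\<integral>y. \<integral>x. indicator unit_square (x, y) *\<^sub>R h (x, y) \<partial>lborel \<partial>lborel)"
    using lborel_pair.integral_snd[of "\<lambda>x y. indicator unit_square (x, y) *\<^sub>R h (x, y)"] int
    by (simp add: case_prod_unfold)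
  also have "\<dots> = (\<integral>y. \<integral>x. indicator {0..1} y *\<^sub>R (indicator {0..1} x *\<^sub>R h (x, y)) \<partial>lborel \<partial>lborel)"
    by (simp only: ind scaleR_left_commute)
  also have "\<dots> = (\<integral>y. \<integral>x. h (x, y) \<partial>\<U> \<partial>\<U>)"
    by (simp only: U integral_scaleR_right)
  finally show "integral\<^sup>L \<Q> h = (\<integral>y. \<integral>x. h (x, y) \<partial>\<U> \<partial>\<U>)" .
qed

text \<open>The character is not conjugated, so this is the Fourier coefficient of index
  \<open>(-a, -b)\<close>; the negated indices in later statements compensate for it.\<close>

definition fourier :: "int \<Rightarrow> int \<Rightarrow> (complex \<times> complex \<Rightarrow> complex) \<Rightarrow> complex" where
  "fourier a b P = (\<integral>t. P (tor t) * (fst (tor t) powi a * snd (tor t) powi b) \<partial>\<Q>)"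

definition null_fourier :: "(complex \<times> complex \<Rightarrow> complex) \<Rightarrow> bool" where
  "null_fourier P \<longleftrightarrow> continuous_on torus P \<and> (\<forall>a b. fourier a b P = 0)"

lemma continuous_on_powi_torus:
  "continuous_on torus (\<lambda>c. fst c powi a * snd c powi b)"
  by (intro continuous_on_mult continuous_on_power_int continuous_on_fst continuous_on_snd continuous_on_id) auto

lemma integrable_fourier:
  assumes "continuous_on torus P"
  shows "integrable \<Q> (\<lambda>t. P (tor t) * (fst (tor t) powi a * snd (tor t) powi b))"
  by (intro integrable_Q continuous_on_torus_comp[where P="\<lambda>c. P c * (fst c powi a * snd c powi b)"]
      continuous_on_mult assms continuous_on_powi_torus)

lemma null_fourier_add:
  assumes "null_fourier P" "null_fourier R"
  shows "null_fourier (\<lambda>c. P c + R c)"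
  using assms integrable_fourier[of P] integrable_fourier[of R]
  by (auto simp: null_fourier_def fourier_def distrib_right intro!: continuous_on_add)

lemma null_fourier_const:
  assumes "null_fourier P"
  shows "null_fourier (\<lambda>c. P c * k)"
proof -
  have "fourier a b (\<lambda>c. P c * k) = fourier a b P * k" for a b
    unfolding fourier_def by (simp add: mult_ac flip: integral_mult_right_zero)
  thus ?thesis
    using assms by (auto simp: null_fourier_def intro!: continuous_on_mult continuous_on_const)
qed

lemma null_fourier_cong:
  assumes "null_fourier P" "\<And>c. c \<in> torus \<Longrightarrow> P c = R c"
  shows "null_fourier R"
proof -
  have "continuous_on torus R"
    using assms continuous_on_cong[of torus torus P R] by (auto simp: null_fourier_def)
  moreover have "fourier a b R = fourier a b P" for a b
    unfolding fourier_def by (intro Bochner_Integration.integral_cong refl arg_cong2[where f="(*)"] assms(2)[symmetric] tor_in_torus)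
  ultimately show ?thesis using assms(1) by (simp add: null_fourier_def)
qed

lemma null_fourier_monomial:
  assumes "null_fourier P"
  shows "null_fourier (\<lambda>c. P c * (fst c powi a * snd c powi b))"
proof -
  have "fourier a' b' (\<lambda>c. P c * (fst c powi a * snd c powi b)) = fourier (a + a') (b + b') P" for a' b'
    unfolding fourier_def by (simp add: power_int_add mult_ac)
  thus ?thesis
    using assms by (auto simp: null_fourier_def intro!: continuous_on_mult continuous_on_powi_torus)
qed

text \<open>On the torus conjugation is inversion, so a real linear functional is a combination of
  the four characters of degree one. This is the base case for real polynomials, which are what
  Stone-Weierstrass supplies.\<close>

lemma null_fourier_linear:
  fixes q :: "complex \<times> complex \<Rightarrow> real"
  assumes P: "null_fourier P" and q: "bounded_linear q"
  shows "null_fourier (\<lambda>c. P c * of_real (q c))"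
proof -
  interpret q: bounded_linear q by fact
  let ?p = "of_real (q (1, 0)) - \<i> * of_real (q (\<i>, 0))" and ?r = "of_real (q (0, 1)) - \<i> * of_real (q (0, \<i>))"
  have rep: "of_real (q c) = (fst c * ?p + cnj (fst c) * cnj ?p + (snd c * ?r + cnj (snd c) * cnj ?r)) / 2" for c
  proof -
    have "c = Re (fst c) *\<^sub>R (1, 0) + Im (fst c) *\<^sub>R (\<i>, 0) + (Re (snd c) *\<^sub>R (0, 1) + Im (snd c) *\<^sub>R (0, \<i>))"
      by (cases c) (auto simp: complex_eq_iff)
    from arg_cong[OF this, of q] have qc: "q c = Re (fst c) * q (1, 0) + Im (fst c) * q (\<i>, 0) + (Re (snd c) * q (0, 1) + Im (snd c) * q (0, \<i>))"
      by (simp only: q.add q.scaleR real_scaleR_def)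
    show ?thesis unfolding qc by (simp add: complex_eq_iff field_simps)
  qed
  have inv: "cnj x = x powi (-1)" if "norm x = 1" for x :: complex
  proof -
    have "x * cnj x = 1" using that by (simp add: complex_norm_square[symmetric])
    hence "inverse x = cnj x" by (rule inverse_unique)
    thus ?thesis by (simp add: power_int_minus)
  qed
  have gen: "u * f * (p / 2) + u * f' * (p' / 2) + (u * s * (r / 2) + u * s' * (r' / 2)) = u * ((f * p + f' * p' + (s * r + s' * r')) / 2)"
    for u f f' s s' p p' r r' :: complex
    by (simp add: field_simps)
  note M = null_fourier_const[OF null_fourier_monomial[OF P]]
  have "null_fourier (\<lambda>c. P c * (fst c powi 1 * snd c powi 0) * (?p / 2) + P c * (fst c powi (-1) * snd c powi 0) * (cnj ?p / 2)
     + (P c * (fst c powi 0 * snd c powi 1) * (?r / 2) + P c * (fst c powi 0 * snd c powi (-1)) * (cnj ?r / 2)))"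
    by (intro null_fourier_add M)
  thus ?thesis
  proof (rule null_fourier_cong)
    fix c assume "c \<in> torus"
    hence "norm (fst c) = 1" "norm (snd c) = 1" by auto
    note i = inv[OF this(1)] inv[OF this(2)]
    show "P c * (fst c powi 1 * snd c powi 0) * (?p / 2) + P c * (fst c powi (-1) * snd c powi 0) * (cnj ?p / 2)
     + (P c * (fst c powi 0 * snd c powi 1) * (?r / 2) + P c * (fst c powi 0 * snd c powi (-1)) * (cnj ?r / 2)) = P c * of_real (q c)"
      unfolding rep[of c] i(1)[symmetric] i(2)[symmetric] gen[symmetric] by simp
  qed
qed

lemma null_fourier_polynomial:
  assumes "real_polynomial_function g" "null_fourier P"
  shows "null_fourier (\<lambda>c. P c * of_real (g c))"
  using assms
proof (induction g arbitrary: P rule: real_polynomial_function.induct)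
  case (linear f)
  thus ?case by (intro null_fourier_linear)
next
  case (const c)
  thus ?case by (intro null_fourier_const)
next
  case (add f g)
  from null_fourier_add[OF add.IH(1)[OF add.prems] add.IH(2)[OF add.prems]]
  show ?case by (simp add: distrib_left)
next
  case (mult f g)
  from mult.IH(2)[OF mult.IH(1)[OF mult.prems]]
  show ?case by (simp add: mult.assoc)
qed

lemma compact_torus: "compact torus"
  by (intro compact_Times compact_sphere)

text \<open>If a polynomial \<open>G\<close> is uniformly close to \<open>cnj P\<close>, then
  \<open>P * G\<close> has zero mean, so the mean of \<open>|P|^2\<close> equals that of
  \<open>P * (cnj P - G)\<close> and is arbitrarily small. A continuous function whose squared
  modulus has zero integral vanishes everywhere.\<close>

lemma null_fourier_imp_zero:
  assumes P: "null_fourier P" and c: "c \<in> torus"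
  shows "P c = 0"
proof -
  have cont: "continuous_on torus P" using P by (simp add: null_fourier_def)
  have contN: "continuous_on S (\<lambda>t. (norm (P (tor t)))\<^sup>2)" for S
    by (intro continuous_on_power continuous_on_norm continuous_on_torus_comp cont)
  have cN: "continuous_on S (\<lambda>t. norm (P (tor t)))" for S
    by (intro continuous_on_norm continuous_on_torus_comp cont)
  define I where "I = (\<integral>t. norm (P (tor t)) \<partial>\<Q>)"
  define J where "J = (\<integral>t. (norm (P (tor t)))\<^sup>2 \<partial>\<Q>)"
  have "I \<ge> 0" unfolding I_def by (rule Bochner_Integration.integral_nonneg) simp
  have small: "J \<le> 2 * e * I" if e: "e > 0" for e
  proof -
    obtain g1 where g1: "real_polynomial_function g1" "\<And>x. x \<in> torus \<Longrightarrow> \<bar>Re (P x) - g1 x\<bar> < e"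
      using Stone_Weierstrass_real_polynomial_function[OF compact_torus continuous_on_Re[OF cont] e] by blast
    obtain g2 where g2: "real_polynomial_function g2" "\<And>x. x \<in> torus \<Longrightarrow> \<bar>Im (P x) - g2 x\<bar> < e"
      using Stone_Weierstrass_real_polynomial_function[OF compact_torus continuous_on_Im[OF cont] e] by blast
    \<comment> \<open>The minus sign makes this an approximation of \<open>cnj P\<close>; the real
      polynomials approximate the real and imaginary parts of \<open>P\<close>.\<close>
    define G where "G = (\<lambda>c. of_real (g1 c) - \<i> * of_real (g2 c))"
    have nG: "null_fourier (\<lambda>c. P c * G c)"
      using null_fourier_add[OF null_fourier_polynomial[OF g1(1) P] null_fourier_const[OF null_fourier_polynomial[OF g2(1) P], of "-\<i>"]]
      by (rule null_fourier_cong) (simp add: G_def algebra_simps)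
    hence cG: "continuous_on torus (\<lambda>c. P c * G c)" by (simp add: null_fourier_def)
    have iG: "integrable \<Q> (\<lambda>t. P (tor t) * G (tor t))"
      by (rule integrable_Q[OF continuous_on_torus_comp[OF cG]])
    have iPP: "integrable \<Q> (\<lambda>t. P (tor t) * cnj (P (tor t)))"
      by (rule integrable_Q[OF continuous_on_torus_comp[where P="\<lambda>c. P c * cnj (P c)"]])
        (intro continuous_on_mult continuous_on_cnj cont)
    have "fourier 0 0 (\<lambda>c. P c * G c) = 0"
      using nG by (simp add: null_fourier_def)
    hence z: "(\<integral>t. P (tor t) * G (tor t) \<partial>\<Q>) = 0"
      by (simp add: fourier_def)
    have "of_real J = (\<integral>t. P (tor t) * cnj (P (tor t)) \<partial>\<Q>)"
      unfolding J_def integral_complex_of_real[symmetric]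
      by (intro Bochner_Integration.integral_cong refl) (simp add: complex_norm_square[symmetric])
    also have "\<dots> = (\<integral>t. P (tor t) * (cnj (P (tor t)) - G (tor t)) \<partial>\<Q>)"
      using z iG iPP by (simp add: right_diff_distrib)
    finally have "norm (of_real J :: complex) = norm (\<integral>t. P (tor t) * (cnj (P (tor t)) - G (tor t)) \<partial>\<Q>)"
      by (rule arg_cong)
    hence "J \<le> norm (\<integral>t. P (tor t) * (cnj (P (tor t)) - G (tor t)) \<partial>\<Q>)"
      using abs_ge_self[of J] by (simp only: norm_of_real)
    also have "\<dots> \<le> (\<integral>t. norm (P (tor t) * (cnj (P (tor t)) - G (tor t))) \<partial>\<Q>)"
      by (rule integral_norm_bound)
    also have "\<dots> \<le> (\<integral>t. 2 * e * norm (P (tor t)) \<partial>\<Q>)"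
    proof (rule integral_mono)
      show "integrable \<Q> (\<lambda>t. norm (P (tor t) * (cnj (P (tor t)) - G (tor t))))"
        using iG iPP by (simp add: right_diff_distrib)
      show "integrable \<Q> (\<lambda>t. 2 * e * norm (P (tor t)))"
        by (intro integrable_mult_right integrable_Q cN)
      fix t
      have "norm (cnj (P (tor t)) - G (tor t)) \<le> \<bar>Re (cnj (P (tor t)) - G (tor t))\<bar> + \<bar>Im (cnj (P (tor t)) - G (tor t))\<bar>"
        by (rule cmod_le)
      also have "\<dots> \<le> 2 * e"
        using g1(2)[OF tor_in_torus, of t] g2(2)[OF tor_in_torus, of t] by (simp add: G_def)
      finally have "norm (P (tor t)) * norm (cnj (P (tor t)) - G (tor t)) \<le> norm (P (tor t)) * (2 * e)"
        by (intro mult_left_mono) auto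
      thus "norm (P (tor t) * (cnj (P (tor t)) - G (tor t))) \<le> 2 * e * norm (P (tor t))"
        by (simp add: norm_mult mult.commute)
    qed
    also have "\<dots> = 2 * e * I" by (simp add: I_def)
    finally show ?thesis .
  qed
  have "J \<le> 0"
  proof (rule field_le_epsilon)
    fix e :: real assume e: "e > 0"
    \<comment> \<open>Dividing by \<open>I + 1\<close> instead of \<open>I\<close> avoids a separate
      case for \<open>I = 0\<close>.\<close>
    have "J \<le> 2 * (e / (2 * (I + 1))) * I" using e \<open>I \<ge> 0\<close> by (intro small) auto
    also have "\<dots> \<le> 0 + e" using e \<open>I \<ge> 0\<close> by (simp add: field_simps)
    finally show "J \<le> 0 + e" .
  qed
  moreover have "J \<ge> 0" unfolding J_def by (rule Bochner_Integration.integral_nonneg) simp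
  ultimately have J0: "J = 0" by simp
  have SI: "set_integrable lborel unit_square (\<lambda>t. (norm (P (tor t)))\<^sup>2)"
    unfolding set_integrable_def by (rule borel_integrable_compact[OF compact_cbox contN])
  have hi: "((\<lambda>t. (norm (P (tor t)))\<^sup>2) has_integral 0) unit_square"
  proof -
    have "integral unit_square (\<lambda>t. (norm (P (tor t)))\<^sup>2) = J"
      unfolding J_def integral_Q set_borel_integral_eq_integral(2)[OF SI, symmetric] set_lebesgue_integral_def ..
    thus ?thesis
      using integrable_integral[OF set_borel_integral_eq_integral(1)[OF SI]] J0 by (simp only:)
  qed
  have nc: "norm (fst c) = 1" "norm (snd c) = 1" using c by auto
  obtain x where x: "x \<in> {0..1}" "fst c = unit_circle x" by (rule unit_circle_exhausts[OF nc(1)])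
  obtain y where y: "y \<in> {0..1}" "snd c = unit_circle y" by (rule unit_circle_exhausts[OF nc(2)])
  have xy: "x \<in> {0..1}" "y \<in> {0..1}" "c = tor (x, y)"
    using x y by (auto simp: tor_def prod_eq_iff)
  have "(norm (P (tor (x, y))))\<^sup>2 = 0"
    by (rule has_integral_0_cbox_imp_0[OF contN _ hi]) (use xy in \<open>auto simp: box_ne_empty Basis_prod_def\<close>)
  thus ?thesis using xy by simp
qed

section \<open>Cauchy's theorem on concentric circles\<close>

lemma has_contour_integral_circle_complex:
  assumes c: "c \<noteq> 0"
    and g: "continuous_on (sphere 0 (norm c)) g"
  shows "contour_integral (circlepath 0 (norm c)) (\<lambda>z. g z / z) = 2 * of_real pi * \<i> * (\<integral>x. g (c * unit_circle x) \<partial>\<U>)"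
proof -
  obtain \<phi> where \<phi>: "\<phi> \<in> {0..1}" "c / of_real (norm c) = unit_circle \<phi>"
    using unit_circle_exhausts[of "c / of_real (norm c)"] c by (auto simp: norm_divide)
  hence c': "c = of_real (norm c) * unit_circle \<phi>" using c by (simp add: field_simps)
  have per: "unit_circle (x + y) = unit_circle x * unit_circle y" "unit_circle (x - 1) = unit_circle x" for x y
    by (auto simp: unit_circle_def cis_mult cis_divide[symmetric] ring_distribs)
  \<comment> \<open>The circle traversed from \<open>c\<close> is the standard one with its starting
    point moved, and a closed contour integral ignores the starting point.\<close>
  have eq: "shiftpath \<phi> (circlepath 0 (norm c)) = (\<lambda>x. c * unit_circle x)"
    by (rule ext, subst (2) c') (auto simp: shiftpath_def circlepath_unit_circle per)
  have vd: "vector_derivative (\<lambda>x. c * unit_circle x) (at x) = 2 * of_real pi * \<i> * (c * unit_circle x)" for x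
  proof -
    have "((\<lambda>x. c * circlepath 0 1 x) has_vector_derivative (c * (2 * pi * \<i> * of_real 1 * exp (2 * of_real pi * \<i> * x)))) (at x)"
      by (intro has_vector_derivative_mult_right has_vector_derivative_circlepath)
    thus ?thesis
      by (intro vector_derivative_at) (simp add: circlepath_unit_circle unit_circle_def cis_conv_exp mult_ac)
  qed
  have cont: "continuous_on {0..1} (\<lambda>x. g (c * unit_circle x))"
    by (intro continuous_on_compose2[OF g] continuous_intros) (auto simp: norm_mult)
  define I where "I = integral {0..1} (\<lambda>x. g (c * unit_circle x))"
  have hI: "((\<lambda>x. g (c * unit_circle x)) has_integral I) {0..1}"
    unfolding I_def by (intro integrable_integral integrable_continuous_real cont)
  have "((\<lambda>z. g z / z) has_contour_integral 2 * of_real pi * \<i> * I) (\<lambda>x. c * unit_circle x)"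
    unfolding has_contour_integral vd using has_integral_mult_right[OF hI, of "2 * of_real pi * \<i>"] c
    by (simp add: mult_ac)
  hence "((\<lambda>z. g z / z) has_contour_integral 2 * of_real pi * \<i> * I) (circlepath 0 (norm c))"
    unfolding eq[symmetric] using \<phi> by (subst (asm) has_contour_integral_shiftpath_eq) auto
  moreover have "I = (\<integral>x. g (c * unit_circle x) \<partial>\<U>)"
    using has_bochner_integral_U[OF cont hI] by (simp add: has_bochner_integral_iff)
  ultimately show ?thesis by (simp add: contour_integral_unique)
qed

text \<open>The mean of \<open>g\<close> is, up to a constant, the contour integral of
  \<open>g z / z\<close>, and the two circles are homotopic inside the annulus between them.
  \<open>S\<close> need not contain the disc, so this also applies to functions with a singularity
  at 0.\<close>

lemma circle_mean_radius:
  assumes S: "open S" "0 \<notin> S" and g: "g holomorphic_on S" and c: "c \<noteq> 0" "d \<noteq> 0"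
    and sub: "\<And>z. min (norm c) (norm d) \<le> norm z \<Longrightarrow> norm z \<le> max (norm c) (norm d) \<Longrightarrow> z \<in> S"
  shows "(\<integral>x. g (c * unit_circle x) \<partial>\<U>) = (\<integral>x. g (d * unit_circle x) \<partial>\<U>)"
proof -
  have hom: "homotopic_loops S (circlepath 0 (norm c)) (circlepath 0 (norm d))"
  proof (rule homotopic_loops_linear)
    fix t :: real
    show "closed_segment (circlepath 0 (norm c) t) (circlepath 0 (norm d) t) \<subseteq> S"
    proof
      fix z assume "z \<in> closed_segment (circlepath 0 (norm c) t) (circlepath 0 (norm d) t)"
      then obtain u where u: "0 \<le> u" "u \<le> 1" "z = (1 - u) *\<^sub>R circlepath 0 (norm c) t + u *\<^sub>R circlepath 0 (norm d) t"
        by (auto simp: closed_segment_def)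
      define r where "r = (1 - u) * norm c + u * norm d"
      have "z = of_real r * unit_circle t"
        unfolding u(3) circlepath_unit_circle by (simp add: r_def scaleR_conv_of_real algebra_simps)
      moreover have "r \<ge> 0" using u by (simp add: r_def)
      ultimately have "norm z = r" by (simp add: norm_mult)
      moreover have "min (norm c) (norm d) \<le> r" "r \<le> max (norm c) (norm d)"
        using u convex_bound_le[of "norm c" "max (norm c) (norm d)" "norm d" "1 - u" u]
          convex_bound_le[of "- norm c" "- min (norm c) (norm d)" "- norm d" "1 - u" u]
        by (auto simp: r_def)
      ultimately show "z \<in> S" by (intro sub) auto
    qed
  qed auto
  have "(\<lambda>z. g z / z) holomorphic_on S"
    using S by (intro holomorphic_intros g) auto
  from Cauchy_theorem_homotopic_loops[OF hom S(1) this]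
  have "contour_integral (circlepath 0 (norm c)) (\<lambda>z. g z / z) = contour_integral (circlepath 0 (norm d)) (\<lambda>z. g z / z)"
    by simp
  moreover have "continuous_on (sphere 0 (norm c)) g" "continuous_on (sphere 0 (norm d)) g"
    by (rule holomorphic_on_imp_continuous_on[OF holomorphic_on_subset[OF g]], use sub in auto)+
  ultimately show ?thesis
    using c by (simp add: has_contour_integral_circle_complex)
qed

section \<open>The reproducing property\<close>

lemma holo2_slice:
  assumes "holo2_at f (x, y)"
  shows "(\<lambda>x. f (x, y)) field_differentiable (at x)" "(\<lambda>y. f (x, y)) field_differentiable (at y)"
proof -
  obtain a b where d: "(f has_derivative (\<lambda>h. a * fst h + b * snd h)) (at (x, y))"
    using assms by (auto simp: holo2_at_def)
  have "((\<lambda>x. f (x, y)) has_derivative (\<lambda>h. a * h)) (at x)"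
    by (rule has_derivative_eq_rhs[OF has_derivative_compose[OF has_derivative_Pair[OF has_derivative_ident has_derivative_const] d]]) auto
  thus "(\<lambda>x. f (x, y)) field_differentiable (at x)"
    by (auto simp: field_differentiable_def has_field_derivative_def)
  have "((\<lambda>y. f (x, y)) has_derivative (\<lambda>h. b * h)) (at y)"
    by (rule has_derivative_eq_rhs[OF has_derivative_compose[OF has_derivative_Pair[OF has_derivative_const has_derivative_ident] d]]) auto
  thus "(\<lambda>y. f (x, y)) field_differentiable (at y)"
    by (auto simp: field_differentiable_def has_field_derivative_def)
qed

section \<open>Monomials and powers on the unit circle\<close>

definition mon :: "int \<Rightarrow> int \<Rightarrow> complex \<times> complex \<Rightarrow> complex" where
  "mon a b w = fst w powi a * snd w powi b"

lemma powi_field_differentiable: "z \<noteq> 0 \<Longrightarrow> (\<lambda>x::complex. x powi a) field_differentiable (at z)"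
  by (rule holomorphic_on_imp_differentiable_at[of _ "-{0}"]) (auto intro!: holomorphic_intros)

lemma holo2_mon: "fst z \<noteq> 0 \<Longrightarrow> snd z \<noteq> 0 \<Longrightarrow> holo2_at (mon a b) z"
  unfolding mon_def[abs_def]
  by (intro holo2_mult holo2_compose[OF holo2_fst] holo2_compose[OF holo2_snd] powi_field_differentiable)

lemma mon_mult: "mon a b (c1 * w1, c2 * w2) = mon a b (c1, c2) * mon a b (w1, w2)"
  by (simp add: mon_def power_int_mult_distrib)

lemma mon_minus: "mon (-a) (-b) w = inverse (mon a b w)"
  by (simp add: mon_def power_int_minus)

lemma mean_powi: "(\<integral>x. unit_circle x powi N \<partial>\<U>) = (if N = 0 then 1 else 0)"
proof -
  have pos: "(\<integral>x. unit_circle x ^ j \<partial>\<U>) = 0" if "j > 0" for j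
  proof -
    have "(\<lambda>z::complex. z ^ j) holomorphic_on cball 0 1" by (intro holomorphic_intros)
    from circle_mean_value[OF this] that show ?thesis
      by (simp add: has_bochner_integral_iff zero_power)
  qed
  consider "N = 0" | "N > 0" | "N < 0" by linarith
  thus ?thesis
  proof cases
    case 1
    have "measure \<U> {0..1} = 1" by (simp add: measure_def)
    thus ?thesis using 1 by simp
  next
    case 2
    thus ?thesis using pos[of "nat N"] by (simp add: power_int_def)
  next
    case 3
    have "unit_circle x powi N = cnj (unit_circle x ^ nat (-N))" for x
    proof -
      have "inverse (unit_circle x) = cnj (unit_circle x)"
        by (simp add: unit_circle_def cis_cnj cis_inverse)
      thus ?thesis using 3 by (simp add: power_int_def)
    qed
    hence "(\<integral>x. unit_circle x powi N \<partial>\<U>) = (\<integral>x. cnj (unit_circle x ^ nat (-N)) \<partial>\<U>)"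
      by (simp only:)
    also have "\<dots> = cnj (\<integral>x. unit_circle x ^ nat (-N) \<partial>\<U>)"
      by (rule Bochner_Integration.integral_cnj)
    finally show ?thesis using pos[of "nat (-N)"] 3 by simp
  qed
qed

lemma cnj_unit_circle_powi: "cnj (unit_circle x) ^ j = unit_circle x powi (- int j)"
proof -
  have "inverse (unit_circle x) = cnj (unit_circle x)"
    by (simp add: unit_circle_def cis_cnj cis_inverse)
  thus ?thesis by (simp add: power_int_minus flip: power_inverse)
qed

context hartogs
begin

section \<open>Fourier coefficients of the kernel\<close>

lemma cf_sums:
  assumes "norm x < 1"
  shows "(\<lambda>j. (of_nat (m * j) + c) * x ^ j) sums cf c x"
proof -
  have x1: "x \<noteq> 1" using assms by auto
  have "(\<lambda>j. of_nat m * (of_nat (Suc j) * x ^ j) + (c - of_nat m) * x ^ j) sums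
     (of_nat m * (1 / (1 - x)\<^sup>2) + (c - of_nat m) * (1 / (1 - x)))"
    by (intro sums_add sums_mult geometric_deriv_sums geometric_sums assms)
  moreover have "of_nat m * (1 / (1 - x)\<^sup>2) + (c - of_nat m) * (1 / (1 - x)) = cf c x"
  proof -
    have "of_nat m * x / (1 - x)\<^sup>2 = of_nat m * (1 - (1 - x)) / (1 - x)\<^sup>2" by simp
    also have "\<dots> = of_nat m / (1 - x)\<^sup>2 - of_nat m * (1 - x) / (1 - x)\<^sup>2"
      by (simp only: right_diff_distrib diff_divide_distrib mult_1_right)
    also have "of_nat m * (1 - x) / (1 - x)\<^sup>2 = of_nat m / (1 - x)"
      using x1 by (simp add: power2_eq_square)
    finally show ?thesis by (simp add: cf_def diff_divide_distrib)
  qed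
  moreover have "of_nat m * (of_nat (Suc j) * x ^ j) + (c - of_nat m) * x ^ j = (of_nat (m * j) + c) * x ^ j" for j
    by (simp add: algebra_simps)
  ultimately show ?thesis by (simp only:)
qed

text \<open>Integrating the power series of \<open>cf\<close> term by term, the summand
  \<open>j\<close> carries the exponent \<open>N - l * j\<close> of the circle variable; only
  \<open>l * j = N\<close> survives.\<close>

lemma cf_mean:
  assumes x: "norm x < 1" and l: "l > 0"
  shows "(\<integral>\<theta>. cf c (x * cnj (unit_circle \<theta>) ^ l) * unit_circle \<theta> powi N \<partial>\<U>) =
    (if \<exists>q::nat. N = int (l * q) then (of_nat (m * nat (N div int l)) + c) * x ^ nat (N div int l) else 0)"
proof -
  define co where "co = (\<lambda>j. (of_nat (m * j) + c) * x ^ j)"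
  define f where "f = (\<lambda>j \<theta>. co j * unit_circle \<theta> powi (N - int (l * j)))"
  have fj: "f j \<theta> = (of_nat (m * j) + c) * (x * cnj (unit_circle \<theta>) ^ l) ^ j * unit_circle \<theta> powi N" for j \<theta>
  proof -
    have 1: "(cnj (unit_circle \<theta>) ^ l) ^ j = unit_circle \<theta> powi (- int (l * j))"
      unfolding power_mult[symmetric] by (rule cnj_unit_circle_powi)
    have 2: "unit_circle \<theta> powi (N - int (l * j)) = unit_circle \<theta> powi N * unit_circle \<theta> powi (- int (l * j))"
      using power_int_add[of "unit_circle \<theta>" N "- int (l * j)"] by simp
    show ?thesis
      unfolding f_def co_def power_mult_distrib 1 2 by (simp only: mult_ac)
  qed
  \<comment> \<open>The majorant is again a \<open>cf\<close> series, taken at \<open>norm c\<close>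
    and \<open>norm x\<close>; passing to real parts makes it a real series.\<close>
  have sm: "summable (\<lambda>j. norm (co j))"
  proof -
    have "(\<lambda>j. (of_nat (m * j) + complex_of_real (norm c)) * of_real (norm x) ^ j) sums cf (of_real (norm c)) (of_real (norm x))"
      by (rule cf_sums) (use x in simp)
    hence "summable (\<lambda>j. Re ((of_nat (m * j) + complex_of_real (norm c)) * of_real (norm x) ^ j))"
      using summable_Re sums_summable by blast
    hence "summable (\<lambda>j. (real (m * j) + norm c) * norm x ^ j)"
      by (simp flip: of_real_power)
    thus ?thesis
    proof (rule summable_comparison_test'[where N=0])
      fix j :: nat
      have "norm (of_nat (m * j) + c) \<le> real (m * j) + norm c"
        using norm_triangle_ineq[of "of_nat (m * j)" c] by (simp only: norm_of_nat)
      thus "norm (norm (co j)) \<le> (real (m * j) + norm c) * norm x ^ j"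
        by (simp add: co_def norm_mult norm_power mult_right_mono del: of_nat_mult)
    qed
  qed
  have nf: "norm (f j \<theta>) = norm (co j)" for j \<theta>
    by (simp add: f_def norm_mult norm_power_int)
  have int: "integrable \<U> (f j)" for j
    unfolding f_def by (intro integrable_U continuous_intros) auto
  have U1: "measure \<U> {0..1} = 1" by (simp add: measure_def)
  have "(\<lambda>j. integral\<^sup>L \<U> (f j)) sums (\<integral>\<theta>. (\<Sum>j. f j \<theta>) \<partial>\<U>)"
    by (rule sums_integral[OF int]) (use sm U1 in \<open>simp_all add: nf space_restrict_space\<close>)
  also have "(\<lambda>j. integral\<^sup>L \<U> (f j)) = (\<lambda>j. if N = int (l * j) then co j else 0)"
    by (auto simp: f_def mean_powi)
  also have "(\<integral>\<theta>. (\<Sum>j. f j \<theta>) \<partial>\<U>) = (\<integral>\<theta>. cf c (x * cnj (unit_circle \<theta>) ^ l) * unit_circle \<theta> powi N \<partial>\<U>)"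
  proof (intro Bochner_Integration.integral_cong refl)
    fix \<theta>
    have "norm (x * cnj (unit_circle \<theta>) ^ l) < 1" using x by (simp add: norm_mult norm_power)
    from sums_mult2[OF cf_sums[OF this]]
    show "(\<Sum>j. f j \<theta>) = cf c (x * cnj (unit_circle \<theta>) ^ l) * unit_circle \<theta> powi N"
      unfolding fj by (rule sums_unique[symmetric])
  qed
  finally have S: "(\<lambda>j. if N = int (l * j) then co j else 0) sums
     (\<integral>\<theta>. cf c (x * cnj (unit_circle \<theta>) ^ l) * unit_circle \<theta> powi N \<partial>\<U>)" .
  show ?thesis
  proof (cases "\<exists>q::nat. N = int (l * q)")
    case True
    then obtain q where q: "N = int (l * q)" by blast
    have "(\<lambda>j. if N = int (l * j) then co j else 0) = (\<lambda>j. if j = q then co j else 0)"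
      using l q by (auto simp: fun_eq_iff)
    from sums_unique2[OF S[unfolded this] sums_single]
    have "(\<integral>\<theta>. cf c (x * cnj (unit_circle \<theta>) ^ l) * unit_circle \<theta> powi N \<partial>\<U>) = co q" .
    moreover have "nat (N div int l) = q" using l by (simp add: q)
    ultimately show ?thesis using True by (simp add: co_def)
  next
    case False
    hence "(\<lambda>j. if N = int (l * j) then co j else 0) = (\<lambda>j. 0)" by auto
    from sums_unique2[OF S[unfolded this] sums_zero]
    have "(\<integral>\<theta>. cf c (x * cnj (unit_circle \<theta>) ^ l) * unit_circle \<theta> powi N \<partial>\<U>) = 0" .
    thus ?thesis using False by simp
  qed
qed

lemma continuous_on_cf:
  assumes "norm v < 1"
  shows "continuous_on S (\<lambda>x. cf c (v * cnj (unit_circle x) ^ l))"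
proof -
  have "norm (v * cnj (unit_circle x) ^ l) < 1" for x using assms by (simp add: norm_mult norm_power)
  hence "1 - v * cnj (unit_circle x) ^ l \<noteq> 0" for x by (metis eq_iff_diff_eq_0 less_irrefl norm_one)
  thus ?thesis
    unfolding cf_def by (intro continuous_intros continuous_on_cnj) auto
qed

lemma K_rot: "norm c = 1 \<Longrightarrow> norm d = 1 \<Longrightarrow> K (rot c d z) (rot c d w) = K z w"
proof -
  assume c: "norm c = 1" "norm d = 1"
  have cc: "c * cnj c = 1" "d * cnj d = 1"
    using c by (simp_all add: complex_norm_square[symmetric])
  have "c * x * cnj (c * y) = (c * cnj c) * (x * cnj y)" "d * x * cnj (d * y) = (d * cnj d) * (x * cnj y)" for x y
    by simp_all
  thus ?thesis by (simp only: K_def fst_rot snd_rot cc mult_1)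
qed

abbreviation orbit :: "(complex \<times> complex \<Rightarrow> complex) \<Rightarrow> complex \<times> complex \<Rightarrow> complex \<times> complex \<Rightarrow> complex" where
  "orbit f w \<equiv> \<lambda>c. f (rot (fst c) (snd c) w)"

text \<open>The mean over the first circle selects the residue class of \<open>a\<close> and, within
  it, one power of \<open>u\<close>; the mean over the second selects one power of \<open>t\<close>.
  The resulting factor is the reciprocal of the squared L^2 norm of the monomial.\<close>

lemma kernel_fourier:
  assumes z: "z \<in> \<Omega>" and w: "w \<in> \<Omega>" and ab: "int n * int a + int m * b \<ge> - int k"
  shows "fourier (int a) b (orbit (K z) w) =
    of_real ((real a + 1) * (real m * (of_int b + 1) + real n * (real a + 1)) / (pi\<^sup>2 * real m))
      * mon (int a) b (fst z * cnj (fst w), snd z * cnj (snd w))"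
proof -
  define s t where "s = fst z * cnj (fst w)" and "t = snd z * cnj (snd w)"
  note ka = \<Omega>_kernel_args[OF z w, folded s_def t_def]
  define r0 q where "r0 = a mod m" and "q = a div m"
  have r0: "r0 < m" and aq: "a = m * q + r0" using m by (auto simp: r0_def q_def)
  \<comment> \<open>The index of the term selected in the series in \<open>t\<close>. It is
    nonnegative because the monomial is admissible, which after division by \<open>m\<close> is a
    statement about the floor in \<open>dg\<close>.\<close>
  define N where "N = int (dg r0 + n * q) + b"
  have N0: "N \<ge> 0"
  proof -
    have "int n * int r0 + int k \<ge> int m * (- (int n * int q + b))"
      using ab by (simp add: aq algebra_simps)
    hence "(int n * int r0 + int k) div int m \<ge> (int m * (- (int n * int q + b))) div int m"
      by (rule zdiv_mono1) (use m in simp)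
    also have "(int m * (- (int n * int q + b))) div int m = - (int n * int q + b)"
      using m by (intro nonzero_mult_div_cancel_left) auto
    finally show ?thesis
      by (simp add: N_def dg_def zdiv_int add.commute)
  qed
  let ?A = "1 / (of_real (pi\<^sup>2) * of_nat m) :: complex"
  have inner: "(\<integral>x. kern (s * cnj (unit_circle x)) (t * cnj (unit_circle y)) * (unit_circle x powi int a * unit_circle y powi b) \<partial>\<U>)
     = ?A * of_nat (a + 1) * (s ^ a / t ^ (dg r0 + n * q)) * (cf (of_real (ec r0)) (t * cnj (unit_circle y) ^ 1) * unit_circle y powi N)" for y
  proof -
    define c2 where "c2 = unit_circle y"
    have c2: "c2 \<noteq> 0" "cnj c2 \<noteq> 0" "norm c2 = 1" "inverse (cnj c2) = c2"
      using complex_norm_square[of c2] by (auto simp: c2_def inverse_eq_divide divide_simps)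
    define t' where "t' = t * cnj c2"
    define u where "u = s ^ m / t' ^ n"
    have u: "norm u < 1" using ka(1-3) c2 by (simp add: u_def t'_def norm_divide norm_mult norm_power)
    have t': "t' \<noteq> 0" "norm t' < 1" using ka c2 by (auto simp: t'_def norm_mult)
    define R where "R = (\<lambda>r. s ^ r / t' ^ dg r * cf (of_real (ec r)) t' * c2 powi b)"
    have eq: "kern (s * cnj (unit_circle x)) t' * (unit_circle x powi int a * c2 powi b)
       = ?A * (\<Sum>r<m. R r * (cf (of_nat (r + 1)) (u * cnj (unit_circle x) ^ m) * unit_circle x powi (int a - int r)))" for x
    proof -
      have "cnj (unit_circle x) ^ r * unit_circle x powi int a = unit_circle x powi (int a - int r)" for r
        using power_int_add[of "unit_circle x" "- int r" "int a"]
        by (simp add: cnj_unit_circle_powi del: power_int_of_nat)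
      hence 1: "unit_circle x powi (int a - int r) = cnj (unit_circle x) ^ r * unit_circle x powi int a" for r by simp
      show ?thesis
        unfolding kern_def R_def u_def 1 by (simp add: sum_distrib_left sum_distrib_right power_mult_distrib mult_ac)
    qed
    have "(\<integral>x. kern (s * cnj (unit_circle x)) t' * (unit_circle x powi int a * c2 powi b) \<partial>\<U>)
      = ?A * (\<Sum>r<m. R r * (\<integral>x. cf (of_nat (r + 1)) (u * cnj (unit_circle x) ^ m) * unit_circle x powi (int a - int r) \<partial>\<U>))"
      unfolding eq
      by (subst integral_mult_right_zero, subst Bochner_Integration.integral_sum)
        (auto intro!: integrable_mult_right integrable_U continuous_on_mult continuous_on_cf u continuous_on_power_int continuous_on_unit_circle continuous_on_id simp del: of_nat_Suc of_nat_add)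
    also have "(\<Sum>r<m. R r * (\<integral>x. cf (of_nat (r + 1)) (u * cnj (unit_circle x) ^ m) * unit_circle x powi (int a - int r) \<partial>\<U>))
      = (\<Sum>r<m. if r = r0 then R r0 * (of_nat (a + 1) * u ^ q) else 0)"
    proof (rule sum.cong[OF refl])
      fix r assume r: "r \<in> {..<m}"
      have iff: "(\<exists>q'::nat. int a - int r = int (m * q')) \<longleftrightarrow> r = r0"
      proof
        assume "\<exists>q'::nat. int a - int r = int (m * q')"
        then obtain q' where "int a - int r = int (m * q')" by blast
        hence "a = m * q' + r" by (metis add.commute diff_eq_eq of_nat_add of_nat_eq_iff)
        thus "r = r0" using r by (simp add: r0_def)
      next
        assume "r = r0"
        thus "\<exists>q'::nat. int a - int r = int (m * q')" by (intro exI[of _ q]) (simp add: aq)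
      qed
      have dq: "nat ((int a - int r0) div int m) = q" using m by (simp add: aq)
      show "R r * (\<integral>x. cf (of_nat (r + 1)) (u * cnj (unit_circle x) ^ m) * unit_circle x powi (int a - int r) \<partial>\<U>)
        = (if r = r0 then R r0 * (of_nat (a + 1) * u ^ q) else 0)"
        unfolding cf_mean[OF u m] iff using dq by (simp add: aq)
    qed
    also have "\<dots> = R r0 * (of_nat (a + 1) * u ^ q)" using r0 by simp
    also have "?A * (R r0 * (of_nat (a + 1) * u ^ q)) = ?A * of_nat (a + 1) * ((s ^ r0 * (s ^ m) ^ q) / (t' ^ dg r0 * (t' ^ n) ^ q)) * (cf (of_real (ec r0)) t' * c2 powi b)"
      by (simp add: R_def u_def power_divide)
    also have "s ^ r0 * (s ^ m) ^ q = s ^ a"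
      by (simp add: aq power_add power_mult)
    also have "t' ^ dg r0 * (t' ^ n) ^ q = t' ^ (dg r0 + n * q)"
      by (simp add: power_add power_mult)
    \<comment> \<open>Conjugates in the denominator become positive powers of \<open>c2\<close>,
      which raise the exponent \<open>b\<close> to \<open>N\<close>.\<close>
    also have "s ^ a / t' ^ (dg r0 + n * q) = (s ^ a / t ^ (dg r0 + n * q)) * c2 powi int (dg r0 + n * q)"
      using c2(4) by (simp add: t'_def power_mult_distrib divide_inverse power_inverse[symmetric] power_int_of_nat del: of_nat_add of_nat_mult)
    finally show ?thesis
      using c2(1) by (simp add: t'_def c2_def N_def power_int_add mult_ac)
  qed
  have cont: "continuous_on unit_square (\<lambda>p. K z (rot (fst (tor p)) (snd (tor p)) w) * (fst (tor p) powi int a * snd (tor p) powi b))"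
  proof (rule continuous_on_torus_comp[where P="\<lambda>c. K z (rot (fst c) (snd c) w) * (fst c powi int a * snd c powi b)"], rule continuous_on_mult[OF _ continuous_on_powi_torus])
    have 1: "continuous_on \<Omega> (\<lambda>w. K w z)"
      by (intro continuous_at_imp_continuous_on ballI holo2_at_imp_isCont K_holo2 z)
    have 2: "K z w' = cnj (K w' z)" for w' by (simp add: cnj_K)
    show "continuous_on torus (orbit (K z) w)"
      unfolding 2
    proof (intro continuous_on_cnj continuous_on_compose2[OF 1])
      show "continuous_on torus (\<lambda>c. rot (fst c) (snd c) w)"
        unfolding rot_def by (intro continuous_on_Pair continuous_on_mult continuous_on_fst continuous_on_snd continuous_on_id continuous_on_const)
    qed (use w in auto)
  qed
  have "fourier (int a) b (orbit (K z) w)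
     = (\<integral>y. \<integral>x. kern (s * cnj (unit_circle x)) (t * cnj (unit_circle y)) * (unit_circle x powi int a * unit_circle y powi b) \<partial>\<U> \<partial>\<U>)"
    unfolding fourier_def integral_Q_iterated(2)[OF cont] by (simp add: K_def s_def t_def mult_ac)
  also have "\<dots> = ?A * of_nat (a + 1) * (s ^ a / t ^ (dg r0 + n * q)) *
      (\<integral>y. cf (of_real (ec r0)) (t * cnj (unit_circle y) ^ 1) * unit_circle y powi N \<partial>\<U>)"
    unfolding inner by (rule integral_mult_right_zero)
  also have "(\<integral>y. cf (of_real (ec r0)) (t * cnj (unit_circle y) ^ 1) * unit_circle y powi N \<partial>\<U>)
     = (of_nat (m * nat N) + of_real (ec r0)) * t ^ nat N"
  proof -
    have "\<exists>q'::nat. N = int (1 * q')" using N0 by (intro exI[of _ "nat N"]) simp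
    thus ?thesis using cf_mean[OF ka(2), of 1 "of_real (ec r0)" N] by simp
  qed
  also have "of_nat (m * nat N) + of_real (ec r0) = complex_of_real (real m * (of_int b + 1) + real n * (real a + 1))"
  proof -
    have "real (nat N) = of_int N" using N0 by simp
    hence "real (m * nat N) + ec r0 = real m * (of_int b + 1) + real n * (real a + 1)"
      by (simp add: N_def ec_def aq algebra_simps)
    thus ?thesis by (metis of_real_add of_real_of_nat_eq)
  qed
  also have "?A * of_nat (a + 1) * (s ^ a / t ^ (dg r0 + n * q)) * (complex_of_real (real m * (of_int b + 1) + real n * (real a + 1)) * t ^ nat N)
     = of_real ((real a + 1) * (real m * (of_int b + 1) + real n * (real a + 1)) / (pi\<^sup>2 * real m)) * (s ^ a * (t ^ nat N / t ^ (dg r0 + n * q)))"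
    by simp
  also have "t ^ nat N / t ^ (dg r0 + n * q) = t powi b"
  proof -
    have "t ^ nat N = t powi N" using N0 by (simp add: power_int_def)
    also have "\<dots> = t powi int (dg r0 + n * q) * t powi b"
      unfolding N_def using ka(1) by (intro power_int_add) auto
    also have "t powi int (dg r0 + n * q) = t ^ (dg r0 + n * q)" by (rule power_int_of_nat)
    finally show ?thesis using ka(1) by simp
  qed
  finally show ?thesis
    by (simp add: mon_def s_def t_def)
qed

section \<open>Averaging over the torus and the operator\<close>

abbreviation rt :: "real \<times> real \<Rightarrow> complex \<times> complex \<Rightarrow> complex \<times> complex" where
  "rt t w \<equiv> rot (fst (tor t)) (snd (tor t)) w"

lemma measurable_rot_\<mu>: "norm c = 1 \<Longrightarrow> norm d = 1 \<Longrightarrow> rot c d \<in> \<mu> \<rightarrow>\<^sub>M \<mu>"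
  by (rule measurable_restrict_space2) (auto intro!: measurable_\<mu>)

lemma measurable_rt: "(\<lambda>x. rt (fst x) (snd x)) \<in> \<Q> \<Otimes>\<^sub>M \<mu> \<rightarrow>\<^sub>M \<mu>"
proof (rule measurable_restrict_space2)
  show "(\<lambda>x. rt (fst x) (snd x)) \<in> space (\<Q> \<Otimes>\<^sub>M \<mu>) \<rightarrow> \<Omega>"
    by (auto simp: space_pair_measure)
  have [measurable]: "fst \<in> borel_measurable (\<Q> \<Otimes>\<^sub>M \<mu>)" "snd \<in> borel_measurable (\<Q> \<Otimes>\<^sub>M \<mu>)"
    by (rule measurable_fst_restrict_lborel)+
  have "(\<lambda>x. rt (fst x) (snd x)) \<in> borel_measurable (\<Q> \<Otimes>\<^sub>M \<mu>)"
    unfolding rot_def tor_def fst_conv snd_conv by measurable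
  thus "(\<lambda>x. rt (fst x) (snd x)) \<in> \<Q> \<Otimes>\<^sub>M \<mu> \<rightarrow>\<^sub>M lborel" by simp
qed

lemma distr_rot_\<mu>:
  assumes c: "norm c = 1" "norm d = 1"
  shows "distr \<mu> \<mu> (rot c d) = \<mu>"
proof (rule measure_eqI)
  fix A assume "A \<in> sets (distr \<mu> \<mu> (rot c d))"
  hence A: "A \<in> sets \<mu>" by simp
  hence A': "A \<in> sets borel" "A \<subseteq> \<Omega>"
    by (auto simp: sets_restrict_space)
  note [measurable] = measurable_rot_\<mu>[OF c]
  have "emeasure (distr \<mu> \<mu> (rot c d)) A = (\<integral>\<^sup>+w. indicator A w \<partial>distr \<mu> \<mu> (rot c d))"
    using A by simp
  also have "\<dots> = (\<integral>\<^sup>+w. indicator A (rot c d w) \<partial>\<mu>)"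
    using A by (subst nn_integral_distr) auto
  also have "\<dots> = (\<integral>\<^sup>+w. indicator A w \<partial>\<mu>)"
    using A' by (intro nn_integral_\<mu>_rot c) auto
  also have "\<dots> = emeasure \<mu> A"
    using A by simp
  finally show "emeasure (distr \<mu> \<mu> (rot c d)) A = emeasure \<mu> A" .
qed simp

lemma integral_rot:
  fixes g :: "complex \<times> complex \<Rightarrow> 'b::{banach, second_countable_topology}"
  assumes "norm c = 1" "norm d = 1" "g \<in> borel_measurable \<mu>"
  shows "(\<integral>w. g (rot c d w) \<partial>\<mu>) = (\<integral>w. g w \<partial>\<mu>)"
  using integral_distr[OF measurable_rot_\<mu>[OF assms(1,2)] assms(3)] by (simp add: distr_rot_\<mu> assms)

lemma nn_integral_rot:
  assumes "norm c = 1" "norm d = 1" "g \<in> borel_measurable \<mu>"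
  shows "(\<integral>\<^sup>+w. g (rot c d w) \<partial>\<mu>) = (\<integral>\<^sup>+w. g w \<partial>\<mu>)"
  using nn_integral_distr[OF measurable_rot_\<mu>[OF assms(1,2)], of g] assms(3) by (simp add: distr_rot_\<mu> assms)

lemma nn_integral_Q_rot:
  assumes g: "g \<in> borel_measurable \<mu>"
  shows "(\<integral>\<^sup>+w. \<integral>\<^sup>+t. g (rt t w) \<partial>\<Q> \<partial>\<mu>) = (\<integral>\<^sup>+w. g w \<partial>\<mu>)"
proof -
  interpret Q: sigma_finite_measure \<Q> by (rule sigma_finite_Q)
  interpret mu: sigma_finite_measure \<mu> by (rule sigma_finite_\<mu>)
  interpret pair_sigma_finite \<Q> \<mu> ..
  have "(\<lambda>x. g (rt (fst x) (snd x))) \<in> borel_measurable (\<Q> \<Otimes>\<^sub>M \<mu>)"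
    by (rule measurable_compose[OF measurable_rt g])
  hence "(\<integral>\<^sup>+w. \<integral>\<^sup>+t. g (rt t w) \<partial>\<Q> \<partial>\<mu>) = (\<integral>\<^sup>+t. \<integral>\<^sup>+w. g (rt t w) \<partial>\<mu> \<partial>\<Q>)"
    by (intro Fubini') (simp add: case_prod_unfold)
  also have "\<dots> = (\<integral>\<^sup>+t. (\<integral>\<^sup>+w. g w \<partial>\<mu>) \<partial>\<Q>)"
    by (intro nn_integral_cong nn_integral_rot g) auto
  finally show ?thesis by simp
qed

lemma integrable_Q_\<mu>:
  fixes g :: "complex \<times> complex \<Rightarrow> 'b::{banach, second_countable_topology}"
  assumes g: "integrable \<mu> g"
  shows "integrable (\<Q> \<Otimes>\<^sub>M \<mu>) (\<lambda>x. g (rt (fst x) (snd x)))"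
proof (rule integrableI_bounded)
  interpret Q: sigma_finite_measure \<Q> by (rule sigma_finite_Q)
  interpret mu: sigma_finite_measure \<mu> by (rule sigma_finite_\<mu>)
  interpret pair_sigma_finite \<Q> \<mu> ..
  have gm [measurable]: "g \<in> borel_measurable \<mu>" using g by auto
  show m: "(\<lambda>x. g (rt (fst x) (snd x))) \<in> borel_measurable (\<Q> \<Otimes>\<^sub>M \<mu>)"
    by (rule measurable_compose[OF measurable_rt gm])
  have "(\<integral>\<^sup>+x. ennreal (norm (g (rt (fst x) (snd x)))) \<partial>(\<Q> \<Otimes>\<^sub>M \<mu>)) = (\<integral>\<^sup>+w. \<integral>\<^sup>+t. ennreal (norm (g (rt t w))) \<partial>\<Q> \<partial>\<mu>)"
    using m by (subst nn_integral_snd[symmetric]) auto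
  also have "\<dots> = (\<integral>\<^sup>+w. ennreal (norm (g w)) \<partial>\<mu>)"
    by (rule nn_integral_Q_rot) simp
  also have "\<dots> < \<infinity>" using g by (simp add: integrable_iff_bounded)
  finally show "(\<integral>\<^sup>+x. ennreal (norm (g (rt (fst x) (snd x)))) \<partial>(\<Q> \<Otimes>\<^sub>M \<mu>)) < \<infinity>" .
qed

lemma measure_Q [simp]: "measure \<Q> unit_square = 1"
  by (simp add: measure_def)

lemma integral_Q_mean:
  fixes g :: "complex \<times> complex \<Rightarrow> 'b::{banach, second_countable_topology}"
  assumes g: "integrable \<mu> g"
  shows "(\<integral>w. g w \<partial>\<mu>) = (\<integral>w. \<integral>t. g (rt t w) \<partial>\<Q> \<partial>\<mu>)"
proof -
  interpret Q: sigma_finite_measure \<Q> by (rule sigma_finite_Q)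
  interpret mu: sigma_finite_measure \<mu> by (rule sigma_finite_\<mu>)
  interpret pair_sigma_finite \<Q> \<mu> ..
  have "(\<integral>w. \<integral>t. g (rt t w) \<partial>\<Q> \<partial>\<mu>) = (\<integral>t. \<integral>w. g (rt t w) \<partial>\<mu> \<partial>\<Q>)"
    using integrable_Q_\<mu>[OF g] by (intro Fubini_integral) (simp add: case_prod_unfold)
  also have "\<dots> = (\<integral>t. (\<integral>w. g w \<partial>\<mu>) \<partial>\<Q>)"
    using g by (intro Bochner_Integration.integral_cong refl integral_rot) auto
  finally show ?thesis by simp
qed

text \<open>Turning both arguments leaves the kernel unchanged, so an orbit of \<open>T f\<close> is
  obtained by applying the kernel to the corresponding orbits of \<open>f\<close>; Fubini then moves
  the coefficient inside the integral.\<close>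

lemma fourier_T:
  assumes f: "L2 f" and z: "z \<in> \<Omega>"
  shows "fourier a b (orbit (T f) z) = (\<integral>w. K z w * fourier a b (orbit f w) \<partial>\<mu>)"
proof -
  interpret Q: sigma_finite_measure \<Q> by (rule sigma_finite_Q)
  interpret mu: sigma_finite_measure \<mu> by (rule sigma_finite_\<mu>)
  interpret pair_sigma_finite \<Q> \<mu> ..
  have fm [measurable]: "f \<in> borel_measurable \<mu>" using f by (simp add: L2_def)
  obtain B where B: "B > 0" "\<And>w. w \<in> \<Omega> \<Longrightarrow> norm (K z w) \<le> B * Y w powr (-\<kappa>)"
    using K_locally_bounded[of "{z}"] z by auto
  let ?e = "\<lambda>t. fst (tor t) powi a * snd (tor t) powi b"
  have [measurable]: "fst \<in> borel_measurable (\<Q> \<Otimes>\<^sub>M \<mu>)" "snd \<in> borel_measurable (\<Q> \<Otimes>\<^sub>M \<mu>)"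
    by (rule measurable_fst_restrict_lborel)+
  have m2: "(\<lambda>x. f (rt (fst x) (snd x))) \<in> borel_measurable (\<Q> \<Otimes>\<^sub>M \<mu>)"
    by (rule measurable_compose[OF measurable_rt fm])
  have m1: "(\<lambda>x. K z (snd x)) \<in> borel_measurable (\<Q> \<Otimes>\<^sub>M \<mu>)"
    by (intro measurable_K borel_measurable_const) measurable
  have "continuous_on UNIV (\<lambda>t. ?e t)"
    by (rule continuous_on_torus_comp[OF continuous_on_powi_torus])
  hence em: "?e \<in> borel_measurable borel"
    by (rule borel_measurable_continuous_onI)
  have m3: "(\<lambda>x. ?e (fst x)) \<in> borel_measurable (\<Q> \<Otimes>\<^sub>M \<mu>)"
    by (rule measurable_compose[OF _ em]) measurable
  \<comment> \<open>As \<open>Y\<close> is rotation invariant, the integrable function of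
    \<open>L2_weight\<close>, composed with rotations, is a majorant on the product space.\<close>
  have int: "integrable (\<Q> \<Otimes>\<^sub>M \<mu>) (\<lambda>x. K z (snd x) * f (rt (fst x) (snd x)) * ?e (fst x))"
  proof (rule Bochner_Integration.integrable_bound)
    show "integrable (\<Q> \<Otimes>\<^sub>M \<mu>) (\<lambda>x. (\<lambda>w. B * (Y w powr (-\<kappa>) * norm (f w))) (rt (fst x) (snd x)))"
      by (rule integrable_Q_\<mu>) (intro integrable_mult_right L2_weight f)
    show "(\<lambda>x. K z (snd x) * f (rt (fst x) (snd x)) * ?e (fst x)) \<in> borel_measurable (\<Q> \<Otimes>\<^sub>M \<mu>)"
      by (rule borel_measurable_times[OF borel_measurable_times[OF m1 m2] m3])
    show "AE x in \<Q> \<Otimes>\<^sub>M \<mu>. norm (K z (snd x) * f (rt (fst x) (snd x)) * ?e (fst x))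
       \<le> norm ((\<lambda>w. B * (Y w powr (-\<kappa>) * norm (f w))) (rt (fst x) (snd x)))"
    proof (rule AE_I2)
      fix x assume "x \<in> space (\<Q> \<Otimes>\<^sub>M \<mu>)"
      hence "snd x \<in> \<Omega>" by (auto simp: space_pair_measure)
      hence "norm (K z (snd x)) * norm (f (rt (fst x) (snd x))) \<le> B * Y (snd x) powr (-\<kappa>) * norm (f (rt (fst x) (snd x)))"
        by (intro mult_right_mono B) auto
      thus "norm (K z (snd x) * f (rt (fst x) (snd x)) * ?e (fst x))
       \<le> norm ((\<lambda>w. B * (Y w powr (-\<kappa>) * norm (f w))) (rt (fst x) (snd x)))"
        using B(1) by (simp add: norm_mult norm_power_int abs_mult mult.assoc)
    qed
  qed
  have T: "T f (rt t z) * ?e t = (\<integral>w. K z w * f (rt t w) * ?e t \<partial>\<mu>)" for t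
  proof -
    have "T f (rt t z) = (\<integral>w. K (rt t z) (rt t w) * f (rt t w) \<partial>\<mu>)"
      unfolding T_def by (rule integral_rot[where g="\<lambda>w. K (rt t z) w * f w", symmetric]) auto
    also have "\<dots> = (\<integral>w. K z w * f (rt t w) \<partial>\<mu>)"
      by (simp add: K_rot)
    finally show ?thesis by simp
  qed
  have "fourier a b (orbit (T f) z) = (\<integral>t. \<integral>w. K z w * f (rt t w) * ?e t \<partial>\<mu> \<partial>\<Q>)"
    unfolding fourier_def using T by (intro Bochner_Integration.integral_cong refl) auto
  also have "\<dots> = (\<integral>w. \<integral>t. K z w * f (rt t w) * ?e t \<partial>\<Q> \<partial>\<mu>)"
    using int by (intro Fubini_integral[symmetric]) (simp add: case_prod_unfold)
  also have "\<dots> = (\<integral>w. K z w * fourier a b (orbit f w) \<partial>\<mu>)"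
    unfolding fourier_def mult.assoc by (simp only: integral_mult_right_zero)
  finally show ?thesis .
qed

section \<open>Norms of monomials and their invariance under the operator\<close>

lemma norm_mon_powr:
  assumes w: "w \<in> \<Omega>" and w1: "fst w \<noteq> 0"
  shows "norm (mon a b w) powr p = X w powr (p * of_int a / 2) * Y w powr (p / 2 * (of_int a * (real n / real m) + of_int b))"
proof -
  have w2: "norm (snd w) > 0" using snd_nonzero[OF w] by simp
  have sq: "x = (x\<^sup>2) powr (1/2)" if "x > 0" for x :: real
  proof -
    have "(x\<^sup>2) powr (1/2) = (x powr 2) powr (1/2)" using that by simp
    also have "\<dots> = x" unfolding powr_powr using that by simp
    finally show ?thesis ..
  qed
  have 2: "norm (snd w) = Y w powr (1/2)" using sq[OF w2] by (simp add: Y_def)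
  have "(norm (fst w))\<^sup>2 = X w * Y w powr (real n / real m)" using w2 by (simp add: X_def Y_def)
  hence 1: "norm (fst w) = X w powr (1/2) * Y w powr (real n / real m / 2)"
    using sq[of "norm (fst w)"] w1 by (simp add: powr_mult powr_powr)
  have pi: "x powi j = x powr of_int j" if "x > 0" for x :: real and j
    using that by (simp add: powr_real_of_int')
  have "norm (mon a b w) = norm (fst w) powr of_int a * norm (snd w) powr of_int b"
    using w1 w2 by (simp add: mon_def norm_mult norm_power_int pi)
  also have "\<dots> = X w powr (of_int a / 2) * Y w powr (real n / real m / 2 * of_int a + of_int b / 2)"
    unfolding 1 2 by (simp add: powr_mult powr_powr powr_add)
  finally show ?thesis
    by (simp add: powr_mult powr_powr algebra_simps)
qed

lemma measurable_mon [measurable]: "mon a b \<in> borel_measurable borel"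
proof -
  have "(\<lambda>x::complex. x powi a) \<in> borel_measurable borel" for a
    unfolding power_int_def by measurable
  note [measurable] = measurable_compose[OF _ this]
  show ?thesis unfolding mon_def[abs_def] by measurable
qed

lemma nn_integral_norm_mon:
  assumes a: "a \<ge> 0" and p: "p > 0"
  shows "(\<integral>\<^sup>+w. ennreal (norm (mon a b w) powr p) \<partial>\<mu>) =
    (\<integral>\<^sup>+w. ennreal (X w powr (p * of_int a / 2) * Y w powr (p / 2 * (of_int a * (real n / real m) + of_int b))) \<partial>\<mu>)"
  by (rule nn_integral_cong_AE) (use AE_fst_nonzero AE_space in eventually_elim, simp add: norm_mon_powr)

lemma mon_moment:
  assumes ab: "int n * int a + int m * b \<ge> - int k"
  shows "(\<integral>\<^sup>+w. ennreal ((norm (mon (int a) b w))\<^sup>2) \<partial>\<mu>) = ennreal (pi\<^sup>2 * real m / ((real a + 1) * (real m * (of_int b + 1) + real n * (real a + 1))))"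
proof -
  \<comment> \<open>From here on \<open>k < m + n\<close> guarantees that the exponent of
    \<open>Y\<close> exceeds -1, so the moment is finite.\<close>
  have "- int (m + n) < int n * int a + int m * b" using ab k by linarith
  hence "real_of_int (- int (m + n)) < real_of_int (int n * int a + int m * b)"
    by (simp only: of_int_less_iff)
  hence pos: "0 < real m * (of_int b + 1) + real n * (real a + 1)" by (simp add: algebra_simps)
  have e: "real n / real m + (real a * (real n / real m) + of_int b) + 1 = (real m * (of_int b + 1) + real n * (real a + 1)) / real m"
    using m by (simp add: field_simps)
  hence "real n / real m + (real a * (real n / real m) + of_int b) + 1 > 0"
    using pos m by simp
  hence gt: "real n / real m + (real a * (real n / real m) + of_int b) > -1" by linarith
  have "(\<integral>\<^sup>+w. ennreal ((norm (mon (int a) b w))\<^sup>2) \<partial>\<mu>) = (\<integral>\<^sup>+w. ennreal (norm (mon (int a) b w) powr 2) \<partial>\<mu>)"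
    by simp
  also have "\<dots> = (\<integral>\<^sup>+w. ennreal (X w powr real a * Y w powr (real a * (real n / real m) + of_int b)) \<partial>\<mu>)"
    by (subst nn_integral_norm_mon) auto
  also have "\<dots> = ennreal (pi\<^sup>2 / ((real a + 1) * (real n / real m + (real a * (real n / real m) + of_int b) + 1)))"
    by (intro nn_integral_moment_finite gt) auto
  finally show ?thesis unfolding e by simp
qed

lemma L2_mon:
  assumes ab: "int n * int a + int m * b \<ge> - int k"
  shows "L2 (mon (int a) b)"
  unfolding L2_def
proof
  show "integrable \<mu> (\<lambda>w. (norm (mon (int a) b w))\<^sup>2)"
    by (rule integrableI_nonneg) (use mon_moment[OF ab] in auto)
qed measurable

text \<open>Averaging over the torus first reduces the kernel to its matching Fourier coefficient.
  What remains is the squared norm of the monomial, and its value cancels the factor in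
  \<open>kernel_fourier\<close>.\<close>

lemma T_mon:
  assumes ab: "int n * int a + int m * b \<ge> - int k" and z: "z \<in> \<Omega>"
  shows "T (mon (int a) b) z = mon (int a) b z"
proof -
  define D where "D = (real a + 1) * (real m * (of_int b + 1) + real n * (real a + 1))"
  have "- int (m + n) < int n * int a + int m * b" using ab k by linarith
  hence "real_of_int (- int (m + n)) < real_of_int (int n * int a + int m * b)"
    by (simp only: of_int_less_iff)
  hence "0 < real m * (of_int b + 1) + real n * (real a + 1)" by (simp add: algebra_simps)
  hence D: "D > 0" by (simp add: D_def)
  have "T (mon (int a) b) z = (\<integral>w. \<integral>t. K z (rt t w) * mon (int a) b (rt t w) \<partial>\<Q> \<partial>\<mu>)"
    unfolding T_def by (rule integral_Q_mean[OF K_integrable[OF z L2_mon[OF ab]]])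
  also have "\<dots> = (\<integral>w. of_real (D / (pi\<^sup>2 * real m)) * mon (int a) b z * of_real ((norm (mon (int a) b w))\<^sup>2) \<partial>\<mu>)"
  proof (intro Bochner_Integration.integral_cong refl)
    fix w assume "w \<in> space \<mu>" hence w: "w \<in> \<Omega>" by simp
    have "(\<integral>t. K z (rt t w) * mon (int a) b (rt t w) \<partial>\<Q>) = fourier (int a) b (orbit (K z) w) * mon (int a) b w"
      unfolding fourier_def integral_mult_left_zero[symmetric]
      by (intro Bochner_Integration.integral_cong refl) (simp add: mon_def power_int_mult_distrib power_mult_distrib mult_ac)
    also have "\<dots> = of_real (D / (pi\<^sup>2 * real m)) * mon (int a) b (fst z * cnj (fst w), snd z * cnj (snd w)) * mon (int a) b w"
      unfolding kernel_fourier[OF z w ab] D_def ..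
    also have "mon (int a) b (fst z * cnj (fst w), snd z * cnj (snd w)) = mon (int a) b z * cnj (mon (int a) b w)"
      by (simp add: mon_def power_int_mult_distrib power_mult_distrib)
    finally show "(\<integral>t. K z (rt t w) * mon (int a) b (rt t w) \<partial>\<Q>)
       = of_real (D / (pi\<^sup>2 * real m)) * mon (int a) b z * of_real ((norm (mon (int a) b w))\<^sup>2)"
      using complex_norm_square[of "mon (int a) b w"] by (simp add: mult_ac)
  qed
  also have "\<dots> = of_real (D / (pi\<^sup>2 * real m)) * mon (int a) b z * (\<integral>w. of_real ((norm (mon (int a) b w))\<^sup>2) \<partial>\<mu>)"
    by (rule integral_mult_right_zero)
  also have "(\<integral>w. complex_of_real ((norm (mon (int a) b w))\<^sup>2) \<partial>\<mu>) = of_real (\<integral>w. (norm (mon (int a) b w))\<^sup>2 \<partial>\<mu>)"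
    by (rule integral_complex_of_real)
  also have "(\<integral>w. (norm (mon (int a) b w))\<^sup>2 \<partial>\<mu>) = pi\<^sup>2 * real m / D"
    using mon_moment[OF ab] D unfolding D_def[symmetric] by (subst integral_eq_nn_integral) auto
  finally show ?thesis
    using D m by simp
qed

section \<open>Fourier coefficients of holomorphic functions\<close>

lemma continuous_on_orbit:
  assumes "continuous_on \<Omega> f" "w \<in> \<Omega>"
  shows "continuous_on torus (orbit f w)"
proof (rule continuous_on_compose2[OF assms(1)])
  show "continuous_on torus (\<lambda>c. rot (fst c) (snd c) w)"
    unfolding rot_def by (intro continuous_on_Pair continuous_on_mult continuous_on_fst continuous_on_snd continuous_on_id continuous_on_const)
qed (use assms in auto)

lemma holo_continuous_on: "(\<And>z. z \<in> \<Omega> \<Longrightarrow> holo2_at f z) \<Longrightarrow> continuous_on \<Omega> f"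
  by (intro continuous_at_imp_continuous_on ballI holo2_at_imp_isCont)

text \<open>
  The mean does not change when one radius moves at a time; points of different \<open>z2\<close> are joined through a
  common small \<open>z1\<close>.
\<close>

lemma torus_mean_independent:
  assumes F: "\<And>z. z \<in> \<Omega> \<Longrightarrow> fst z \<noteq> 0 \<Longrightarrow> holo2_at F z"
    and w: "w \<in> \<Omega>" "fst w \<noteq> 0" and w': "w' \<in> \<Omega>" "fst w' \<noteq> 0"
  shows "(\<integral>t. F (rt t w) \<partial>\<Q>) = (\<integral>t. F (rt t w') \<partial>\<Q>)"
proof -
  \<comment> \<open>The axis is removed because the functions in question are multiplied by inverse
    monomials and may have poles there.\<close>
  define \<Omega>' where "\<Omega>' = {z \<in> \<Omega>. fst z \<noteq> 0}"
  have o: "open \<Omega>'"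
  proof -
    have "\<Omega>' = \<Omega> \<inter> {z. fst z \<noteq> 0}" by (auto simp: \<Omega>'_def)
    thus ?thesis
      using open_\<Omega> by (simp add: open_Int open_Collect_neq continuous_on_fst)
  qed
  have F': "holo2_at F z" if "z \<in> \<Omega>'" for z using F that by (auto simp: \<Omega>'_def)
  have cF: "continuous_on \<Omega>' F"
    by (intro continuous_at_imp_continuous_on ballI holo2_at_imp_isCont F')
  have cont: "continuous_on unit_square (\<lambda>t. F (rt t (x, y)))" if "(x, y) \<in> \<Omega>'" for x y
  proof (rule continuous_on_torus_comp[where P="\<lambda>c. F (rot (fst c) (snd c) (x, y))"], rule continuous_on_compose2[OF cF])
    show "continuous_on torus (\<lambda>c. rot (fst c) (snd c) (x, y))"
      unfolding rot_def by (intro continuous_on_Pair continuous_on_mult continuous_on_fst continuous_on_snd continuous_on_id continuous_on_const)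
    show "(\<lambda>c. rot (fst c) (snd c) (x, y)) ` torus \<subseteq> \<Omega>'"
      using that by (auto simp: \<Omega>'_def)
  qed
  have in\<Omega>': "(x, y) \<in> \<Omega>' \<longleftrightarrow> x \<noteq> 0 \<and> norm x ^ m < norm y ^ n \<and> norm y < 1" for x y
    by (auto simp: \<Omega>'_def mem_\<Omega>_iff)
  have step1: "(\<integral>t. F (rt t (x, y)) \<partial>\<Q>) = (\<integral>t. F (rt t (x', y)) \<partial>\<Q>)" if x: "(x, y) \<in> \<Omega>'" "(x', y) \<in> \<Omega>'" for x x' y
    unfolding integral_Q_iterated(2)[OF cont[OF x(1)]] integral_Q_iterated(2)[OF cont[OF x(2)]]
  proof (rule Bochner_Integration.integral_cong[OF refl])
    fix \<theta>
    define y' where "y' = unit_circle \<theta> * y"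
    have ny: "norm y' = norm y" by (simp add: y'_def norm_mult)
    let ?S = "{\<zeta>. (\<zeta>, y') \<in> \<Omega>'}"
    have "open ?S"
      using open_vimage[OF o, of "\<lambda>\<zeta>. (\<zeta>, y')"] by (simp add: vimage_def continuous_on_Pair)
    moreover have "(\<lambda>\<zeta>. F (\<zeta>, y')) holomorphic_on ?S"
      by (rule holomorphic_onI, rule field_differentiable_at_within, rule holo2_slice(1), rule F') simp
    moreover have "\<zeta> \<in> ?S" if "min (norm x) (norm x') \<le> norm \<zeta>" "norm \<zeta> \<le> max (norm x) (norm x')" for \<zeta>
    proof -
      have "norm \<zeta> ^ m \<le> max (norm x ^ m) (norm x' ^ m)"
        using that(2) power_mono[of "norm \<zeta>" "norm x" m] power_mono[of "norm \<zeta>" "norm x'" m]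
        by (auto simp: max_def split: if_splits)
      hence "norm \<zeta> ^ m < norm y ^ n" using x by (auto simp: in\<Omega>')
      moreover have "\<zeta> \<noteq> 0" using that(1) x by (auto simp: in\<Omega>' min_def split: if_splits)
      ultimately show ?thesis using x by (simp add: in\<Omega>' ny)
    qed
    ultimately have "(\<integral>\<phi>. F (x * unit_circle \<phi>, y') \<partial>\<U>) = (\<integral>\<phi>. F (x' * unit_circle \<phi>, y') \<partial>\<U>)"
      using x by (intro circle_mean_radius) (auto simp: in\<Omega>')
    thus "(\<integral>\<phi>. F (rt (\<phi>, \<theta>) (x, y)) \<partial>\<U>) = (\<integral>\<phi>. F (rt (\<phi>, \<theta>) (x', y)) \<partial>\<U>)"
      by (simp add: rot_def y'_def mult.commute)
  qed
  have step2: "(\<integral>t. F (rt t (x, y)) \<partial>\<Q>) = (\<integral>t. F (rt t (x, y')) \<partial>\<Q>)" if x: "(x, y) \<in> \<Omega>'" "(x, y') \<in> \<Omega>'" for x y y'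
    unfolding integral_Q_iterated(1)[OF cont[OF x(1)]] integral_Q_iterated(1)[OF cont[OF x(2)]]
  proof (rule Bochner_Integration.integral_cong[OF refl])
    fix \<theta>
    define x' where "x' = unit_circle \<theta> * x"
    have nx: "norm x' = norm x" "x' \<noteq> 0" using x by (auto simp: x'_def norm_mult in\<Omega>')
    let ?S = "{\<zeta>. (x', \<zeta>) \<in> \<Omega>'}"
    have "open ?S"
      using open_vimage[OF o, of "\<lambda>\<zeta>. (x', \<zeta>)"] by (simp add: vimage_def continuous_on_Pair)
    moreover have "(\<lambda>\<zeta>. F (x', \<zeta>)) holomorphic_on ?S"
      by (rule holomorphic_onI, rule field_differentiable_at_within, rule holo2_slice(2), rule F') simp
    moreover have "\<zeta> \<in> ?S" if "min (norm y) (norm y') \<le> norm \<zeta>" "norm \<zeta> \<le> max (norm y) (norm y')" for \<zeta>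
    proof -
      have "min (norm y ^ n) (norm y' ^ n) \<le> norm \<zeta> ^ n"
        using that(1) power_mono[of "norm y" "norm \<zeta>" n] power_mono[of "norm y'" "norm \<zeta>" n]
        by (auto simp: min_def split: if_splits)
      hence "norm x ^ m < norm \<zeta> ^ n" using x by (auto simp: in\<Omega>')
      moreover have "norm \<zeta> < 1" using that(2) x by (auto simp: in\<Omega>')
      ultimately show ?thesis using nx by (simp add: in\<Omega>')
    qed
    ultimately have "(\<integral>\<phi>. F (x', y * unit_circle \<phi>) \<partial>\<U>) = (\<integral>\<phi>. F (x', y' * unit_circle \<phi>) \<partial>\<U>)"
      using x n by (intro circle_mean_radius[where S="?S"]) (auto simp: in\<Omega>' zero_power)
    thus "(\<integral>\<phi>. F (rt (\<theta>, \<phi>) (x, y)) \<partial>\<U>) = (\<integral>\<phi>. F (rt (\<theta>, \<phi>) (x, y')) \<partial>\<U>)"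
      by (simp add: rot_def x'_def mult.commute)
  qed
  obtain x y x' y' where xy: "w = (x, y)" "w' = (x', y')" by (cases w, cases w')
  have i: "(x, y) \<in> \<Omega>'" "(x', y') \<in> \<Omega>'" using w w' xy by (auto simp: \<Omega>'_def)
  \<comment> \<open>Whichever first coordinate has the smaller modulus can be combined with either
    second coordinate without leaving the domain.\<close>
  define v where "v = (if norm x \<le> norm x' then x else x')"
  have "norm v ^ m \<le> norm x ^ m" "norm v ^ m \<le> norm x' ^ m"
    by (intro power_mono; simp add: v_def)+
  hence v: "(v, y) \<in> \<Omega>'" "(v, y') \<in> \<Omega>'"
    using i by (auto simp: in\<Omega>' v_def)
  have "(\<integral>t. F (rt t (x, y)) \<partial>\<Q>) = (\<integral>t. F (rt t (v, y)) \<partial>\<Q>)" by (rule step1[OF i(1) v(1)])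
  also have "\<dots> = (\<integral>t. F (rt t (v, y')) \<partial>\<Q>)" by (rule step2[OF v])
  also have "\<dots> = (\<integral>t. F (rt t (x', y')) \<partial>\<Q>)" by (rule step1[OF v(2) i(2)])
  finally show ?thesis by (simp add: xy)
qed

text \<open>Divided by the monomial, the coefficient is the torus mean of \<open>f\<close> times the
  inverse monomial. That product is holomorphic off the axis, so its mean is the same for all
  orbits.\<close>

lemma fourier_holo:
  assumes f: "\<And>z. z \<in> \<Omega> \<Longrightarrow> holo2_at f z"
  shows "\<exists>M. \<forall>w\<in>\<Omega>. fst w \<noteq> 0 \<longrightarrow> fourier (-a) (-b) (orbit f w) = mon a b w * M"
proof -
  define F where "F = (\<lambda>w. f w * mon (-a) (-b) w)"
  have F: "holo2_at F z" if "z \<in> \<Omega>" "fst z \<noteq> 0" for z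
    unfolding F_def using that snd_nonzero by (intro holo2_mult f holo2_mon) auto
  have eq: "fourier (-a) (-b) (orbit f w) = mon a b w * (\<integral>t. F (rt t w) \<partial>\<Q>)"
    if w: "w \<in> \<Omega>" "fst w \<noteq> 0" for w
  proof -
    have ne: "mon a b w \<noteq> 0" using w snd_nonzero[OF w(1)] by (simp add: mon_def)
    have "f (rt t w) * (fst (tor t) powi (-a) * snd (tor t) powi (-b)) = mon a b w * F (rt t w)" for t
    proof -
      have "mon (-a) (-b) (rt t w) = mon (-a) (-b) (tor t) * mon (-a) (-b) w"
        using mon_mult[of "-a" "-b" "fst (tor t)" "fst w" "snd (tor t)" "snd w"] by (simp add: rot_def tor_def)
      thus ?thesis
        using ne by (simp add: F_def mon_minus[of a b w] mon_def[of _ _ "tor t"])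
    qed
    thus ?thesis unfolding fourier_def by (simp only: integral_mult_right_zero)
  qed
  show ?thesis
  proof (cases "\<exists>w0\<in>\<Omega>. fst w0 \<noteq> 0")
    case True
    then obtain w0 where "w0 \<in> \<Omega>" "fst w0 \<noteq> 0" by blast
    from torus_mean_independent[OF F _ _ this] eq show ?thesis
      by (intro exI[of _ "\<integral>t. F (rt t w0) \<partial>\<Q>"]) auto
  qed auto
qed

text \<open>For a fixed second coordinate the slice of the domain is a full disc about 0, where
  \<open>f\<close> is holomorphic. Multiplication by the positive power \<open>- a\<close> of the
  disc variable makes the value at the centre, hence the mean, zero.\<close>

lemma fourier_holo_negative:
  assumes f: "\<And>z. z \<in> \<Omega> \<Longrightarrow> holo2_at f z" and w: "w \<in> \<Omega>" and a: "a < 0"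
  shows "fourier (-a) b (orbit f w) = 0"
proof -
  have cont: "continuous_on unit_square (\<lambda>t. f (rt t w) * (fst (tor t) powi (-a) * snd (tor t) powi b))"
    by (rule continuous_on_torus_comp[where P="\<lambda>c. f (rot (fst c) (snd c) w) * (fst c powi (-a) * snd c powi b)"])
      (intro continuous_on_mult[OF _ continuous_on_powi_torus] continuous_on_orbit holo_continuous_on f w)
  have inner: "(\<integral>x. f (rt (x, y) w) * (fst (tor (x, y)) powi (-a) * snd (tor (x, y)) powi b) \<partial>\<U>) = 0" for y
  proof -
    define y' where "y' = unit_circle y * snd w"
    define g where "g = (\<lambda>\<zeta>. f (\<zeta> * fst w, y') * \<zeta> ^ nat (-a))"
    have "g holomorphic_on cball 0 1"
      unfolding g_def
    proof (intro holomorphic_on_mult holomorphic_on_power holomorphic_on_ident)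
      show "(\<lambda>\<zeta>. f (\<zeta> * fst w, y')) holomorphic_on cball 0 1"
      proof (rule holomorphic_onI, rule field_differentiable_at_within)
        fix \<zeta> assume "\<zeta> \<in> cball (0::complex) 1"
        hence "(norm \<zeta> * norm (fst w)) ^ m \<le> norm (fst w) ^ m"
          by (intro power_mono mult_left_le_one_le) auto
        hence "(\<zeta> * fst w, y') \<in> \<Omega>"
          using w by (simp add: mem_\<Omega>_iff norm_mult y'_def)
        from holo2_slice(1)[OF f[OF this]]
        have "(\<lambda>x. f (x, y')) field_differentiable at (\<zeta> * fst w)" .
        moreover have "(\<lambda>\<zeta>. \<zeta> * fst w) field_differentiable at \<zeta>"
          by (intro field_differentiable_mult field_differentiable_ident field_differentiable_const)
        ultimately show "(\<lambda>\<zeta>. f (\<zeta> * fst w, y')) field_differentiable at \<zeta>"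
          using field_differentiable_compose[of "\<lambda>\<zeta>. \<zeta> * fst w" \<zeta> "\<lambda>x. f (x, y')"] by (simp add: o_def)
      qed
    qed
    from circle_mean_value[OF this] have g0: "(\<integral>x. g (unit_circle x) \<partial>\<U>) = 0"
      using a by (simp add: has_bochner_integral_iff g_def zero_power)
    have eqx: "f (rt (x, y) w) * (fst (tor (x, y)) powi (-a) * snd (tor (x, y)) powi b) = g (unit_circle x) * unit_circle y powi b" for x
    proof -
      have "unit_circle x powi (-a) = unit_circle x ^ nat (-a)" using a by (simp add: power_int_def)
      thus ?thesis by (simp add: g_def y'_def rot_def mult_ac)
    qed
    show ?thesis unfolding eqx integral_mult_left_zero g0 by simp
  qed
  show ?thesis
    unfolding fourier_def integral_Q_iterated(2)[OF cont] inner by simp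
qed

text \<open>Jensen's inequality for a measure of total mass 1, obtained from Hoelder's inequality
  against the constant 1.\<close>

lemma norm_fourier_powr:
  assumes f: "continuous_on torus P" and p: "p > 1"
  shows "ennreal (norm (fourier a b P) powr p) \<le> (\<integral>\<^sup>+t. ennreal (norm (P (tor t)) powr p) \<partial>\<Q>)"
proof -
  define q where "q = p / (p - 1)"
  have pq: "p > 1" "q > 1" "1 / p + 1 / q = 1"
    using p by (auto simp: q_def field_simps)
  have c: "continuous_on UNIV (\<lambda>t. P (tor t))" by (rule continuous_on_torus_comp[OF f])
  have [measurable]: "(\<lambda>t. P (tor t)) \<in> borel_measurable \<Q>"
    by (intro measurable_restrict_space1) (use borel_measurable_continuous_onI[OF c] in simp)
  have "continuous_on unit_square (\<lambda>t. norm (P (tor t)) powr p)"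
    using p by (intro continuous_on_powr' continuous_on_norm continuous_on_torus_comp f continuous_on_const) auto
  hence "integrable \<Q> (\<lambda>t. norm (P (tor t)) powr p)" by (rule integrable_Q)
  note int = this
  define A where "A = (\<integral>t. norm (P (tor t)) powr p \<partial>\<Q>)"
  have A: "A \<ge> 0" "(\<integral>\<^sup>+t. ennreal (norm (P (tor t)) powr p) \<partial>\<Q>) = ennreal A"
    unfolding A_def using nn_integral_eq_integral[OF int] by (auto intro: Bochner_Integration.integral_nonneg)
  have "ennreal (norm (fourier a b P)) \<le> (\<integral>\<^sup>+t. ennreal (norm (P (tor t) * (fst (tor t) powi a * snd (tor t) powi b))) \<partial>\<Q>)"
    unfolding fourier_def by (rule integral_norm_bound_ennreal[OF integrable_fourier[OF f]])
  also have "\<dots> = (\<integral>\<^sup>+t. ennreal (norm (P (tor t)) * 1) \<partial>\<Q>)"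
    by (intro nn_integral_cong) (simp add: norm_mult norm_power_int)
  also have "\<dots> \<le> ennreal (A powr (1 / p) * 1 powr (1 / q))"
    by (rule nn_integral_Holder[OF pq]) (use A in auto)
  finally have "norm (fourier a b P) \<le> A powr (1 / p)" by simp
  hence "norm (fourier a b P) powr p \<le> (A powr (1 / p)) powr p"
    using p by (intro powr_mono2) auto
  also have "\<dots> = A" using A p by (simp add: powr_powr)
  finally show ?thesis unfolding A(2) by (rule ennreal_leI)
qed

text \<open>
  If the coefficient did not vanish, the monomial would be in \<open>L^p\<close>, as \<open>|.|^p\<close> of a mean is at most the
  mean of \<open>|.|^p\<close>.
\<close>

lemma fourier_holo_vanish:
  assumes f: "\<And>z. z \<in> \<Omega> \<Longrightarrow> holo2_at f z" and fm: "f \<in> borel_measurable \<mu>"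
    and p: "p > 1" and fin: "(\<integral>\<^sup>+w. ennreal (norm (f w) powr p) \<partial>\<mu>) < \<infinity>"
    and a: "a \<ge> 0" and ab: "p * (real n * of_int a + real m * of_int b) \<le> - 2 * real (m + n)"
    and w: "w \<in> \<Omega>" "fst w \<noteq> 0"
  shows "fourier (-a) (-b) (orbit f w) = 0"
proof -
  note [measurable] = fm
  obtain M where M: "\<And>w. w \<in> \<Omega> \<Longrightarrow> fst w \<noteq> 0 \<Longrightarrow> fourier (-a) (-b) (orbit f w) = mon a b w * M"
    using fourier_holo[of f a b, OF f] by blast
  have "M = 0"
  proof (rule ccontr)
    assume M0: "M \<noteq> 0"
    have "(\<integral>\<^sup>+w. ennreal (norm (mon a b w) powr p) * ennreal (norm M powr p) \<partial>\<mu>) \<le> (\<integral>\<^sup>+w. \<integral>\<^sup>+t. ennreal (norm (f (rt t w)) powr p) \<partial>\<Q> \<partial>\<mu>)"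
    proof (rule nn_integral_mono_AE)
      show "AE w in \<mu>. ennreal (norm (mon a b w) powr p) * ennreal (norm M powr p) \<le> (\<integral>\<^sup>+t. ennreal (norm (f (rt t w)) powr p) \<partial>\<Q>)"
        using AE_fst_nonzero AE_space
      proof eventually_elim
        case (elim w)
        hence w: "w \<in> \<Omega>" by simp
        have "ennreal (norm (mon a b w) powr p) * ennreal (norm M powr p) = ennreal (norm (fourier (-a) (-b) (orbit f w)) powr p)"
          unfolding M[OF w elim(1)] by (simp add: norm_mult powr_mult ennreal_mult')
        also have "\<dots> \<le> (\<integral>\<^sup>+t. ennreal (norm (f (rt t w)) powr p) \<partial>\<Q>)"
          by (rule norm_fourier_powr[OF continuous_on_orbit[OF holo_continuous_on[OF f] w] p])
        finally show ?case .
      qed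
    qed
    also have "\<dots> = (\<integral>\<^sup>+w. ennreal (norm (f w) powr p) \<partial>\<mu>)"
      by (rule nn_integral_Q_rot[where g="\<lambda>w. ennreal (norm (f w) powr p)"]) measurable
    also note fin
    also have "(\<integral>\<^sup>+w. ennreal (norm (mon a b w) powr p) * ennreal (norm M powr p) \<partial>\<mu>) = (\<integral>\<^sup>+w. ennreal (norm (mon a b w) powr p) \<partial>\<mu>) * ennreal (norm M powr p)"
      by (rule nn_integral_multc) measurable
    also have "(\<integral>\<^sup>+w. ennreal (norm (mon a b w) powr p) \<partial>\<mu>) = \<infinity>"
    proof -
      \<comment> \<open>The borderline exponent -1 still diverges, which matches the non-strict
        inequality in \<open>ab\<close>.\<close>
      have "real m * (real n / real m + p / 2 * (of_int a * (real n / real m) + of_int b)) = real n + p * (real n * of_int a + real m * of_int b) / 2"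
        using m by (simp add: field_simps)
      also have "\<dots> \<le> real m * (-1)" using ab by simp
      finally have "real n / real m + p / 2 * (of_int a * (real n / real m) + of_int b) \<le> -1"
        by (subst (asm) mult_le_cancel_left_pos) (use m in auto)
      moreover have "p * of_int a / 2 \<ge> 0" using a p by simp
      hence "p * of_int a / 2 > -1" by linarith
      moreover have "p > 0" using p by simp
      ultimately show ?thesis
        unfolding nn_integral_norm_mon[OF a \<open>p > 0\<close>] by (intro nn_integral_moment_infinite)
    qed
    finally show False using M0 by (simp add: ennreal_top_mult)
  qed
  thus ?thesis using M[OF w] by simp
qed

section \<open>The operator fixes A^p\<close>

theorem T_reproducing:
  assumes f: "\<And>z. z \<in> \<Omega> \<Longrightarrow> holo2_at f z" and fL: "L2 f"
    and p: "p > 1" and fin: "(\<integral>\<^sup>+w. ennreal (norm (f w) powr p) \<partial>\<mu>) < \<infinity>"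
    and kp: "2 * real (m + n) \<le> (real k + 1) * p"
    and z: "z \<in> \<Omega>"
  shows "T f z = f z"
proof -
  have fm: "f \<in> borel_measurable \<mu>" using fL by (simp add: L2_def)
  have vanish: "fourier (-a) (-b) (orbit f w) = 0"
    if ab: "a \<ge> 0" "int n * a + int m * b < - int k" and w: "w \<in> \<Omega>" "fst w \<noteq> 0" for a b w
  proof (rule fourier_holo_vanish[OF f fm p fin ab(1) _ w])
    \<comment> \<open>Integrality gains one unit, and this is where the maximality of
      \<open>k\<close>, in the form of \<open>kp\<close>, excludes the monomial from L^p.\<close>
    have "int n * a + int m * b \<le> - (int k + 1)" using ab by simp
    hence "real_of_int (int n * a + int m * b) \<le> real_of_int (- (int k + 1))" by (simp only: of_int_le_iff)
    hence "p * (real n * of_int a + real m * of_int b) \<le> p * (- (real k + 1))"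
      using p by (intro mult_left_mono) auto
    thus "p * (real n * of_int a + real m * of_int b) \<le> - 2 * real (m + n)"
      using kp by (simp add: algebra_simps)
  qed auto
  have main: "T f z = f z" if z: "z \<in> \<Omega>" and z1: "fst z \<noteq> 0" for z
  proof -
    define P where "P = (\<lambda>c. T f (rot (fst c) (snd c) z) - f (rot (fst c) (snd c) z))"
    have cT: "continuous_on torus (orbit (T f) z)"
      by (intro continuous_on_orbit holo_continuous_on T_holo2 fL z)
    have cf: "continuous_on torus (orbit f z)"
      by (intro continuous_on_orbit holo_continuous_on f z)
    have eq: "fourier (-a) (-b) (orbit (T f) z) = fourier (-a) (-b) (orbit f z)" for a b
    proof -
      have T: "fourier (-a) (-b) (orbit (T f) z) = (\<integral>w. K z w * fourier (-a) (-b) (orbit f w) \<partial>\<mu>)"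
        by (rule fourier_T[OF fL z])
      obtain M where M: "\<And>w. w \<in> \<Omega> \<Longrightarrow> fst w \<noteq> 0 \<Longrightarrow> fourier (-a) (-b) (orbit f w) = mon a b w * M"
        using fourier_holo[of f a b, OF f] by blast
      have "(\<integral>w. K z w * fourier (-a) (-b) (orbit f w) \<partial>\<mu>) = mon a b z * M"
      proof (cases "a \<ge> 0 \<and> int n * a + int m * b \<ge> - int k")
        case False
        \<comment> \<open>Either the first exponent is negative, excluded by holomorphy across the
          axis, or the monomial is below the threshold, excluded by integrability. Both sides then
          vanish.\<close>
        have zero: "fourier (-a) (-b) (orbit f w) = 0" if "w \<in> \<Omega>" "fst w \<noteq> 0" for w
          using fourier_holo_negative[OF f that(1), of a "-b"] vanish[of a b, OF _ _ that] False by linarith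
        have "(\<integral>w. K z w * fourier (-a) (-b) (orbit f w) \<partial>\<mu>) = 0"
          by (rule integral_eq_zero_AE) (use AE_fst_nonzero AE_space in eventually_elim, simp add: zero)
        thus ?thesis using zero[OF z z1] M[OF z z1] by simp
      next
        case True
        have "(\<integral>w. K z w * fourier (-a) (-b) (orbit f w) \<partial>\<mu>) = (\<integral>w. K z w * mon a b w * M \<partial>\<mu>)"
        proof (cases "M = 0")
          case True
          have "(\<integral>w. K z w * fourier (-a) (-b) (orbit f w) \<partial>\<mu>) = 0"
            by (rule integral_eq_zero_AE) (use AE_fst_nonzero AE_space in eventually_elim, simp add: M True)
          thus ?thesis using True by simp
        next
          case False
          have ae: "AE w in \<mu>. K z w * fourier (-a) (-b) (orbit f w) = K z w * mon a b w * M"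
            using AE_fst_nonzero AE_space by eventually_elim (simp add: M)
          show ?thesis
          proof (rule integral_cong_AE[OF _ _ ae])
            have [measurable]: "fst \<in> borel_measurable (\<Q> \<Otimes>\<^sub>M \<mu>)" "snd \<in> borel_measurable (\<Q> \<Otimes>\<^sub>M \<mu>)"
              by (rule measurable_fst_restrict_lborel)+
            interpret Q: sigma_finite_measure \<Q> by (rule sigma_finite_Q)
            have "continuous_on UNIV (\<lambda>t. fst (tor t) powi (-a) * snd (tor t) powi (-b))"
              by (rule continuous_on_torus_comp[OF continuous_on_powi_torus])
            hence em: "(\<lambda>t. fst (tor t) powi (-a) * snd (tor t) powi (-b)) \<in> borel_measurable \<Q>"
              by (intro measurable_restrict_space1) (simp add: borel_measurable_continuous_onI)
            have sw: "(\<lambda>x. (snd x, fst x)) \<in> \<mu> \<Otimes>\<^sub>M \<Q> \<rightarrow>\<^sub>M \<Q> \<Otimes>\<^sub>M \<mu>" by measurable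
            have "(\<lambda>x. f (rt (snd x) (fst x)) * (fst (tor (snd x)) powi (-a) * snd (tor (snd x)) powi (-b))) \<in> borel_measurable (\<mu> \<Otimes>\<^sub>M \<Q>)"
              using borel_measurable_times[OF measurable_compose[OF sw measurable_compose[OF measurable_rt fm]] measurable_compose[OF measurable_snd em]]
              by (simp only: fst_conv snd_conv)
            hence "(\<lambda>w. fourier (-a) (-b) (orbit f w)) \<in> borel_measurable \<mu>"
              unfolding fourier_def by (intro Q.borel_measurable_lebesgue_integral) (simp add: case_prod_unfold)
            thus "(\<lambda>w. K z w * fourier (-a) (-b) (orbit f w)) \<in> borel_measurable \<mu>"
              by measurable
          qed measurable
        qed
        also have "\<dots> = T (mon a b) z * M" unfolding T_def by (rule integral_mult_left_zero)
        also have "T (mon a b) z = mon a b z"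
          using T_mon[of "nat a" b z] True z by simp
        finally show ?thesis .
      qed
      thus ?thesis unfolding T M[OF z z1] .
    qed
    have "null_fourier P"
      unfolding null_fourier_def
    proof safe
      show "continuous_on torus P" unfolding P_def by (intro continuous_on_diff cT cf)
      fix a b
      have "fourier a b P = fourier a b (orbit (T f) z) - fourier a b (orbit f z)"
        unfolding fourier_def P_def left_diff_distrib
        using integrable_fourier[OF cT] integrable_fourier[OF cf] by (intro Bochner_Integration.integral_diff) auto
      thus "fourier a b P = 0" using eq[of "-a" "-b"] by simp
    qed
    from null_fourier_imp_zero[OF this, of "(1, 1)"] show ?thesis
      by (simp add: P_def rot_def)
  qed
  show ?thesis
  proof (cases "fst z = 0")
    case False
    thus ?thesis using main z by blast
  next
    case True
    \<comment> \<open>Points on the axis are reached by continuity along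
      \<open>z + (1 / (j + 1), 0)\<close>, since the Fourier argument only works off the
      axis.\<close>
    define D where "D = (\<lambda>w. T f w - f w)"
    have "isCont D z"
      unfolding D_def by (intro holo2_at_imp_isCont holo2_diff T_holo2 fL f z)
    moreover have lim: "(\<lambda>j. z + (1 / of_nat (Suc j), 0)) \<longlonglongrightarrow> z + (0, 0)"
      using lim_1_over_n[where 'a=complex, THEN LIMSEQ_Suc] by (intro tendsto_intros) auto
    ultimately have "(\<lambda>j. D (z + (1 / of_nat (Suc j), 0))) \<longlonglongrightarrow> D z"
      using isCont_tendsto_compose pair_add_zero by metis
    moreover have "\<forall>\<^sub>F j in sequentially. D (z + (1 / of_nat (Suc j), 0)) = 0"
    proof -
      have "\<forall>\<^sub>F j in sequentially. z + (1 / of_nat (Suc j), 0) \<in> \<Omega>"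
        using topological_tendstoD[OF lim open_\<Omega>] z by (simp add: pair_add_zero)
      thus ?thesis
      proof eventually_elim
        case (elim j)
        have "fst (z + (1 / of_nat (Suc j), 0)) \<noteq> 0" using True by (simp del: of_nat_Suc)
        thus ?case using main[OF elim] by (simp add: D_def)
      qed
    qed
    hence "(\<lambda>j. D (z + (1 / of_nat (Suc j), 0))) \<longlonglongrightarrow> 0"
      by (rule tendsto_eventually)
    ultimately have "D z = 0" by (rule LIMSEQ_unique)
    thus ?thesis by (simp add: D_def)
  qed
qed

end

section \<open>Best approximation\<close>

lemma completion_ex_borel_measurable_complex:
  fixes f :: "'a \<Rightarrow> complex"
  assumes f: "f \<in> borel_measurable (completion M)"
  shows "\<exists>g\<in>borel_measurable M. AE x in M. f x = g x"
proof -
  have "(\<lambda>x. Re (f x)) \<in> borel_measurable (completion M)" "(\<lambda>x. Im (f x)) \<in> borel_measurable (completion M)"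
    using f by (auto intro: borel_measurable_Re borel_measurable_Im)
  from this[THEN completion_ex_borel_measurable_real]
  obtain r i where ri: "r \<in> borel_measurable M" "AE x in M. Re (f x) = r x"
    "i \<in> borel_measurable M" "AE x in M. Im (f x) = i x"
    by blast
  show ?thesis
  proof
    show "(\<lambda>x. Complex (r x) (i x)) \<in> borel_measurable M"
      unfolding Complex_eq using ri(1,3) by measurable
    show "AE x in M. f x = Complex (r x) (i x)"
      using ri(2,4) by eventually_elim (simp add: complex_eq_iff)
  qed
qed

context hartogs
begin

abbreviation LB :: "(complex \<times> complex) measure" where
  "LB \<equiv> lebesgue_on \<Omega>"

lemma indicator_measurable:
  fixes h :: "complex \<times> complex \<Rightarrow> 'b::{banach, second_countable_topology}"
  assumes "h \<in> borel_measurable \<mu>"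
  shows "(\<lambda>x. indicator \<Omega> x *\<^sub>R h x) \<in> borel_measurable lborel"
  using assms by (subst (asm) borel_measurable_restrict_space_iff) auto

lemma measurable_LB:
  fixes h :: "complex \<times> complex \<Rightarrow> 'b::{banach, second_countable_topology}"
  assumes "h \<in> borel_measurable \<mu>"
  shows "h \<in> borel_measurable LB"
  using measurable_completion[OF indicator_measurable[OF assms]]
  by (subst borel_measurable_restrict_space_iff) auto

lemma integral_LB:
  fixes h :: "complex \<times> complex \<Rightarrow> 'b::{banach, second_countable_topology}"
  assumes "h \<in> borel_measurable \<mu>"
  shows "integral\<^sup>L LB h = integral\<^sup>L \<mu> h"
  using integral_completion[OF indicator_measurable[OF assms]]
  by (simp add: integral_restrict_space)

lemma integrable_LB:
  fixes h :: "complex \<times> complex \<Rightarrow> 'b::{banach, second_countable_topology}"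
  assumes "h \<in> borel_measurable \<mu>"
  shows "integrable LB h \<longleftrightarrow> integrable \<mu> h"
  using integrable_completion[OF indicator_measurable[OF assms]]
  by (simp add: integrable_restrict_space)

lemma borel_representative:
  assumes f: "f \<in> borel_measurable LB"
  shows "\<exists>g. g \<in> borel_measurable \<mu> \<and> (AE x in LB. f x = (g x :: complex))"
proof -
  have "(\<lambda>x. indicator \<Omega> x *\<^sub>R f x) \<in> borel_measurable lebesgue"
    using f by (subst (asm) borel_measurable_restrict_space_iff) auto
  then obtain g where g: "g \<in> borel_measurable lborel" "AE x in lborel. indicator \<Omega> x *\<^sub>R f x = g x"
    using completion_ex_borel_measurable_complex by blast
  have "AE x in lebesgue. indicator \<Omega> x *\<^sub>R f x = g x" by (rule AE_completion[OF g(2)])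
  hence "AE x in LB. f x = g x"
    by (subst AE_restrict_space_iff) (auto elim: eventually_mono)
  moreover have "g \<in> borel_measurable \<mu>" using g(1) by (intro measurable_\<mu>) simp
  ultimately show ?thesis by blast
qed

definition rep :: "(complex \<times> complex \<Rightarrow> complex) \<Rightarrow> (complex \<times> complex \<Rightarrow> complex) \<Rightarrow> bool" where
  "rep f g \<longleftrightarrow> g \<in> borel_measurable \<mu> \<and> (AE x in LB. f x = g x)"

lemma ex_rep: "f \<in> Lp_space p \<Omega> \<Longrightarrow> \<exists>g. rep f g"
  using borel_representative by (auto simp: Lp_space_def rep_def)

text \<open>\<open>h\<close> has to preserve measurability for every \<open>N\<close> because it is
  used on \<open>\<mu>\<close> and on the restriction of the completed measure; the condition on
  \<open>id\<close> accounts for its direct dependence on the point.\<close>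

lemma rep_integral:
  fixes h :: "complex \<times> complex \<Rightarrow> complex \<Rightarrow> 'b::{banach, second_countable_topology}"
  assumes r: "rep f g" and f: "f \<in> borel_measurable LB"
    and h: "\<And>N u. u \<in> borel_measurable N \<Longrightarrow> id \<in> borel_measurable N \<Longrightarrow> (\<lambda>w. h w (u w)) \<in> borel_measurable N"
  shows "integral\<^sup>L LB (\<lambda>w. h w (f w)) = integral\<^sup>L \<mu> (\<lambda>w. h w (g w))"
    and "integrable LB (\<lambda>w. h w (f w)) \<longleftrightarrow> integrable \<mu> (\<lambda>w. h w (g w))"
proof -
  have g: "g \<in> borel_measurable \<mu>" and ae: "AE x in LB. f x = g x"
    using r by (auto simp: rep_def)
  have id: "id \<in> borel_measurable \<mu>" unfolding id_def by (rule measurable_restrict_lborel_id)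
  have hg: "(\<lambda>w. h w (g w)) \<in> borel_measurable \<mu>" by (rule h[OF g id])
  have hf: "(\<lambda>w. h w (f w)) \<in> borel_measurable LB" by (rule h[OF f measurable_LB[OF id]])
  have aeh: "AE w in LB. h w (f w) = h w (g w)" using ae by eventually_elim simp
  show "integral\<^sup>L LB (\<lambda>w. h w (f w)) = integral\<^sup>L \<mu> (\<lambda>w. h w (g w))"
    using integral_cong_AE[OF hf measurable_LB[OF hg] aeh] integral_LB[OF hg] by simp
  show "integrable LB (\<lambda>w. h w (f w)) \<longleftrightarrow> integrable \<mu> (\<lambda>w. h w (g w))"
    using integrable_cong_AE[OF hf measurable_LB[OF hg] aeh] integrable_LB[OF hg] by simp
qed

lemma rep_powr:
  assumes f: "f \<in> borel_measurable LB" and r: "rep f g"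
  shows "f \<in> Lp_space p \<Omega> \<longleftrightarrow> integrable \<mu> (\<lambda>w. norm (g w) powr p)"
    and "Lp_norm p \<Omega> f = (\<integral>w. norm (g w) powr p \<partial>\<mu>) powr (1 / p)"
  using rep_integral[OF r f, of "\<lambda>w u. norm u powr p"] f
  by (auto simp: Lp_space_def Lp_norm_def)

lemma rep_self: "f \<in> borel_measurable \<mu> \<Longrightarrow> rep f f"
  by (simp add: rep_def)

section \<open>Square integrable functions and the absolute operator\<close>

lemma finite_measure_\<mu>: "finite_measure \<mu>"
proof (rule finite_measureI)
  have "\<Omega> \<subseteq> cball 0 2"
  proof
    fix z assume z: "z \<in> \<Omega>"
    have "norm (snd z) ^ n \<le> 1" using z by (intro power_le_one) (auto simp: mem_\<Omega>_iff)
    hence "norm (fst z) ^ m < 1" using z by (auto simp: mem_\<Omega>_iff)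
    hence "norm (fst z) < 1" using one_le_power[of "norm (fst z)" m] by linarith
    moreover have "norm z \<le> norm (fst z) + norm (snd z)" using norm_Pair_le[of "fst z" "snd z"] by simp
    ultimately show "z \<in> cball 0 2" using z by (simp add: mem_\<Omega>_iff)
  qed
  hence "emeasure lborel \<Omega> \<le> emeasure lborel (cball (0 :: complex \<times> complex) 2)"
    by (intro emeasure_mono) auto
  also have "\<dots> < \<infinity>" by (intro emeasure_bounded_finite) simp
  finally show "emeasure \<mu> (space \<mu>) \<noteq> \<infinity>" by (simp add: emeasure_restrict_space)
qed

text \<open>Pointwise \<open>|g|^2 \<le> 1 + |g|^p\<close> for \<open>p \<ge> 2\<close>, and
  constants are integrable because the domain has finite measure. This is how L^p inputs become
  arguments of the L^2 theory.\<close>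

lemma integrable_powr_imp_L2:
  assumes p: "p \<ge> 2" and g: "g \<in> borel_measurable \<mu>" "integrable \<mu> (\<lambda>w. norm (g w) powr p)"
  shows "L2 g"
  unfolding L2_def
proof
  interpret finite_measure \<mu> by (rule finite_measure_\<mu>)
  show "integrable \<mu> (\<lambda>w. (norm (g w))\<^sup>2)"
  proof (rule Bochner_Integration.integrable_bound)
    show "integrable \<mu> (\<lambda>w. 1 + norm (g w) powr p)"
      using g(2) by (intro Bochner_Integration.integrable_add) auto
    show "(\<lambda>w. (norm (g w))\<^sup>2) \<in> borel_measurable \<mu>" using g(1) by measurable
    have "(norm (g w))\<^sup>2 \<le> 1 + norm (g w) powr p" for w
    proof (cases "norm (g w) \<le> 1")
      case True
      hence "(norm (g w))\<^sup>2 \<le> 1" by (simp add: power_le_one)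
      thus ?thesis by (simp add: add_increasing2)
    next
      case False
      have "(norm (g w))\<^sup>2 = norm (g w) powr 2" by simp
      also have "\<dots> \<le> norm (g w) powr p" using False p by (intro powr_mono) auto
      finally show ?thesis by simp
    qed
    thus "AE w in \<mu>. norm ((norm (g w))\<^sup>2) \<le> norm (1 + norm (g w) powr p)"
      by (intro AE_I2) (simp add: add_nonneg_nonneg)
  qed
qed (rule g(1))

lemma L2_integrable_product:
  assumes "L2 f" "L2 g"
  shows "integrable \<mu> (\<lambda>w. norm (f w) * norm (g w))"
proof (rule Bochner_Integration.integrable_bound)
  have [measurable]: "f \<in> borel_measurable \<mu>" "g \<in> borel_measurable \<mu>" using assms by (auto simp: L2_def)
  show "integrable \<mu> (\<lambda>w. (norm (f w))\<^sup>2 + (norm (g w))\<^sup>2)"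
    using assms by (auto simp: L2_def)
  show "(\<lambda>w. norm (f w) * norm (g w)) \<in> borel_measurable \<mu>" by measurable
  have "norm (f w) * norm (g w) \<le> (norm (f w))\<^sup>2 + (norm (g w))\<^sup>2" for w
  proof -
    have "0 \<le> norm (f w) * norm (g w)" by simp
    thus ?thesis using sum_squares_bound[of "norm (f w)" "norm (g w)"] by linarith
  qed
  thus "AE w in \<mu>. norm (norm (f w) * norm (g w)) \<le> norm ((norm (f w))\<^sup>2 + (norm (g w))\<^sup>2)"
    by (intro AE_I2) simp
qed

lemma L2_add:
  assumes "L2 f" "L2 g"
  shows "L2 (\<lambda>w. f w + g w)"
  unfolding L2_def
proof
  have [measurable]: "f \<in> borel_measurable \<mu>" "g \<in> borel_measurable \<mu>" using assms by (auto simp: L2_def)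
  show m: "(\<lambda>w. f w + g w) \<in> borel_measurable \<mu>" by measurable
  show "integrable \<mu> (\<lambda>w. (norm (f w + g w))\<^sup>2)"
  proof (rule Bochner_Integration.integrable_bound)
    show "integrable \<mu> (\<lambda>w. 2 * (norm (f w))\<^sup>2 + 2 * (norm (g w))\<^sup>2)"
      using assms by (auto simp: L2_def)
    show "(\<lambda>w. (norm (f w + g w))\<^sup>2) \<in> borel_measurable \<mu>" using m by measurable
    have "(norm (f w + g w))\<^sup>2 \<le> 2 * (norm (f w))\<^sup>2 + 2 * (norm (g w))\<^sup>2" for w
    proof -
      have "(norm (f w + g w))\<^sup>2 \<le> (norm (f w) + norm (g w))\<^sup>2"
        by (intro power_mono norm_triangle_ineq) auto
      also have "\<dots> \<le> 2 * (norm (f w))\<^sup>2 + 2 * (norm (g w))\<^sup>2"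
        using sum_squares_bound[of "norm (f w)" "norm (g w)"] by (simp add: power2_sum)
      finally show ?thesis .
    qed
    thus "AE w in \<mu>. norm ((norm (f w + g w))\<^sup>2) \<le> norm (2 * (norm (f w))\<^sup>2 + 2 * (norm (g w))\<^sup>2)"
      by (intro AE_I2) simp
  qed
qed

lemma L2_uminus: "L2 f \<Longrightarrow> L2 (\<lambda>w. - f w)"
  by (auto simp: L2_def)

lemma L2_diff: "L2 f \<Longrightarrow> L2 g \<Longrightarrow> L2 (\<lambda>w. f w - g w)"
  using L2_add[OF _ L2_uminus, of f g] by simp

lemma continuous_on_measurable_\<mu>:
  fixes f :: "complex \<times> complex \<Rightarrow> complex"
  assumes "continuous_on \<Omega> f"
  shows "f \<in> borel_measurable \<mu>"
proof -
  have "sets \<mu> = sets (restrict_space borel \<Omega>)"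
    by (simp add: sets_restrict_space)
  thus ?thesis
    using borel_measurable_continuous_on_restrict[OF assms] measurable_cong_sets[OF _ refl] by blast
qed

lemma T_measurable: "L2 g \<Longrightarrow> T g \<in> borel_measurable \<mu>"
  by (intro continuous_on_measurable_\<mu> holo_continuous_on T_holo2)

definition absT :: "(complex \<times> complex \<Rightarrow> complex) \<Rightarrow> complex \<times> complex \<Rightarrow> real" where
  "absT g z = (\<integral>w. norm (K z w) * norm (g w) \<partial>\<mu>)"

lemma abs_K_integrable: "z \<in> \<Omega> \<Longrightarrow> L2 g \<Longrightarrow> integrable \<mu> (\<lambda>w. norm (K z w) * norm (g w))"
  using integrable_norm[OF K_integrable] by (simp add: norm_mult)

lemma absT_nn: "z \<in> \<Omega> \<Longrightarrow> L2 g \<Longrightarrow> ennreal (absT g z) = (\<integral>\<^sup>+w. ennreal (norm (K z w) * norm (g w)) \<partial>\<mu>)"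
  unfolding absT_def by (rule nn_integral_eq_integral[symmetric]) (auto simp: abs_K_integrable)

lemma measurable_kernel_integral:
  fixes h :: "complex \<times> complex \<Rightarrow> complex \<times> complex \<Rightarrow> 'b::{banach, second_countable_topology}"
  assumes "(\<lambda>x. h (fst x) (snd x)) \<in> borel_measurable (\<mu> \<Otimes>\<^sub>M \<mu>)"
  shows "(\<lambda>z. \<integral>w. h z w \<partial>\<mu>) \<in> borel_measurable \<mu>"
proof -
  interpret mu: sigma_finite_measure \<mu> by (rule sigma_finite_\<mu>)
  show ?thesis
    using assms by (intro mu.borel_measurable_lebesgue_integral) (simp add: case_prod_unfold)
qed

lemma measurable_K_pair: "(\<lambda>x. K (fst x) (snd x)) \<in> borel_measurable (\<mu> \<Otimes>\<^sub>M \<mu>)"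
  by (rule measurable_K[OF measurable_fst_restrict_lborel])

lemma absT_measurable:
  assumes "L2 g"
  shows "absT g \<in> borel_measurable \<mu>"
proof -
  have g: "g \<in> borel_measurable \<mu>" using assms by (simp add: L2_def)
  note [measurable] = measurable_K_pair measurable_compose[OF measurable_snd g]
  show ?thesis
    unfolding absT_def[abs_def] by (rule measurable_kernel_integral) measurable
qed

text \<open>With \<open>u\<close> arbitrary below \<open>absT g\<close>, one statement covers
  \<open>absT g\<close> itself, the modulus of \<open>T g\<close>, and the modulus of the absolute
  kernel applied to a complex function.\<close>

lemma kernel_Lp_integrable:
  assumes p: "p \<ge> 2" and kp: "real k * p < 2 * real (m + n)"
  shows "\<exists>C>0. \<forall>g u. L2 g \<longrightarrow> integrable \<mu> (\<lambda>w. norm (g w) powr p) \<longrightarrow> u \<in> borel_measurable \<mu> \<longrightarrow>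
     (\<forall>z\<in>\<Omega>. 0 \<le> u z \<and> u z \<le> absT g z) \<longrightarrow>
     integrable \<mu> (\<lambda>z. u z powr p) \<and> (\<integral>z. u z powr p \<partial>\<mu>) \<le> C * (\<integral>w. norm (g w) powr p \<partial>\<mu>)"
proof -
  obtain C where C: "C > 0" "\<And>f u. f \<in> borel_measurable \<mu> \<Longrightarrow> (\<forall>z\<in>\<Omega>. 0 \<le> u z \<and> ennreal (u z) \<le> (\<integral>\<^sup>+w. ennreal (norm (K z w) * norm (f w :: complex)) \<partial>\<mu>))
     \<Longrightarrow> (\<integral>\<^sup>+z. ennreal (u z powr p) \<partial>\<mu>) \<le> ennreal C * (\<integral>\<^sup>+w. ennreal (norm (f w) powr p) \<partial>\<mu>)"
    using kernel_Lp_bound[OF p kp] by blast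
  have "integrable \<mu> (\<lambda>z. u z powr p) \<and> (\<integral>z. u z powr p \<partial>\<mu>) \<le> C * (\<integral>w. norm (g w) powr p \<partial>\<mu>)"
    if g: "L2 g" "integrable \<mu> (\<lambda>w. norm (g w) powr p)" and u [measurable]: "u \<in> borel_measurable \<mu>"
      and ub: "\<forall>z\<in>\<Omega>. 0 \<le> u z \<and> u z \<le> absT g z" for g u
  proof -
    have "(\<integral>\<^sup>+z. ennreal (u z powr p) \<partial>\<mu>) \<le> ennreal C * (\<integral>\<^sup>+w. ennreal (norm (g w) powr p) \<partial>\<mu>)"
      using g(1) ub by (intro C(2)) (auto simp: L2_def absT_nn[symmetric] intro!: ennreal_leI)
    also have "\<dots> = ennreal (C * (\<integral>w. norm (g w) powr p \<partial>\<mu>))"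
      using C(1) by (subst nn_integral_eq_integral[OF g(2)]) (auto simp: ennreal_mult')
    finally have b: "(\<integral>\<^sup>+z. ennreal (u z powr p) \<partial>\<mu>) \<le> ennreal (C * (\<integral>w. norm (g w) powr p \<partial>\<mu>))" .
    hence i: "integrable \<mu> (\<lambda>z. u z powr p)"
      by (intro integrableI_nonneg) (auto simp: le_less_trans)
    have "0 \<le> C * (\<integral>w. norm (g w) powr p \<partial>\<mu>)"
      using C(1) by (intro mult_nonneg_nonneg Bochner_Integration.integral_nonneg) auto
    thus ?thesis
      using b i by (subst (asm) nn_integral_eq_integral[OF i]) auto
  qed
  thus ?thesis using C(1) by blast
qed

lemma norm_T_le: "z \<in> \<Omega> \<Longrightarrow> L2 g \<Longrightarrow> norm (T g z) \<le> absT g z"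
  unfolding T_def absT_def using integral_norm_bound[of \<mu> "\<lambda>w. K z w * g w"] by (simp add: norm_mult)

lemma k_two: "real k * 2 < 2 * real (m + n)"
  using k by simp

lemma L2_powr_two: "L2 g \<Longrightarrow> integrable \<mu> (\<lambda>w. norm (g w) powr 2)"
  by (simp add: L2_def)

lemma absT_square_integrable: "L2 g \<Longrightarrow> integrable \<mu> (\<lambda>z. (absT g z)\<^sup>2)"
proof -
  assume g: "L2 g"
  have nn: "absT g z \<ge> 0" for z unfolding absT_def by (rule Bochner_Integration.integral_nonneg) simp
  have "integrable \<mu> (\<lambda>z. absT g z powr 2)"
    using kernel_Lp_integrable[OF order_refl k_two] g L2_powr_two[OF g] absT_measurable[OF g] nn by blast
  thus ?thesis using nn by simp
qed

lemma L2_T: "L2 g \<Longrightarrow> L2 (T g)"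
  unfolding L2_def
proof
  assume "g \<in> borel_measurable \<mu> \<and> integrable \<mu> (\<lambda>w. (norm (g w))\<^sup>2)"
  hence g: "L2 g" by (simp add: L2_def)
  show Tm: "T g \<in> borel_measurable \<mu>" by (rule T_measurable[OF g])
  show "integrable \<mu> (\<lambda>w. (norm (T g w))\<^sup>2)"
  proof (rule Bochner_Integration.integrable_bound[OF absT_square_integrable[OF g]])
    show "(\<lambda>w. (norm (T g w))\<^sup>2) \<in> borel_measurable \<mu>" using Tm by measurable
    show "AE w in \<mu>. norm ((norm (T g w))\<^sup>2) \<le> norm ((absT g w)\<^sup>2)"
      using norm_T_le[OF _ g] by (intro AE_I2) (auto intro!: power_mono)
  qed
qed

text \<open>Fubini together with the symmetry \<open>cnj_K\<close>. The exchange of integrals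
  requires absolute convergence, hence the L^2 bound for \<open>absT\<close> and not only for
  \<open>T\<close>.\<close>

lemma T_self_adjoint:
  assumes g: "L2 g" and d: "L2 d"
  shows "(\<integral>z. T g z * cnj (d z) \<partial>\<mu>) = (\<integral>w. g w * cnj (T d w) \<partial>\<mu>)"
proof -
  interpret mu: sigma_finite_measure \<mu> by (rule sigma_finite_\<mu>)
  interpret pair_sigma_finite \<mu> \<mu> ..
  have gm: "g \<in> borel_measurable \<mu>" and dm: "d \<in> borel_measurable \<mu>" using g d by (auto simp: L2_def)
  have nn: "absT g z \<ge> 0" for z unfolding absT_def by (rule Bochner_Integration.integral_nonneg) simp
  define F where "F = (\<lambda>x. K (fst x) (snd x) * g (snd x) * cnj (d (fst x)))"
  have Fm: "F \<in> borel_measurable (\<mu> \<Otimes>\<^sub>M \<mu>)"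
    unfolding F_def
    by (intro borel_measurable_times measurable_K_pair borel_measurable_cnj measurable_compose[OF measurable_snd gm] measurable_compose[OF measurable_fst dm])
  have nF: "(\<integral>w. norm (F (z, w)) \<partial>\<mu>) = absT g z * norm (d z)" for z
    by (simp add: F_def norm_mult absT_def)
  have int: "integrable (\<mu> \<Otimes>\<^sub>M \<mu>) F"
  proof (rule Fubini_integrable[OF Fm])
    have "L2 (\<lambda>z. of_real (absT g z))"
      using absT_square_integrable[OF g] absT_measurable[OF g] by (auto simp: L2_def)
    from L2_integrable_product[OF this d] nn
    show "integrable \<mu> (\<lambda>z. \<integral>w. norm (F (z, w)) \<partial>\<mu>)"
      unfolding nF by simp
    show "AE z in \<mu>. integrable \<mu> (\<lambda>w. F (z, w))"
      using K_integrable[OF _ g] by (intro AE_I2) (auto simp: F_def intro!: integrable_mult_left)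
  qed
  have "(\<integral>z. T g z * cnj (d z) \<partial>\<mu>) = (\<integral>z. \<integral>w. F (z, w) \<partial>\<mu> \<partial>\<mu>)"
    by (simp add: T_def F_def)
  also have "\<dots> = (\<integral>w. \<integral>z. F (z, w) \<partial>\<mu> \<partial>\<mu>)"
    using int by (intro Fubini_integral[symmetric]) simp
  also have "\<dots> = (\<integral>w. g w * cnj (T d w) \<partial>\<mu>)"
  proof (rule Bochner_Integration.integral_cong[OF refl])
    fix w
    have "cnj (T d w) = (\<integral>z. K z w * cnj (d z) \<partial>\<mu>)"
      unfolding T_def Bochner_Integration.integral_cnj[symmetric] by (simp add: cnj_K)
    thus "(\<integral>z. F (z, w) \<partial>\<mu>) = g w * cnj (T d w)"
      by (simp add: F_def mult_ac flip: integral_mult_right_zero)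
  qed
  finally show ?thesis .
qed

text \<open>By self-adjointness the inner product of \<open>T g\<close> with
  \<open>d = T g - h\<close> equals that of \<open>g\<close> with \<open>T d\<close>, so once
  \<open>T\<close> fixes \<open>d\<close> the error \<open>g - T g\<close> is orthogonal to
  \<open>d\<close>.\<close>

lemma Pythagoras_T:
  assumes g: "L2 g" and h: "L2 h" and Td: "\<And>z. z \<in> \<Omega> \<Longrightarrow> T (\<lambda>w. T g w - h w) z = T g z - h z"
  shows "(\<integral>z. (norm (g z - h z))\<^sup>2 \<partial>\<mu>) = (\<integral>z. (norm (g z - T g z))\<^sup>2 \<partial>\<mu>) + (\<integral>z. (norm (T g z - h z))\<^sup>2 \<partial>\<mu>)"
proof -
  define e d where "e = (\<lambda>z. g z - T g z)" and "d = (\<lambda>z. T g z - h z)"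
  have e: "L2 e" and d: "L2 d" unfolding e_def d_def by (intro L2_diff g h L2_T)+
  have prod: "integrable \<mu> (\<lambda>z. u z * cnj (d z))" if u: "L2 u" for u
  proof (rule Bochner_Integration.integrable_bound[OF L2_integrable_product[OF u d]])
    show "(\<lambda>z. u z * cnj (d z)) \<in> borel_measurable \<mu>"
      using u d unfolding L2_def by (intro borel_measurable_times borel_measurable_cnj) auto
  qed (simp add: norm_mult)
  have "(\<integral>z. T g z * cnj (d z) \<partial>\<mu>) = (\<integral>w. g w * cnj (d w) \<partial>\<mu>)"
    unfolding T_self_adjoint[OF g d] using Td by (intro Bochner_Integration.integral_cong) (auto simp: d_def)
  hence orth: "(\<integral>z. e z * cnj (d z) \<partial>\<mu>) = 0"
    unfolding e_def left_diff_distrib using prod[OF g] prod[OF L2_T[OF g]] by simp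
  have ie: "integrable \<mu> (\<lambda>z. (norm (e z))\<^sup>2)" "integrable \<mu> (\<lambda>z. (norm (d z))\<^sup>2)"
    using e d by (auto simp: L2_def)
  have "(norm (g z - h z))\<^sup>2 = (norm (e z))\<^sup>2 + (norm (d z))\<^sup>2 + 2 * Re (e z * cnj (d z))" for z
  proof -
    have "(norm (x + y))\<^sup>2 = (norm x)\<^sup>2 + (norm y)\<^sup>2 + 2 * Re (x * cnj y)" for x y :: complex
      unfolding cmod_power2 by (simp add: power2_eq_square algebra_simps)
    from this[of "e z" "d z"] show ?thesis by (simp add: e_def d_def)
  qed
  hence "(\<integral>z. (norm (g z - h z))\<^sup>2 \<partial>\<mu>) = (\<integral>z. (norm (e z))\<^sup>2 + (norm (d z))\<^sup>2 + 2 * Re (e z * cnj (d z)) \<partial>\<mu>)"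
    by simp
  also have "\<dots> = (\<integral>z. (norm (e z))\<^sup>2 \<partial>\<mu>) + (\<integral>z. (norm (d z))\<^sup>2 \<partial>\<mu>) + 2 * Re (\<integral>z. e z * cnj (d z) \<partial>\<mu>)"
  proof -
    have ir: "integrable \<mu> (\<lambda>z. Re (e z * cnj (d z)))"
      by (rule integrable_Re[OF prod[OF e]])
    have "(\<integral>z. Re (e z * cnj (d z)) \<partial>\<mu>) = Re (\<integral>z. e z * cnj (d z) \<partial>\<mu>)"
      by (rule integral_Re[OF prod[OF e]])
    moreover have "(\<integral>z. (norm (e z))\<^sup>2 + (norm (d z))\<^sup>2 + 2 * Re (e z * cnj (d z)) \<partial>\<mu>)
       = (\<integral>z. (norm (e z))\<^sup>2 + (norm (d z))\<^sup>2 \<partial>\<mu>) + (\<integral>z. 2 * Re (e z * cnj (d z)) \<partial>\<mu>)"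
      by (intro Bochner_Integration.integral_add Bochner_Integration.integrable_add ie integrable_mult_right ir)
    moreover have "(\<integral>z. (norm (e z))\<^sup>2 + (norm (d z))\<^sup>2 \<partial>\<mu>) = (\<integral>z. (norm (e z))\<^sup>2 \<partial>\<mu>) + (\<integral>z. (norm (d z))\<^sup>2 \<partial>\<mu>)"
      by (intro Bochner_Integration.integral_add ie)
    moreover have "(\<integral>z. 2 * Re (e z * cnj (d z)) \<partial>\<mu>) = 2 * (\<integral>z. Re (e z * cnj (d z)) \<partial>\<mu>)"
      by (rule integral_mult_right_zero)
    ultimately show ?thesis by (simp only:)
  qed
  finally show ?thesis using orth by (simp add: e_def d_def)
qed

section \<open>Transfer to the Lebesgue spaces\<close>

lemma measurable_K_times:
  "u \<in> borel_measurable N \<Longrightarrow> id \<in> borel_measurable N \<Longrightarrow> (\<lambda>w. K z w * u w) \<in> borel_measurable N"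
  by (intro borel_measurable_times measurable_K borel_measurable_const) (simp_all add: id_def)

lemma measurable_abs_K_times:
  assumes [measurable]: "u \<in> borel_measurable N" and id: "id \<in> borel_measurable N"
  shows "(\<lambda>w. abs_kernel K z w * u w) \<in> borel_measurable N"
proof -
  have [measurable]: "(\<lambda>w. K z w) \<in> borel_measurable N"
    using id by (intro measurable_K borel_measurable_const) (simp add: id_def)
  show ?thesis unfolding abs_kernel_def by measurable
qed

text \<open>Changing the argument on a null set does not change any of the integrals, so the
  equality holds at every point, without an exceptional set.\<close>

lemma integral_operator_eq_T:
  assumes "f \<in> borel_measurable LB" "rep f g"
  shows "integral_operator \<Omega> K f = T g"
proof
  fix z
  show "integral_operator \<Omega> K f z = T g z"
    unfolding integral_operator_def T_def
    by (rule rep_integral(1)[OF assms(2,1), where h="\<lambda>w u. K z w * u", OF measurable_K_times])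
qed

lemma Lp_rep_L2:
  assumes f: "f \<in> Lp_space r \<Omega>" and r: "r \<ge> 2" and g: "rep f g"
  shows "L2 g" "integrable \<mu> (\<lambda>w. norm (g w) powr r)" "f \<in> borel_measurable LB"
proof -
  show fm: "f \<in> borel_measurable LB" using f by (simp add: Lp_space_def)
  show i: "integrable \<mu> (\<lambda>w. norm (g w) powr r)" using rep_powr(1)[OF fm g] f by simp
  show "L2 g" using g by (intro integrable_powr_imp_L2[OF r _ i]) (simp add: rep_def)
qed

text \<open>Holomorphic functions are continuous on the domain, hence Borel there, and can serve as
  their own representatives.\<close>

lemma bergman_props:
  assumes h: "h \<in> bergman_space r \<Omega>" and r: "r \<ge> 2"
  shows "\<And>z. z \<in> \<Omega> \<Longrightarrow> holo2_at h z" "h \<in> borel_measurable \<mu>" "rep h h" "L2 h"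
    "integrable \<mu> (\<lambda>w. norm (h w) powr r)" "(\<integral>\<^sup>+w. ennreal (norm (h w) powr r) \<partial>\<mu>) < \<infinity>"
proof -
  show holo: "holo2_at h z" if "z \<in> \<Omega>" for z
    using h that by (simp add: bergman_space_def holomorphic2_on_iff_holo2_at[OF open_\<Omega>])
  show m: "h \<in> borel_measurable \<mu>"
    by (intro continuous_on_measurable_\<mu> holo_continuous_on holo)
  show rh: "rep h h" by (rule rep_self[OF m])
  have hL: "h \<in> Lp_space r \<Omega>" using h by (simp add: bergman_space_def)
  show "L2 h" "integrable \<mu> (\<lambda>w. norm (h w) powr r)" by (rule Lp_rep_L2[OF hL r rh])+
  thus "(\<integral>\<^sup>+w. ennreal (norm (h w) powr r) \<partial>\<mu>) < \<infinity>"
    by (subst nn_integral_eq_integral) auto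
qed

lemma bergman_spaceI:
  assumes "\<And>z. z \<in> \<Omega> \<Longrightarrow> holo2_at h z" "integrable \<mu> (\<lambda>w. norm (h w) powr r)"
  shows "h \<in> bergman_space r \<Omega>"
proof -
  have m: "h \<in> borel_measurable \<mu>"
    by (intro continuous_on_measurable_\<mu> holo_continuous_on assms)
  have "h \<in> Lp_space r \<Omega>"
    using rep_powr(1)[OF measurable_LB[OF m] rep_self[OF m]] assms(2) by simp
  thus ?thesis
    using assms(1) by (simp add: bergman_space_def holomorphic2_on_iff_holo2_at[OF open_\<Omega>])
qed

lemma T_Lp:
  assumes r: "r \<ge> 2" and kr: "real k * r < 2 * real (m + n)"
  shows "\<exists>C>0. \<forall>g. L2 g \<longrightarrow> integrable \<mu> (\<lambda>w. norm (g w) powr r) \<longrightarrow>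
    T g \<in> bergman_space r \<Omega> \<and> Lp_norm r \<Omega> (T g) \<le> C * (\<integral>w. norm (g w) powr r \<partial>\<mu>) powr (1 / r)"
proof -
  obtain C where C: "C > 0" "\<And>g u. L2 g \<Longrightarrow> integrable \<mu> (\<lambda>w. norm (g w) powr r) \<Longrightarrow> u \<in> borel_measurable \<mu> \<Longrightarrow>
     (\<forall>z\<in>\<Omega>. 0 \<le> u z \<and> u z \<le> absT g z) \<Longrightarrow>
     integrable \<mu> (\<lambda>z. u z powr r) \<and> (\<integral>z. u z powr r \<partial>\<mu>) \<le> C * (\<integral>w. norm (g w) powr r \<partial>\<mu>)"
    using kernel_Lp_integrable[OF r kr] by blast
  have "T g \<in> bergman_space r \<Omega> \<and> Lp_norm r \<Omega> (T g) \<le> C powr (1 / r) * (\<integral>w. norm (g w) powr r \<partial>\<mu>) powr (1 / r)"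
    if g: "L2 g" "integrable \<mu> (\<lambda>w. norm (g w) powr r)" for g
  proof -
    have "(\<lambda>z. norm (T g z)) \<in> borel_measurable \<mu>"
      using T_measurable[OF g(1)] by measurable
    from C(2)[OF g this] norm_T_le[OF _ g(1)]
    have i: "integrable \<mu> (\<lambda>z. norm (T g z) powr r)"
      and b: "(\<integral>z. norm (T g z) powr r \<partial>\<mu>) \<le> C * (\<integral>w. norm (g w) powr r \<partial>\<mu>)"
      by auto
    have "Lp_norm r \<Omega> (T g) = (\<integral>z. norm (T g z) powr r \<partial>\<mu>) powr (1 / r)"
      by (rule rep_powr(2)[OF measurable_LB[OF T_measurable[OF g(1)]] rep_self[OF T_measurable[OF g(1)]]])
    also have "\<dots> \<le> (C * (\<integral>w. norm (g w) powr r \<partial>\<mu>)) powr (1 / r)"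
      using r b by (intro powr_mono2) (auto intro: Bochner_Integration.integral_nonneg)
    finally show ?thesis
      using bergman_spaceI[OF T_holo2[OF _ g(1)] i] by (simp add: powr_mult)
  qed
  thus ?thesis using C(1) by (intro exI[of _ "C powr (1 / r)"]) auto
qed

lemma bounded_linear_projection: "bounded_linear_L2_A2 \<Omega> (integral_operator \<Omega> K)"
proof -
  obtain C where C: "C > 0" "\<And>g. L2 g \<Longrightarrow> integrable \<mu> (\<lambda>w. norm (g w) powr 2) \<Longrightarrow>
    T g \<in> bergman_space 2 \<Omega> \<and> Lp_norm 2 \<Omega> (T g) \<le> C * (\<integral>w. norm (g w) powr 2 \<partial>\<mu>) powr (1 / 2)"
    using T_Lp[OF order_refl k_two] by blast
  have int: "integrable LB (\<lambda>w. K z w * f w)" if f: "f \<in> Lp_space 2 \<Omega>" and z: "z \<in> \<Omega>" for f z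
  proof -
    obtain g where g: "rep f g" using ex_rep[OF f] by blast
    note L = Lp_rep_L2[OF f order_refl g]
    show ?thesis
      by (rule rep_integral(2)[OF g L(3), where h="\<lambda>w u. K z w * u", OF measurable_K_times, THEN iffD2, OF _ _ K_integrable[OF z L(1)]])
  qed
  have bd: "integral_operator \<Omega> K f \<in> bergman_space 2 \<Omega> \<and> Lp_norm 2 \<Omega> (integral_operator \<Omega> K f) \<le> C * Lp_norm 2 \<Omega> f"
    if f: "f \<in> Lp_space 2 \<Omega>" for f
  proof -
    obtain g where g: "rep f g" using ex_rep[OF f] by blast
    note L = Lp_rep_L2[OF f order_refl g]
    show ?thesis
      using C(2)[OF L(1,2)] rep_powr(2)[OF L(3) g, of 2] by (simp only: integral_operator_eq_T[OF L(3) g])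
  qed
  have add: "integral_operator \<Omega> K (\<lambda>w. f w + g w) z = integral_operator \<Omega> K f z + integral_operator \<Omega> K g z"
    if "f \<in> Lp_space 2 \<Omega>" "g \<in> Lp_space 2 \<Omega>" "z \<in> \<Omega>" for f g z
    unfolding integral_operator_def distrib_left
    by (intro Bochner_Integration.integral_add int that)
  have scale: "integral_operator \<Omega> K (\<lambda>w. c * f w) z = c * integral_operator \<Omega> K f z" for c f z
  proof -
    have "(\<lambda>w. K z w * (c * f w)) = (\<lambda>w. c * (K z w * f w))" by (simp add: mult.left_commute)
    thus ?thesis unfolding integral_operator_def by (simp only: integral_mult_right_zero)
  qed
  show ?thesis
    unfolding bounded_linear_L2_A2_def
  proof (intro conjI ballI allI)
    show "\<exists>C>0. \<forall>f\<in>Lp_space 2 \<Omega>. Lp_norm 2 \<Omega> (integral_operator \<Omega> K f) \<le> C * Lp_norm 2 \<Omega> f"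
      using bd C(1) by blast
  qed (rule add scale bd[THEN conjunct1]; assumption)+
qed

lemma has_integral_kernel: "has_integral_kernel_L2 \<Omega> (integral_operator \<Omega> K) K"
  unfolding has_integral_kernel_L2_def
proof (intro conjI ballI)
  let ?B = "borel :: ((complex \<times> complex) \<times> (complex \<times> complex)) measure"
  have "fst \<in> borel_measurable ?B" "snd \<in> borel_measurable ?B"
    by (intro borel_measurable_continuous_onI continuous_on_fst continuous_on_snd continuous_on_id)+
  from measurable_K[OF this] have "(\<lambda>x. K (fst x) (snd x)) \<in> borel_measurable lborel"
    unfolding measurable_cong_sets[OF sets_lborel refl] .
  from measurable_restrict_space1[OF measurable_completion[OF this]]
  show "(\<lambda>(z, w). K z w) \<in> borel_measurable (lebesgue_on (\<Omega> \<times> \<Omega>))"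
    by (simp only: case_prod_unfold)
  fix f z assume f: "f \<in> Lp_space 2 \<Omega>" and z: "z \<in> \<Omega>"
  obtain g where g: "rep f g" using ex_rep[OF f] by blast
  note L = Lp_rep_L2[OF f order_refl g]
  show "integrable LB (\<lambda>w. K z w * f w)"
    by (rule rep_integral(2)[OF g L(3), where h="\<lambda>w u. K z w * u", OF measurable_K_times, THEN iffD2, OF _ _ K_integrable[OF z L(1)]])
  show "integral_operator \<Omega> K f z = integral_operator \<Omega> K f z" ..
qed

lemma abs_kernel_bounded:
  assumes r: "r \<ge> 2" and kr: "real k * r < 2 * real (m + n)"
  shows "integral_operator_bounded_Lp r \<Omega> (abs_kernel K)"
proof -
  obtain C where C: "C > 0" "\<And>g u. L2 g \<Longrightarrow> integrable \<mu> (\<lambda>w. norm (g w) powr r) \<Longrightarrow> u \<in> borel_measurable \<mu> \<Longrightarrow>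
     (\<forall>z\<in>\<Omega>. 0 \<le> u z \<and> u z \<le> absT g z) \<Longrightarrow>
     integrable \<mu> (\<lambda>z. u z powr r) \<and> (\<integral>z. u z powr r \<partial>\<mu>) \<le> C * (\<integral>w. norm (g w) powr r \<partial>\<mu>)"
    using kernel_Lp_integrable[OF r kr] by blast
  have "(AE z in LB. integrable LB (\<lambda>w. abs_kernel K z w * f w)) \<and>
        integral_operator \<Omega> (abs_kernel K) f \<in> Lp_space r \<Omega> \<and>
        Lp_norm r \<Omega> (integral_operator \<Omega> (abs_kernel K) f) \<le> C powr (1 / r) * Lp_norm r \<Omega> f"
    if f: "f \<in> Lp_space r \<Omega>" for f
  proof -
    obtain g where g: "rep f g" using ex_rep[OF f] by blast
    note L = Lp_rep_L2[OF f r g]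
    have gm: "g \<in> borel_measurable \<mu>" using g by (simp add: rep_def)
    define S where "S = (\<lambda>z. \<integral>w. abs_kernel K z w * g w \<partial>\<mu>)"
    have op: "integral_operator \<Omega> (abs_kernel K) f = S"
    proof
      fix z
      show "integral_operator \<Omega> (abs_kernel K) f z = S z"
        unfolding integral_operator_def S_def
        by (rule rep_integral(1)[OF g L(3), where h="\<lambda>w u. abs_kernel K z w * u", OF measurable_abs_K_times])
    qed
    have nK: "norm (abs_kernel K z w * g w) = norm (K z w) * norm (g w)" for z w
      by (simp add: abs_kernel_def norm_mult)
    have Sm: "S \<in> borel_measurable \<mu>"
      unfolding S_def abs_kernel_def
    proof (rule measurable_kernel_integral)
      note [measurable] = measurable_K_pair measurable_compose[OF measurable_snd gm]
      show "(\<lambda>x. of_real (norm (K (fst x) (snd x))) * g (snd x)) \<in> borel_measurable (\<mu> \<Otimes>\<^sub>M \<mu>)"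
        by measurable
    qed
    have id: "id \<in> borel_measurable \<mu>" unfolding id_def by (rule measurable_restrict_lborel_id)
    have int: "integrable LB (\<lambda>w. abs_kernel K z w * f w)" if z: "z \<in> \<Omega>" for z
    proof -
      have "integrable \<mu> (\<lambda>w. abs_kernel K z w * g w)"
        by (rule Bochner_Integration.integrable_bound[OF abs_K_integrable[OF z L(1)] measurable_abs_K_times[OF gm id]])
          (simp add: nK)
      thus ?thesis
        by (rule rep_integral(2)[OF g L(3), where h="\<lambda>w u. abs_kernel K z w * u", OF measurable_abs_K_times, THEN iffD2, rotated 2])
    qed
    have "norm (S z) \<le> absT g z" for z
      unfolding S_def absT_def using integral_norm_bound[of \<mu> "\<lambda>w. abs_kernel K z w * g w"] by (simp add: nK)
    moreover have "(\<lambda>z. norm (S z)) \<in> borel_measurable \<mu>" using Sm by measurable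
    ultimately have i: "integrable \<mu> (\<lambda>z. norm (S z) powr r)"
      and b: "(\<integral>z. norm (S z) powr r \<partial>\<mu>) \<le> C * (\<integral>w. norm (g w) powr r \<partial>\<mu>)"
      using C(2)[OF L(1,2), of "\<lambda>z. norm (S z)"] by auto
    have "S \<in> Lp_space r \<Omega>"
      using rep_powr(1)[OF measurable_LB[OF Sm] rep_self[OF Sm]] i by simp
    moreover have "Lp_norm r \<Omega> S \<le> C powr (1 / r) * Lp_norm r \<Omega> f"
    proof -
      have "Lp_norm r \<Omega> S = (\<integral>z. norm (S z) powr r \<partial>\<mu>) powr (1 / r)"
        by (rule rep_powr(2)[OF measurable_LB[OF Sm] rep_self[OF Sm]])
      also have "\<dots> \<le> (C * (\<integral>w. norm (g w) powr r \<partial>\<mu>)) powr (1 / r)"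
        using r b by (intro powr_mono2) (auto intro: Bochner_Integration.integral_nonneg)
      also have "\<dots> = C powr (1 / r) * Lp_norm r \<Omega> f"
        unfolding rep_powr(2)[OF L(3) g] by (simp add: powr_mult)
      finally show ?thesis .
    qed
    ultimately show ?thesis
      unfolding op using int by (auto intro!: AE_I2)
  qed
  thus ?thesis
    unfolding integral_operator_bounded_Lp_def using C(1) by (intro exI[of _ "C powr (1 / r)"]) auto
qed

lemma bergman_reproducing:
  assumes r: "r \<ge> 2" and kr: "2 * real (m + n) \<le> (real k + 1) * r"
    and h: "h \<in> bergman_space r \<Omega>" and z: "z \<in> \<Omega>"
  shows "T h z = h z"
  using bergman_props[OF h r] r by (intro T_reproducing[OF _ _ _ _ kr z]) auto

lemma best_approximation:
  assumes r: "r \<ge> 2" and kr: "real k * r < 2 * real (m + n)" "2 * real (m + n) \<le> (real k + 1) * r"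
    and f: "f \<in> Lp_space r \<Omega>" and h: "h \<in> bergman_space r \<Omega>"
  defines "P \<equiv> integral_operator \<Omega> K"
  shows "Lp_norm 2 \<Omega> (\<lambda>z. f z - P f z) \<le> Lp_norm 2 \<Omega> (\<lambda>z. f z - h z)"
    and "Lp_norm 2 \<Omega> (\<lambda>z. f z - P f z) = Lp_norm 2 \<Omega> (\<lambda>z. f z - h z) \<Longrightarrow> \<forall>z\<in>\<Omega>. h z = P f z"
proof -
  obtain g where g: "rep f g" using ex_rep[OF f] by blast
  note L = Lp_rep_L2[OF f r g]
  have P: "P f = T g" unfolding P_def by (rule integral_operator_eq_T[OF L(3) g])
  note H = bergman_props[OF h r]
  have Tb: "T g \<in> bergman_space r \<Omega>" using T_Lp[OF r kr(1)] L by blast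
  have Td: "T (\<lambda>w. T g w - h w) z = T g z - h z" if z: "z \<in> \<Omega>" for z
  proof -
    have "T (\<lambda>w. T g w - h w) z = T (T g) z - T h z"
      unfolding T_def[of "\<lambda>w. T g w - h w"] T_def[of "T g"] T_def[of h] right_diff_distrib
      by (intro Bochner_Integration.integral_diff K_integrable z L2_T L(1) H(4))
    thus ?thesis using bergman_reproducing[OF r kr(2) Tb z] bergman_reproducing[OF r kr(2) h z] by simp
  qed
  note Pyth = Pythagoras_T[OF L(1) H(4) Td]
  have norm_eq: "Lp_norm 2 \<Omega> (\<lambda>z. f z - u z) = (\<integral>z. (norm (g z - u z))\<^sup>2 \<partial>\<mu>) powr (1 / 2)"
    if u: "u \<in> borel_measurable \<mu>" for u
  proof -
    have gm: "g \<in> borel_measurable \<mu>" using g by (simp add: rep_def)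
    have "rep (\<lambda>z. f z - u z) (\<lambda>z. g z - u z)"
      using g borel_measurable_diff[OF gm u] unfolding rep_def by (auto elim: eventually_mono)
    from rep_powr(2)[OF borel_measurable_diff[OF L(3) measurable_LB[OF u]] this, of 2]
    show ?thesis by simp
  qed
  have T_m: "T g \<in> borel_measurable \<mu>" by (rule T_measurable[OF L(1)])
  define a where "a = (\<integral>z. (norm (g z - T g z))\<^sup>2 \<partial>\<mu>)"
  define b where "b = (\<integral>z. (norm (T g z - h z))\<^sup>2 \<partial>\<mu>)"
  have ab: "a \<ge> 0" "b \<ge> 0" unfolding a_def b_def by (auto intro: Bochner_Integration.integral_nonneg)
  have n1: "Lp_norm 2 \<Omega> (\<lambda>z. f z - P f z) = a powr (1 / 2)"
    unfolding P a_def by (rule norm_eq[OF T_m])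
  have n2: "Lp_norm 2 \<Omega> (\<lambda>z. f z - h z) = (a + b) powr (1 / 2)"
    unfolding norm_eq[OF H(2)] a_def b_def using Pyth by simp
  show "Lp_norm 2 \<Omega> (\<lambda>z. f z - P f z) \<le> Lp_norm 2 \<Omega> (\<lambda>z. f z - h z)"
    unfolding n1 n2 using ab by (intro powr_mono2) auto
  assume "Lp_norm 2 \<Omega> (\<lambda>z. f z - P f z) = Lp_norm 2 \<Omega> (\<lambda>z. f z - h z)"
  hence "sqrt a = sqrt (a + b)"
    unfolding n1 n2 using ab by (simp add: powr_half_sqrt)
  hence "b = 0" by simp
  moreover have "integrable \<mu> (\<lambda>z. (norm (T g z - h z))\<^sup>2)"
    using L2_diff[OF L2_T[OF L(1)] H(4)] by (simp add: L2_def)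
  ultimately have "AE z in \<mu>. (norm (T g z - h z))\<^sup>2 = 0"
    unfolding b_def by (subst (asm) integral_nonneg_eq_0_iff_AE) auto
  hence ae: "AE z in \<mu>. T g z - h z = 0" by eventually_elim simp
  show "\<forall>z\<in>\<Omega>. h z = P f z"
  proof
    fix z assume z: "z \<in> \<Omega>"
    \<comment> \<open>Equality of norms gives \<open>T g = h\<close> only almost everywhere. Since
      \<open>T\<close> fixes the difference and an integral ignores null sets, the difference
      vanishes at every point.\<close>
    have "T (\<lambda>w. T g w - h w) z = 0"
      unfolding T_def[of "\<lambda>w. T g w - h w"] by (rule integral_eq_zero_AE) (use ae in eventually_elim, simp)
    thus "h z = P f z" using Td[OF z] by (simp add: P)
  qed
qed

end

theorem theorem0p4:
  fixes m n :: nat and p :: real and \<Omega> :: "(complex \<times> complex) set"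
  assumes "m > 0" and "n > 0" and "coprime m n" and "2 \<le> p"
  defines "\<Omega> \<equiv> rational_hartogs m n"
  shows "\<exists>P K.
     bounded_linear_L2_A2 \<Omega> P \<and>
     has_integral_kernel_L2 \<Omega> P K \<and>
     integral_operator_bounded_Lp p \<Omega> (abs_kernel K) \<and>
     (\<forall>h\<in>bergman_space p \<Omega>. \<forall>z\<in>\<Omega>. P h z = h z) \<and>
     (\<forall>g\<in>Lp_space p \<Omega>.
        P g \<in> bergman_space p \<Omega> \<and>
        (\<forall>h\<in>bergman_space p \<Omega>.
           Lp_norm 2 \<Omega> (\<lambda>z. g z - P g z) \<le> Lp_norm 2 \<Omega> (\<lambda>z. g z - h z) \<and>
           (Lp_norm 2 \<Omega> (\<lambda>z. g z - P g z) = Lp_norm 2 \<Omega> (\<lambda>z. g z - h z)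
              \<longrightarrow> (\<forall>z\<in>\<Omega>. h z = P g z))))"
proof -
  \<comment> \<open>The largest integer strictly below \<open>2 * (m + n) / p\<close>. The floor
    would be one too large when the quotient is an integer, and then
    \<open>k * p < 2 * (m + n)\<close> would fail.\<close>
  define k where "k = nat (\<lceil>2 * real (m + n) / p\<rceil> - 1)"
  have "2 * real (m + n) / p > 0" using assms by simp
  hence "real k = of_int \<lceil>2 * real (m + n) / p\<rceil> - 1"
    by (simp add: k_def of_nat_nat)
  hence "real k < 2 * real (m + n) / p" "2 * real (m + n) / p \<le> real k + 1"
    by linarith+
  hence kp: "real k * p < 2 * real (m + n)" "2 * real (m + n) \<le> (real k + 1) * p"
    using assms by (auto simp: field_simps)
  \<comment> \<open>Here \<open>p \<ge> 2\<close> yields the locale assumption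
    \<open>k < m + n\<close>.\<close>
  have "real k * 2 \<le> real k * p" using assms by (intro mult_left_mono) auto
  hence "real k * 2 < 2 * real (m + n)" by (rule le_less_trans[OF _ kp(1)])
  hence "real k < real (m + n)" by simp
  hence "k < m + n" by (simp only: of_nat_less_iff)
  then interpret hartogs m n k using assms by unfold_locales
  let ?P = "integral_operator \<Omega> K"
  have 1: "?P h z = h z" if h: "h \<in> bergman_space p \<Omega>" and z: "z \<in> \<Omega>" for h z
  proof -
    note h' = h[unfolded \<Omega>_def] and z' = z[unfolded \<Omega>_def]
    note H = bergman_props[OF h' assms(4)]
    show ?thesis
      using integral_operator_eq_T[OF measurable_LB[OF H(2)] H(3)] bergman_reproducing[OF assms(4) kp(2) h' z']
      by (simp add: \<Omega>_def)
  qed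
  have 2: "?P g \<in> bergman_space p \<Omega>" if g: "g \<in> Lp_space p \<Omega>" for g
  proof -
    note g' = g[unfolded \<Omega>_def]
    obtain g0 where r: "rep g g0" using ex_rep[OF g'] by blast
    note L = Lp_rep_L2[OF g' assms(4) r]
    show ?thesis
      using T_Lp[OF assms(4) kp(1)] L integral_operator_eq_T[OF L(3) r] by (auto simp: \<Omega>_def)
  qed
  have 3: "Lp_norm 2 \<Omega> (\<lambda>z. g z - ?P g z) \<le> Lp_norm 2 \<Omega> (\<lambda>z. g z - h z) \<and>
      (Lp_norm 2 \<Omega> (\<lambda>z. g z - ?P g z) = Lp_norm 2 \<Omega> (\<lambda>z. g z - h z) \<longrightarrow> (\<forall>z\<in>\<Omega>. h z = ?P g z))"
    if "g \<in> Lp_space p \<Omega>" "h \<in> bergman_space p \<Omega>" for g h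
    using best_approximation[OF assms(4) kp that[unfolded \<Omega>_def]] unfolding \<Omega>_def by blast
  show ?thesis
  proof (intro exI[of _ ?P] exI[of _ K] conjI ballI)
    show "bounded_linear_L2_A2 \<Omega> ?P" unfolding \<Omega>_def by (rule bounded_linear_projection)
    show "has_integral_kernel_L2 \<Omega> ?P K" unfolding \<Omega>_def by (rule has_integral_kernel)
    show "integral_operator_bounded_Lp p \<Omega> (abs_kernel K)"
      unfolding \<Omega>_def by (rule abs_kernel_bounded[OF assms(4) kp(1)])
  qed (use 1 2 3 in blast)+
qed

end
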